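(* Let $(M,d)$ be a metric space, let $f:M\to M$ be a Lipschitz transformation (possibly non-invertible) preserving an ergodic Borel probability measure $\mu$, and let $A:M\to GL(d,\mathbb{R})$ be a $\nu$-Hölder cocycle over $f$ such that both $\log\|A(x)\|$ and $\log\|A(x)^{-1}\|$ are $\mu$-integrable. Denote by $\chi_1<\dots<\chi_k$ the $k$ distinct Lyapunov exponents of this cocycle, and by $F^i_x$, $i=1,\dots,k$, the subspaces of the Oseledets filtration of $\mathbb{R}^d$ corresponding to $\chi_i$, defined for $\mu$-almost every $x\in M$. Then, for every $\epsilon>0$, there exist a compact subset $\Lambda_\epsilon$ of $M$ and constants $C_\epsilon=C(\Lambda_\epsilon)>0$, $\omega_i=\omega_i(\chi_1,\dots,\chi_k)\in(0,1)$, $i=1,\dots,k$, and $\delta=\delta(\epsilon,A,\Lambda_\epsilon,\chi_1,\dots,\chi_k)>0$ such that (1) $\mu(\Lambda_\epsilon)\ge 1-\epsilon$; (2) for all $x,y\in\Lambda_\epsilon$ with $d(x,y)<\delta$ and all $i=1,\dots,k$ we have $\operatorname{dist}(F^i_x,F^i_y)\le C_\epsilon\, d(x,y)^{\nu\omega_i}$. Moreover, if $f$ is also invertible, then, letting $E^i_x$ be the Oseledets subspaces corresponding to $\chi_i$, $i=1,\dots,k$, which form a splitting $\mathbb{R}^d=E^1_x\oplus\dots\oplus E^k_x$ for $\mu$-almost every $x\in M$, we also have (3) $\operatorname{dist}(E^i_x,E^i_y)\le C_\epsilon\, d(x,y)^{\nu\omega_i}$ for all $i=1,\dots,k$ and all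 $x,y\in\Lambda_\epsilon$ with $d(x,y)<\delta$.
   Context: The letter $d$ denotes both the distance on $M$ and the dimension of $\mathbb{R}^d$. $\|\cdot\|$ is a Euclidean norm on $\mathbb{R}^d$ and the associated norm on $d\times d$ matrices. Hölder cocycle: $A:M\to GL(d,\mathbb{R})$ is $\nu$-Hölder if there is $H>0$ with $\|A(x)-A(y)\|\le H\,d(x,y)^\nu$ for all $x,y\in M$ ($M$ is not assumed compact). Put $A^n(x)=A(f^{n-1}(x))\cdots A(f(x))A(x)$ for $n\ge 1$, $A^0(x)=\mathrm{Id}$, and, if $f$ is invertible, $A^{-n}(x)=A(f^{-n}(x))^{-1}\cdots A(f^{-1}(x))^{-1}$ for $n>0$. Oseledets filtration: by Oseledets' theorem and ergodicity there are numbers $\chi_1<\dots<\chi_k$ (the Lyapunov exponents) and, for $\mu$-a.e. $x$, a measurable filtration $\{0\}=F^0_x\subset F^1_x\subset\dots\subset F^k_x=\mathbb{R}^d$ with $A(x)F^i_x=F^i_{f(x)}$ and $\lim_{n\to\infty}\frac1n\log\|A^n(x)v\|=\chi_i$ for all $v\in F^i_x\setminus F^{i-1}_x$, $i=1,\dots,k$. Oseledets splitting: if $f$ is invertible, for $\mu$-a.e. $x$ there is a splitting $\mathbb{R}^d=E^1_x\oplus\dots\oplus E^k_x$ with $A(x)E^i_x=E^i_{f(x)}$ and $\lim_{n\to\pm\infty}\frac1n\log\|A^n(x)v\|=\chi_i$ for all $0\ne v\in E^i_x$. Distance of subspaces: $\operatorname{dist}(v,E)=\min_{w\in E}\|v-w\|$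 and $\operatorname{dist}(E,F)=\max\{\sup_{v\in E,\|v\|=1}\operatorname{dist}(v,F),\ \sup_{v\in F,\|v\|=1}\operatorname{dist}(v,E)\}$.
   Formalization: Two hypotheses are added, since the claim fails without them: μ is tight (compact sets have measure arbitrarily close to 1), and in (3) "invertible" means that f is bijective with Lipschitz inverse. The ω_i depend on f and ν as well as on the exponents. *)

theory Defs
  imports "HOL-Probability.Probability"
begin

definition ergodic_borel_prob :: "('m::topological_space \<Rightarrow> 'm) \<Rightarrow> 'm measure \<Rightarrow> bool" where
  "ergodic_borel_prob f \<mu> \<longleftrightarrow>
     prob_space \<mu> \<and> sets \<mu> = sets borel \<and>
     f \<in> measurable \<mu> \<mu> \<and> distr \<mu> \<mu> f = \<mu> \<and>
     (\<forall>B\<in>sets \<mu>. f -` B = B \<longrightarrow> measure \<mu> B = 0 \<or> measure \<mu> B = 1)"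

text \<open>Automatic for Borel probability measures on complete separable metric spaces, but not on
  arbitrary metric spaces, where all compact sets may be null.\<close>

definition tight_measure :: "'m::topological_space measure \<Rightarrow> bool" where
  "tight_measure \<mu> \<longleftrightarrow> (\<forall>e>0. \<exists>K. compact K \<and> measure \<mu> K \<ge> 1 - e)"

text \<open>The library norm on \<^typ>\<open>real^'d^'d\<close> is the Frobenius norm; the norm associated with
  the Euclidean norm on vectors is the operator norm.\<close>

definition opnorm :: "real^'d^'d \<Rightarrow> real" where
  "opnorm B = onorm (\<lambda>v. B *v v)"

definition hoelder_cocycle :: "real \<Rightarrow> ('m::metric_space \<Rightarrow> real^'d^'d) \<Rightarrow> bool" where
  "hoelder_cocycle \<nu> A \<longleftrightarrow>
     (\<forall>x. invertible (A x)) \<and>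
     (\<exists>H>0. \<forall>x y. opnorm (A x - A y) \<le> H * dist x y powr \<nu>)"

primrec cocycle_fwd :: "('m \<Rightarrow> 'm) \<Rightarrow> ('m \<Rightarrow> real^'d^'d) \<Rightarrow> nat \<Rightarrow> 'm \<Rightarrow> real^'d^'d" where
  "cocycle_fwd f A 0 x = mat 1"
| "cocycle_fwd f A (Suc n) x = A ((f ^^ n) x) ** cocycle_fwd f A n x"

primrec cocycle_bwd :: "('m \<Rightarrow> 'm) \<Rightarrow> ('m \<Rightarrow> real^'d^'d) \<Rightarrow> nat \<Rightarrow> 'm \<Rightarrow> real^'d^'d" where
  "cocycle_bwd f A 0 x = mat 1"
| "cocycle_bwd f A (Suc n) x = matrix_inv (A ((inv f ^^ Suc n) x)) ** cocycle_bwd f A n x"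

text \<open>Meaningful at negative times only when \<open>f\<close> is bijective.\<close>

definition cocycle :: "('m \<Rightarrow> 'm) \<Rightarrow> ('m \<Rightarrow> real^'d^'d) \<Rightarrow> int \<Rightarrow> 'm \<Rightarrow> real^'d^'d" where
  "cocycle f A n x =
     (if n \<ge> 0 then cocycle_fwd f A (nat n) x else cocycle_bwd f A (nat (- n)) x)"

text \<open>Measurability of a map into the Grassmannian is expressed through the distance functions
  of the subspaces; the completion is used because the subspaces are determined only almost
  everywhere.\<close>

definition measurable_subspaces :: "'m measure \<Rightarrow> ('m \<Rightarrow> (real^'d) set) \<Rightarrow> bool" where
  "measurable_subspaces \<mu> V \<longleftrightarrow>
     (\<forall>v. (\<lambda>x. infdist v (V x)) \<in> borel_measurable (completion \<mu>))"

definition oseledets_filtration_at ::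
    "('m \<Rightarrow> 'm) \<Rightarrow> ('m \<Rightarrow> real^'d^'d) \<Rightarrow> nat \<Rightarrow> (nat \<Rightarrow> real) \<Rightarrow> (nat \<Rightarrow> 'm \<Rightarrow> (real^'d) set)
      \<Rightarrow> 'm \<Rightarrow> bool" where
  "oseledets_filtration_at f A k lyap F x \<longleftrightarrow>
     (\<forall>i\<le>k. subspace (F i x)) \<and>
     F 0 x = {0} \<and> F k x = UNIV \<and> (\<forall>i<k. F i x \<subset> F (Suc i) x) \<and>
     (\<forall>i\<le>k. (\<lambda>v. A x *v v) ` F i x = F i (f x)) \<and>
     (\<forall>i\<in>{1..k}. \<forall>v \<in> F i x - F (i - 1) x.
        (\<lambda>n. ln (norm (cocycle_fwd f A n x *v v)) / real n) \<longlonglongrightarrow> lyap i)"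

definition oseledets_filtration ::
    "'m measure \<Rightarrow> ('m \<Rightarrow> 'm) \<Rightarrow> ('m \<Rightarrow> real^'d^'d) \<Rightarrow> nat \<Rightarrow> (nat \<Rightarrow> real)
      \<Rightarrow> (nat \<Rightarrow> 'm \<Rightarrow> (real^'d) set) \<Rightarrow> bool" where
  "oseledets_filtration \<mu> f A k lyap F \<longleftrightarrow>
     strict_mono_on {1..k} lyap \<and>
     (\<forall>i\<le>k. measurable_subspaces \<mu> (F i)) \<and>
     (AE x in \<mu>. oseledets_filtration_at f A k lyap F x)"

definition oseledets_splitting_at ::
    "('m \<Rightarrow> 'm) \<Rightarrow> ('m \<Rightarrow> real^'d^'d) \<Rightarrow> nat \<Rightarrow> (nat \<Rightarrow> real) \<Rightarrow> (nat \<Rightarrow> 'm \<Rightarrow> (real^'d) set)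
      \<Rightarrow> 'm \<Rightarrow> bool" where
  "oseledets_splitting_at f A k lyap E x \<longleftrightarrow>
     (\<forall>i\<in>{1..k}. subspace (E i x)) \<and>
     (\<forall>v. \<exists>!u. u \<in> (\<Pi>\<^sub>E i\<in>{1..k}. E i x) \<and> v = (\<Sum>i=1..k. u i)) \<and>
     (\<forall>i\<in>{1..k}. (\<lambda>v. A x *v v) ` E i x = E i (f x)) \<and>
     (\<forall>i\<in>{1..k}. \<forall>v \<in> E i x - {0}.
        ((\<lambda>n. ln (norm (cocycle f A n x *v v)) / real_of_int n) \<longlongrightarrow> lyap i) at_top \<and>
        ((\<lambda>n. ln (norm (cocycle f A n x *v v)) / real_of_int n) \<longlongrightarrow> lyap i) at_bot)"

definition oseledets_splitting ::
    "'m measure \<Rightarrow> ('m \<Rightarrow> 'm) \<Rightarrow> ('m \<Rightarrow> real^'d^'d) \<Rightarrow> nat \<Rightarrow> (nat \<Rightarrow> real)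
      \<Rightarrow> (nat \<Rightarrow> 'm \<Rightarrow> (real^'d) set) \<Rightarrow> bool" where
  "oseledets_splitting \<mu> f A k lyap E \<longleftrightarrow>
     strict_mono_on {1..k} lyap \<and> (AE x in \<mu>. oseledets_splitting_at f A k lyap E x)"

text \<open>To be used for nonzero subspaces only: for the zero subspace the supremum is taken over the
  empty set and is unspecified. For a subspace the infimum in \<^const>\<open>infdist\<close> is attained.\<close>

definition subspace_dist :: "(real^'d) set \<Rightarrow> (real^'d) set \<Rightarrow> real" where
  "subspace_dist V W =
     max (SUP v\<in>{v\<in>V. norm v = 1}. infdist v W) (SUP v\<in>{v\<in>W. norm v = 1}. infdist v V)"

end

theory Submission
  imports Defs
begin

text \<open>Off a set of small measure, all vectors of a subspace of the Oseledets filtration grow at a rate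
  close to its exponent and all vectors orthogonal to it grow at a rate close to the next exponent,
  with uniform constants. The cocycles at two nearby points stay close for a time proportional to
  the logarithm of their distance; hence a unit vector of \<open>F i x\<close>, which grows slowly under the
  cocycle at \<open>x\<close>, grows slowly for that long also under the cocycle at \<open>y\<close> and must therefore be
  close to \<open>F i y\<close>.

  The uniform growth rates are deduced from the pointwise ones without the multiplicative or the
  subadditive ergodic theorem: an orbit segment is cut greedily into blocks of bounded length on which
  compactness of the sphere provides the required growth, and the few remaining times, where no such
  block starts, are controlled by the one-sided Birkhoff theorem. The Oseledets splitting is the
  intersection of the filtrations of the cocycle and of its inverse.\<close>

section \<open>Ergodic sums and greedy decomposition of orbits\<close>

text \<open>The Oseledets subspaces are given only almost everywhere and are measurable only for the
  completion. They are traded for \<open>growth_space\<close>, the vectors growing at most like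
  \<open>exp (s * n)\<close>: it is defined and strictly invariant at every point, measurable
  without completion, and almost everywhere equal to \<open>F i x\<close> once \<open>s\<close> lies
  strictly inside a spectral gap. The freedom to move \<open>s\<close> inside the gap pays for all
  subexponential losses.

  The exponent comes from a balance. If vectors of the subspace grow at rate at most \<alpha>, the
  quotient at rate at least \<beta> > \<alpha>, and the cocycles over two points at distance d
  separate at rate \<kappa>, then the distance of the subspaces is at most a constant times
  \<open>exp (- \<beta> * n) * (exp (\<alpha> * n) + exp (\<kappa> * n) * d powr \<nu>)\<close> for
  every n. The best n gives the power (\<beta> - \<alpha>) / (\<kappa> - \<alpha>) of
  \<open>d powr \<nu>\<close>. Losses in \<kappa> may be generous, since they only lower this power.
  The three rates are built from the Lyapunov exponents, \<nu> and Lipschitz constants, hence do not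
  depend on \<epsilon>.\<close>

definition (in prob_space) nearly :: "('c \<Rightarrow> 'a \<Rightarrow> bool) \<Rightarrow> bool" where
  "nearly P \<longleftrightarrow> (\<forall>\<delta>>0. \<exists>S\<in>events. \<exists>C. prob S \<ge> 1 - \<delta> \<and> (\<forall>x\<in>S. P C x))"

context prob_space
begin

lemma nearly_mono:
  assumes "nearly P" and "\<And>C. \<exists>C'. \<forall>x. P C x \<longrightarrow> Q C' x"
  shows "nearly Q"
  unfolding nearly_def
proof (intro allI impI)
  fix \<delta> :: real assume "\<delta> > 0"
  then obtain S C where S: "S \<in> events" "prob S \<ge> 1 - \<delta>" "\<forall>x\<in>S. P C x"
    using assms(1) unfolding nearly_def by blast
  obtain C' where "\<forall>x. P C x \<longrightarrow> Q C' x" using assms(2) by blast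
  then show "\<exists>S\<in>events. \<exists>C. prob S \<ge> 1 - \<delta> \<and> (\<forall>x\<in>S. Q C x)"
    using S by (intro bexI[of _ S] exI[of _ C']) auto
qed

lemma prob_Int_ge:
  assumes "S \<in> events" "T \<in> events" "prob S \<ge> 1 - a" "prob T \<ge> 1 - b"
  shows "prob (S \<inter> T) \<ge> 1 - (a + b)"
proof -
  have "prob (S \<union> T) = prob S + prob (T - S)"
    using assms by (simp add: finite_measure_Union')
  moreover have "prob T = prob (T \<inter> S) + prob (T - S)"
    using assms by (simp add: finite_measure_Diff')
  moreover have "prob (S \<union> T) \<le> 1" by simp
  ultimately show ?thesis using assms by (simp add: Int_commute)
qed

text \<open>The constants are kept as a pair, so that several uniform estimates can be collected on
  one set before their constants are merged.\<close>

lemma nearly_conj: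
  assumes "nearly P" "nearly Q"
  shows "nearly (\<lambda>(C, D) x. P C x \<and> Q D x)"
  unfolding nearly_def
proof (intro allI impI)
  fix \<delta> :: real assume "\<delta> > 0"
  then have h: "\<delta> / 2 > 0" by simp
  obtain S C where S: "S \<in> events" "prob S \<ge> 1 - \<delta> / 2" "\<forall>x\<in>S. P C x"
    using assms(1) h unfolding nearly_def by blast
  obtain T D where T: "T \<in> events" "prob T \<ge> 1 - \<delta> / 2" "\<forall>x\<in>T. Q D x"
    using assms(2) h unfolding nearly_def by blast
  show "\<exists>S\<in>events. \<exists>C. prob S \<ge> 1 - \<delta> \<and> (\<forall>x\<in>S. (case C of (C, D) \<Rightarrow> \<lambda>x. P C x \<and> Q D x) x)"
    using S T prob_Int_ge[OF S(1) T(1) S(2) T(2)]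
    by (intro bexI[of _ "S \<inter> T"] exI[of _ "(C, D)"]) auto
qed

text \<open>The sets where \<open>P n\<close> holds increase to a set of full measure, so one of
  them already has measure above \<open>1 - \<delta>\<close>. This is how a constant that is merely
  finite at almost every point becomes uniform.\<close>

lemma nearly_AE_nat:
  fixes P :: "nat \<Rightarrow> 'a \<Rightarrow> bool"
  assumes meas: "\<And>n. {x \<in> space M. P n x} \<in> events"
    and mono: "\<And>n x. P n x \<Longrightarrow> P (Suc n) x"
    and ae: "AE x in M. \<exists>n. P n x"
  shows "nearly P"
  unfolding nearly_def
proof (intro allI impI)
  fix \<delta> :: real assume d: "\<delta> > 0"
  let ?S = "\<lambda>n. {x \<in> space M. P n x}"
  have "incseq ?S" using mono by (intro incseq_SucI) auto
  then have lim: "(\<lambda>n. prob (?S n)) \<longlonglongrightarrow> prob (\<Union>n. ?S n)"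
    using meas by (intro finite_Lim_measure_incseq) auto
  have "prob (\<Union>n. ?S n) = 1"
  proof (rule prob_eq_1[THEN iffD2])
    show "(\<Union>n. ?S n) \<in> events" using meas by auto
    show "AE x in M. x \<in> (\<Union>n. ?S n)" using ae AE_space by eventually_elim auto
  qed
  then have "eventually (\<lambda>n. prob (?S n) > 1 - \<delta>) sequentially"
    using order_tendstoD(1)[OF lim, of "1 - \<delta>"] d by simp
  then obtain n where "prob (?S n) > 1 - \<delta>" by (auto simp: eventually_sequentially)
  then show "\<exists>S\<in>events. \<exists>C. prob S \<ge> 1 - \<delta> \<and> (\<forall>x\<in>S. P C x)"
    using meas[of n] by (intro bexI[of _ "?S n"] exI[of _ n]) auto
qed

lemma nearly_AE:
  assumes "AE x in M. R x"
  shows "nearly (\<lambda>(C::unit) x. R x)"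
  unfolding nearly_def
proof (intro allI impI)
  fix \<delta> :: real assume d: "\<delta> > 0"
  obtain S where S: "S \<subseteq> {x \<in> space M. R x}" "S \<in> events" "prob S = 1"
    by (rule AE_E_prob[OF assms])
  show "\<exists>S\<in>events. \<exists>C::unit. prob S \<ge> 1 - \<delta> \<and> (\<forall>x\<in>S. R x)"
    using S d by (intro bexI[of _ S] exI[of _ "()"]) auto
qed

text \<open>Good sets of measure at least \<open>1 - 1 / (n + 1)\<close> have a union of full
  measure. \<open>nearly_lower\<close> uses this to have the constants of earlier uniform estimates
  at hand at almost every single point.\<close>

lemma AE_of_nearly:
  assumes "nearly P"
  shows "AE x in M. \<exists>C. P C x"
proof -
  have "\<exists>S\<in>events. prob S \<ge> 1 - inverse (Suc n) \<and> (\<forall>x\<in>S. \<exists>C. P C x)" for n :: nat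
    using assms[unfolded nearly_def, rule_format, of "inverse (Suc n)"] by (auto 4 4)
  then obtain S where S: "\<And>n::nat. S n \<in> events" "\<And>n. prob (S n) \<ge> 1 - inverse (Suc n)"
    "\<And>n x. x \<in> S n \<Longrightarrow> \<exists>C. P C x" by metis
  let ?U = "\<Union>n. S n"
  have U: "?U \<in> events" using S(1) by auto
  have "1 - inverse (real (Suc n)) \<le> prob ?U" for n
    using S(1) S(2)[of n] finite_measure_mono[of "S n" ?U] U by (meson UN_upper UNIV_I order_trans)
  moreover have "(\<lambda>n. 1 - inverse (real (Suc n))) \<longlonglongrightarrow> 1"
    using LIMSEQ_inverse_real_of_nat_add_minus[of 1] by simp
  ultimately have "1 \<le> prob ?U" using LIMSEQ_le_const2 by blast
  then have "prob ?U = 1" by (simp add: antisym)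
  then have "AE x in M. x \<in> ?U" using U prob_eq_1 by blast
  then show ?thesis using S(3) by (auto elim: eventually_mono)
qed

end

text \<open>Abstracted from the given map because the splitting requires all estimates a second
  time, for \<open>inv f\<close>.\<close>

locale ergodic_system = prob_space M for M :: "'a measure" +
  fixes f :: "'a \<Rightarrow> 'a"
  assumes space_UNIV: "space M = UNIV"
    and f_measurable [measurable]: "f \<in> M \<rightarrow>\<^sub>M M"
    and f_invariant: "distr M M f = M"
    and ergodic: "\<And>S. S \<in> events \<Longrightarrow> f -` S = S \<Longrightarrow> prob S = 0 \<or> prob S = 1"
begin

lemma funpow_measurable [measurable]: "(f ^^ n) \<in> M \<rightarrow>\<^sub>M M"
  by (induction n) (auto intro: measurable_comp)

lemma AE_comp: "AE x in M. P x \<Longrightarrow> AE x in M. P (f x)"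
  using AE_distrD[OF f_measurable, of P] by (subst (asm) f_invariant)

lemma AE_orbit:
  assumes "AE x in M. P x"
  shows "AE x in M. \<forall>n. P ((f ^^ n) x)"
proof -
  have "AE x in M. P ((f ^^ n) x)" for n
  proof (induction n)
    case (Suc n)
    then show ?case using AE_comp[of "\<lambda>x. P ((f ^^ n) x)"] by (simp add: funpow_swap1)
  qed (simp add: assms)
  then show ?thesis by (simp add: AE_all_countable)
qed

lemma integrable_comp:
  fixes h :: "'a \<Rightarrow> real"
  assumes "integrable M h"
  shows "integrable M (\<lambda>x. h (f x))" "(\<integral>x. h (f x) \<partial>M) = (\<integral>x. h x \<partial>M)"
proof -
  have "h \<in> borel_measurable M" using assms by auto
  then show "integrable M (\<lambda>x. h (f x))" "(\<integral>x. h (f x) \<partial>M) = (\<integral>x. h x \<partial>M)"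
    using integrable_distr_eq[OF f_measurable, of h] integral_distr[OF f_measurable, of h] assms
    by (simp_all add: f_invariant)
qed

text \<open>This is the maximum of the Birkhoff sums of length at most \<open>n\<close>, the empty
  sum included. The recursion splits off the first time, so that composition with \<open>f\<close>
  appears directly.\<close>

primrec max_birkhoff :: "('a \<Rightarrow> real) \<Rightarrow> nat \<Rightarrow> 'a \<Rightarrow> real" where
  "max_birkhoff h 0 x = 0"
| "max_birkhoff h (Suc n) x = max 0 (h x + max_birkhoff h n (f x))"

lemma max_birkhoff_nonneg: "max_birkhoff h n x \<ge> 0"
  by (cases n) auto

lemma max_birkhoff_mono: "max_birkhoff h n x \<le> max_birkhoff h (Suc n) x"
proof (induction n arbitrary: x)
  case (Suc n)
  show ?case using Suc[of "f x"] by (simp add: max_def)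
qed simp

lemma birkhoff_le_max: "(\<Sum>l<n. h ((f ^^ l) x)) \<le> max_birkhoff h n x"
proof (induction n arbitrary: x)
  case (Suc n)
  have "(\<Sum>l<Suc n. h ((f ^^ l) x)) = h x + (\<Sum>l<n. h ((f ^^ l) (f x)))"
    by (simp only: sum.lessThan_Suc_shift) (simp add: funpow_swap1)
  also have "\<dots> \<le> h x + max_birkhoff h n (f x)" using Suc by simp
  finally show ?case by simp
qed simp

lemma max_birkhoff_integrable:
  assumes "integrable M h" shows "integrable M (max_birkhoff h n)"
proof (induction n)
  case (Suc n)
  have "integrable M (\<lambda>x. max 0 (h x + max_birkhoff h n (f x)))"
    using assms integrable_comp(1)[OF Suc] by (intro integrable_max integrable_add) auto
  then show ?case by (simp cong: Bochner_Integration.integrable_cong)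
qed simp

text \<open>Garsia's argument: if the maximal Birkhoff sums were unbounded almost everywhere, then
  \<open>max_birkhoff h (Suc n) - max_birkhoff h n \<circ> f\<close> would converge to \<open>h\<close>, although its
  integral is nonnegative.\<close>

lemma max_birkhoff_bounded:
  assumes h: "integrable M h" and neg: "(\<integral>x. h x \<partial>M) < 0"
  shows "AE x in M. \<exists>C::nat. \<forall>n. max_birkhoff h n x \<le> C"
proof -
  let ?m = "max_birkhoff h"
  have [measurable]: "h \<in> borel_measurable M" using h by auto
  have m_meas [measurable]: "?m n \<in> borel_measurable M" for n
    using max_birkhoff_integrable[OF h] by auto
  define S where "S = {x \<in> space M. \<forall>C::nat. \<exists>n. ?m n x > C}"
  have S: "S \<in> events" unfolding S_def by measurable
  \<comment> \<open>By the recursion, the maximal sums at \<open>x\<close> and at \<open>f x\<close>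
    differ by \<open>h x\<close> as soon as they are large. Unboundedness is thus a strictly
    invariant property, as \<open>ergodic\<close> demands.\<close>
  have "x \<in> S \<longleftrightarrow> f x \<in> S" for x
  proof
    assume x: "x \<in> S"
    show "f x \<in> S"
      unfolding S_def space_UNIV
    proof (simp, intro allI)
      fix C :: nat
      obtain D :: nat where D: "C + h x \<le> D" using real_arch_simple by blast
      obtain n where n: "?m n x > D" using x unfolding S_def by blast
      then obtain k where "n = Suc k" by (cases n) auto
      then show "\<exists>n. real C < ?m n (f x)" using n D
        by (intro exI[of _ k]) (auto simp: max_def split: if_splits)
    qed
  next
    assume x: "f x \<in> S"
    show "x \<in> S"
      unfolding S_def space_UNIV
    proof (simp, intro allI)
      fix C :: nat
      obtain D :: nat where D: "C - h x \<le> D" using real_arch_simple by blast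
      obtain n where n: "?m n (f x) > D" using x unfolding S_def by blast
      then show "\<exists>n. real C < ?m n x" using D
        by (intro exI[of _ "Suc n"]) (auto simp: max_def)
    qed
  qed
  then have "f -` S = S" by auto
  then have "prob S = 0 \<or> prob S = 1" using ergodic[OF S] by simp
  moreover have "prob S \<noteq> 1"
  proof
    assume "prob S = 1"
    then have ae: "AE x in M. x \<in> S" using S prob_eq_1 by blast
    let ?d = "\<lambda>n x. ?m (Suc n) x - ?m n (f x)"
    have lim: "(\<lambda>n. \<integral>x. ?d n x \<partial>M) \<longlonglongrightarrow> (\<integral>x. h x \<partial>M)"
    proof (rule integral_dominated_convergence[where w = "\<lambda>x. \<bar>h x\<bar>"])
      show "integrable M (\<lambda>x. \<bar>h x\<bar>)" using h by simp
      \<comment> \<open>With m = \<open>max_birkhoff h n (f x)\<close> the difference equals max (-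
        m) (h x), and m is nonnegative.\<close>
      show "AE x in M. norm (?d n x) \<le> \<bar>h x\<bar>" for n
      proof (rule AE_I2)
        fix x
        show "norm (?d n x) \<le> \<bar>h x\<bar>"
          using max_birkhoff_nonneg[of h n "f x"] by (simp add: max_def abs_real_def)
      qed
      show "AE x in M. (\<lambda>n. ?d n x) \<longlonglongrightarrow> h x"
        using AE_comp[OF ae]
      proof eventually_elim
        case (elim x)
        obtain D :: nat where D: "- h x \<le> D" using real_arch_simple by blast
        obtain n where n: "?m n (f x) > D" using elim unfolding S_def by blast
        have "?m j (f x) > D" if "j \<ge> n" for j
          using that n lift_Suc_mono_le[of "\<lambda>j. ?m j (f x)", OF max_birkhoff_mono] by fastforce
        then have "?d j x = h x" if "j \<ge> n" for j
          using that D by (force simp: max_def)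
        then show ?case by (intro tendsto_eventually) (auto simp: eventually_sequentially)
      qed
    qed (measurable)
    have "(\<integral>x. ?d n x \<partial>M) \<ge> 0" for n
    proof -
      have i: "integrable M (?m n)" for n by (rule max_birkhoff_integrable[OF h])
      have "(\<integral>x. ?d n x \<partial>M) = (\<integral>x. ?m (Suc n) x \<partial>M) - (\<integral>x. ?m n x \<partial>M)"
        using i[of "Suc n"] i[of n] integrable_comp[OF i[of n]]
        by (simp del: max_birkhoff.simps add: Bochner_Integration.integral_diff)
      also have "\<dots> \<ge> 0"
        using integral_mono[OF i[of n] i[of "Suc n"] max_birkhoff_mono] by simp
      finally show ?thesis .
    qed
    then have "(\<integral>x. h x \<partial>M) \<ge> 0" using LIMSEQ_le_const[OF lim] by blast
    then show False using neg by simp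
  qed
  ultimately have "prob S = 0" by blast
  then have "AE x in M. x \<notin> S" using S prob_eq_0 by blast
  then show ?thesis unfolding S_def space_UNIV by (auto simp: not_less)
qed

text \<open>Subtracting \<open>c\<close> makes the integral negative, so the maximal Birkhoff sums
  of the difference are almost everywhere finite; their bound is the constant
  \<open>C\<close>.\<close>

lemma birkhoff_upper:
  assumes g: "integrable M g" and c: "(\<integral>x. g x \<partial>M) < c"
  shows "nearly (\<lambda>(C::real) x. \<forall>n. (\<Sum>l<n. g ((f ^^ l) x)) \<le> C + c * real n)"
proof -
  let ?h = "\<lambda>x. g x - c"
  have h: "integrable M ?h" "(\<integral>x. ?h x \<partial>M) < 0"
    using g c by (auto simp: prob_space)
  have [measurable]: "max_birkhoff ?h n \<in> borel_measurable M" for n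
    using max_birkhoff_integrable[OF h(1)] by auto
  have "nearly (\<lambda>(C::nat) x. \<forall>n. max_birkhoff ?h n x \<le> real C)"
  proof (rule nearly_AE_nat)
    show "{x \<in> space M. \<forall>n. max_birkhoff ?h n x \<le> real C} \<in> events" for C
      by measurable
    show "\<forall>n. max_birkhoff ?h n x \<le> real C \<Longrightarrow> \<forall>n. max_birkhoff ?h n x \<le> real (Suc C)" for C x
      by (meson of_nat_le_iff le_SucI order_refl order_trans)
    show "AE x in M. \<exists>C::nat. \<forall>n. max_birkhoff ?h n x \<le> real C"
      using max_birkhoff_bounded[OF h] .
  qed
  then show ?thesis
  proof (rule nearly_mono)
    fix C :: nat
    have "(\<Sum>l<n. g ((f ^^ l) x)) \<le> C + c * real n" if "\<forall>n. max_birkhoff ?h n x \<le> real C" for x n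
      using birkhoff_le_max[of ?h x n] that[rule_format, of n]
      by (simp add: sum_subtractf mult.commute)
    then show "\<exists>C'. \<forall>x. (\<forall>n. max_birkhoff ?h n x \<le> real C) \<longrightarrow>
        (\<forall>n. (\<Sum>l<n. g ((f ^^ l) x)) \<le> C' + c * real n)"
      by (intro exI[of _ "real C"]) blast
  qed
qed

section \<open>Orbit sums over rarely visited sets\<close>

lemma integral_indicator_tendsto_0:
  assumes u: "integrable M u" and S: "\<And>N. S N \<in> events"
    and dec: "\<And>N. S (Suc N) \<subseteq> S N" and ae: "AE x in M. \<exists>N. x \<notin> S N"
  shows "(\<lambda>N::nat. \<integral>x. indicat_real (S N) x * u x \<partial>M) \<longlonglongrightarrow> 0"
proof -
  have [measurable]: "u \<in> borel_measurable M" "\<And>N. S N \<in> sets M" using u S by auto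
  have "(\<lambda>N. \<integral>x. indicat_real (S N) x * u x \<partial>M) \<longlonglongrightarrow> (\<integral>x. 0 \<partial>M)"
  proof (rule integral_dominated_convergence[where w = "\<lambda>x. \<bar>u x\<bar>"])
    show "integrable M (\<lambda>x. \<bar>u x\<bar>)" using u by simp
    show "AE x in M. (\<lambda>N. indicat_real (S N) x * u x) \<longlonglongrightarrow> 0"
      using ae
    proof eventually_elim
      case (elim x)
      then obtain N where N: "x \<notin> S N" by blast
      have "x \<notin> S n" if "n \<ge> N" for n
        using lift_Suc_antimono_le[of S, OF dec that] N by blast
      then have "indicat_real (S n) x * u x = 0" if "n \<ge> N" for n using that by simp
      then show ?case
        by (intro tendsto_eventually) (unfold eventually_sequentially, blast)
    qed
  qed (auto simp: indicator_def)
  then show ?thesis by simp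
qed

text \<open>The sets decrease to a null set, so \<open>N\<close> can be taken with the integral of
  \<open>u\<close> over \<open>S N\<close> below \<epsilon>; \<open>birkhoff_upper\<close> does the
  rest.\<close>

lemma nearly_sum_bad:
  assumes u: "integrable M u" and S: "\<And>N. S N \<in> events"
    and dec: "\<And>N. S (Suc N) \<subseteq> S N" and ae: "AE x in M. \<exists>N. x \<notin> S N" and e: "\<epsilon> > 0"
  obtains N :: nat where
    "nearly (\<lambda>(C::real) x. \<forall>n. (\<Sum>l<n. indicat_real (S N) ((f ^^ l) x) * u ((f ^^ l) x)) \<le> C + \<epsilon> * real n)"
proof -
  have [measurable]: "u \<in> borel_measurable M" "\<And>N. S N \<in> sets M" using u S by auto
  have "eventually (\<lambda>N. (\<integral>x. indicat_real (S N) x * u x \<partial>M) < \<epsilon>) sequentially"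
    using order_tendstoD(2)[OF integral_indicator_tendsto_0[of u S, OF u S dec ae] e] .
  then obtain N where N: "(\<integral>x. indicat_real (S N) x * u x \<partial>M) < \<epsilon>"
    by (auto simp: eventually_sequentially)
  have "integrable M (\<lambda>x. indicat_real (S N) x * u x)"
    using integrable_mult_indicator[OF S u, of N] by simp
  from birkhoff_upper[OF this N] show thesis by (rule that)
qed

text \<open>A single value of \<open>u\<close> along the orbit is at most \<open>N\<close> plus its
  contribution from the times at which the absolute value of \<open>u\<close> exceeds
  \<open>N\<close>, and this contribution is one term of a sum of nonnegative terms bounded by
  \<open>nearly_sum_bad\<close>.\<close>

lemma nearly_tempered:
  assumes u: "integrable M u" and e: "\<epsilon> > 0"
  shows "nearly (\<lambda>(C::real) x. \<forall>n. u ((f ^^ n) x) \<le> C + \<epsilon> * real n)"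
proof -
  have [measurable]: "u \<in> borel_measurable M" using u by auto
  let ?S = "\<lambda>N::nat. {x \<in> space M. \<bar>u x\<bar> > real N}"
  let ?v = "\<lambda>x. \<bar>u x\<bar>"
  have v: "integrable M ?v" using u by simp
  have S: "?S N \<in> events" for N by measurable
  have dec: "?S (Suc N) \<subseteq> ?S N" for N by auto
  have ae: "AE x in M. \<exists>N. x \<notin> ?S N"
    by (intro AE_I2) (auto simp: not_less real_arch_simple)
  obtain N where N: "nearly (\<lambda>(C::real) x. \<forall>n. (\<Sum>l<n. indicat_real (?S N) ((f ^^ l) x) * ?v ((f ^^ l) x)) \<le> C + \<epsilon> * real n)"
    using nearly_sum_bad[of ?v ?S, OF v S dec ae e] by blast
  then show ?thesis
  proof (rule nearly_mono)
    fix C :: real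
    have "u ((f ^^ n) x) \<le> (N + C + \<epsilon>) + \<epsilon> * real n"
      if x: "\<forall>n. (\<Sum>l<n. indicat_real (?S N) ((f ^^ l) x) * ?v ((f ^^ l) x)) \<le> C + \<epsilon> * real n" for x n
    proof -
      let ?t = "\<lambda>l. indicat_real (?S N) ((f ^^ l) x) * ?v ((f ^^ l) x)"
      have "u ((f ^^ n) x) \<le> N + ?t n" by (auto simp: indicator_def space_UNIV)
      also have "?t n \<le> (\<Sum>l<Suc n. ?t l)"
        by (intro member_le_sum) (auto simp: indicator_def)
      also have "\<dots> \<le> C + \<epsilon> * real (Suc n)" using x by blast
      finally show ?thesis by (simp add: algebra_simps)
    qed
    then show "\<exists>C'. \<forall>x. (\<forall>n. (\<Sum>l<n. indicat_real (?S N) ((f ^^ l) x) * ?v ((f ^^ l) x)) \<le> C + \<epsilon> * real n) \<longrightarrow>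
        (\<forall>n. u ((f ^^ n) x) \<le> C' + \<epsilon> * real n)" by blast
  qed
qed

end

text \<open>Induction on \<open>n - j\<close>. At a bad time one step is taken and paid for with
  \<open>u j\<close>; at any other time a jump is free. A jump that passes \<open>n\<close> can only
  start among the last \<open>N\<close> times, and from there every single step is paid for by the
  second sum.\<close>

lemma greedy_bound:
  fixes r u :: "nat \<Rightarrow> real" and N :: nat
  assumes u: "\<And>l. u l \<ge> 0" and r: "\<And>l. r l \<ge> 0"
    and step: "\<And>l. r (Suc l) \<le> exp (u l) * r l"
    and jump: "\<And>l. \<not> bad l \<Longrightarrow> \<exists>m\<in>{1..N}. r (l + m) \<le> r l"
    and "j \<le> n"
  shows "r n \<le> exp ((\<Sum>l=j..<n. of_bool (bad l) * u l) + (\<Sum>l=n-N..<n. u l)) * r j"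
  using \<open>j \<le> n\<close>
proof (induction "n - j" arbitrary: j rule: less_induct)
  case less
  let ?b = "\<lambda>j. \<Sum>l=j..<n. of_bool (bad l) * u l" and ?t = "\<Sum>l=n-N..<n. u l"
  have b_nonneg: "?b j \<ge> 0" for j using u by (intro sum_nonneg) auto
  have t_nonneg: "?t \<ge> 0" using u by (intro sum_nonneg) auto
  consider "j = n" | "j < n" "bad j" | "j < n" "\<not> bad j" using less.prems by force
  then show ?case
  proof cases
    case 1
    then show ?thesis using r[of n] t_nonneg mult_right_mono[of 1 "exp ?t" "r n"] by simp
  next
    case 2
    have "r n \<le> exp (?b (Suc j) + ?t) * r (Suc j)" using less(1)[of "Suc j"] 2 by auto
    also have "\<dots> \<le> exp (?b (Suc j) + ?t) * (exp (u j) * r j)"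
      by (intro mult_left_mono step) auto
    also have "\<dots> = exp (?b j + ?t) * r j"
      using 2 by (simp add: sum.atLeast_Suc_lessThan exp_add del: sum_of_bool_mult_eq)
    finally show ?thesis .
  next
    case 3
    obtain m where m: "m \<in> {1..N}" "r (j + m) \<le> r j" using jump 3 by blast
    show ?thesis
    proof (cases "j + m \<le> n")
      case True
      have "r n \<le> exp (?b (j + m) + ?t) * r (j + m)" using less(1)[of "j + m"] True m 3 by auto
      also have "\<dots> \<le> exp (?b j + ?t) * r j"
      proof (rule mult_mono)
        have "?b (j + m) \<le> ?b j" using u by (intro sum_mono2) auto
        then show "exp (?b (j + m) + ?t) \<le> exp (?b j + ?t)" by simp
      qed (use m r in auto)
      finally show ?thesis .
    next
      case False
      have "r (j + i) \<le> exp (\<Sum>l=j..<j+i. u l) * r j" for i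
      proof (induction i)
        case (Suc i)
        have "r (j + Suc i) \<le> exp (u (j + i)) * r (j + i)" using step[of "j + i"] by simp
        also have "\<dots> \<le> exp (u (j + i)) * (exp (\<Sum>l=j..<j+i. u l) * r j)"
          by (intro mult_left_mono Suc) auto
        finally show ?case by (simp add: exp_add mult_ac)
      qed simp
      from this[of "n - j"] have "r n \<le> exp (\<Sum>l=j..<n. u l) * r j" using 3 by simp
      also have "\<dots> \<le> exp ?t * r j"
      proof (rule mult_right_mono)
        have "(\<Sum>l=j..<n. u l) \<le> ?t" using False m u by (intro sum_mono2) auto
        then show "exp (\<Sum>l=j..<n. u l) \<le> exp ?t" by simp
      qed (rule r)
      also have "\<dots> \<le> exp (?b j + ?t) * r j"
      proof (rule mult_right_mono)
        show "exp ?t \<le> exp (?b j + ?t)" using b_nonneg[of j] by (simp del: sum_of_bool_mult_eq)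
      qed (rule r)
      finally show ?thesis .
    qed
  qed
qed

context ergodic_system
begin

text \<open>The times in \<open>bad N\<close> contribute little by \<open>nearly_sum_bad\<close>; the last jump, which may
  overshoot \<open>n\<close>, costs at most \<open>N\<close> terms of tempered size.\<close>

lemma nearly_greedy:
  fixes bad :: "nat \<Rightarrow> 'a set"
  assumes u: "integrable M u" "\<And>x. u x \<ge> 0" and S: "\<And>N. bad N \<in> events"
    and dec: "\<And>N. bad (Suc N) \<subseteq> bad N" and ae: "AE x in M. \<exists>N. x \<notin> bad N" and e: "\<epsilon> > 0"
  obtains N :: nat where
    "nearly (\<lambda>(C::real) x. \<forall>r. (\<forall>l. r l \<ge> 0) \<and> (\<forall>l. r (Suc l) \<le> exp (u ((f ^^ l) x)) * r l) \<and>
        (\<forall>l. (f ^^ l) x \<notin> bad N \<longrightarrow> (\<exists>m\<in>{1..N}. r (l + m) \<le> r l)) \<longrightarrow>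
        (\<forall>n. \<forall>j\<le>n. r n \<le> exp (C + \<epsilon> * real n) * r j))"
proof -
  have e2: "\<epsilon> / 2 > 0" using e by simp
  obtain N where N: "nearly (\<lambda>(C::real) x. \<forall>n. (\<Sum>l<n. indicat_real (bad N) ((f ^^ l) x) * u ((f ^^ l) x)) \<le> C + \<epsilon> / 2 * real n)"
    using nearly_sum_bad[of u bad, OF u(1) S dec ae e2] by blast
  \<comment> \<open>The final window has at most \<open>N\<close> terms, each at most a constant
    plus \<open>\<eta> * n\<close>, so their linear part stays below
    \<open>\<epsilon> / 2 * n\<close>; adding 1 covers \<open>N = 0\<close>.\<close>
  define \<eta> where "\<eta> = \<epsilon> / 2 / (real N + 1)"
  have eta: "\<eta> > 0" using e by (simp add: \<eta>_def)
  have etaN: "real N * \<eta> \<le> \<epsilon> / 2" using e by (simp add: \<eta>_def field_simps)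
  note nearly_conj[OF N nearly_tempered[OF u(1) eta]]
  \<comment> \<open>The good set depends only on \<open>u\<close> and \<open>bad N\<close>. The
    sequence \<open>r\<close> can therefore be quantified inside, and one set of base points serves
    all vectors at once.\<close>
  then have "nearly (\<lambda>(C::real) x. \<forall>r. (\<forall>l. r l \<ge> 0) \<and> (\<forall>l. r (Suc l) \<le> exp (u ((f ^^ l) x)) * r l) \<and>
        (\<forall>l. (f ^^ l) x \<notin> bad N \<longrightarrow> (\<exists>m\<in>{1..N}. r (l + m) \<le> r l)) \<longrightarrow>
        (\<forall>n. \<forall>j\<le>n. r n \<le> exp (C + \<epsilon> * real n) * r j))"
  proof (rule nearly_mono, safe, goal_cases)
    case (1 C D)
    have "r n \<le> exp ((C + real N * \<bar>D\<bar>) + \<epsilon> * real n) * r j"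
      if C: "\<forall>n. (\<Sum>l<n. indicat_real (bad N) ((f ^^ l) x) * u ((f ^^ l) x)) \<le> C + \<epsilon> / 2 * real n"
        and D: "\<forall>n. u ((f ^^ n) x) \<le> D + \<eta> * real n"
        and r: "\<forall>l. r l \<ge> 0" "\<forall>l. r (Suc l) \<le> exp (u ((f ^^ l) x)) * r l"
        "\<forall>l. (f ^^ l) x \<notin> bad N \<longrightarrow> (\<exists>m\<in>{1..N}. r (l + m) \<le> r l)" and j: "j \<le> n" for x r n j
    proof -
      let ?u = "\<lambda>l. u ((f ^^ l) x)" and ?bad = "\<lambda>l. (f ^^ l) x \<in> bad N"
      have "r n \<le> exp ((\<Sum>l=j..<n. of_bool (?bad l) * ?u l) + (\<Sum>l=n-N..<n. ?u l)) * r j"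
        using r u j by (intro greedy_bound) auto
      also have "\<dots> \<le> exp ((C + real N * \<bar>D\<bar>) + \<epsilon> * real n) * r j"
      proof (intro mult_right_mono exp_le_cancel_iff[THEN iffD2])
        have "(\<Sum>l=j..<n. of_bool (?bad l) * ?u l) \<le> (\<Sum>l<n. of_bool (?bad l) * ?u l)"
          using u by (intro sum_mono2) auto
        also have "\<dots> = (\<Sum>l<n. indicat_real (bad N) ((f ^^ l) x) * ?u l)"
          by (intro sum.cong) (auto simp: indicator_def)
        finally have 1: "(\<Sum>l=j..<n. of_bool (?bad l) * ?u l) \<le> C + \<epsilon> / 2 * real n"
          using C by (meson order_trans)
        have "(\<Sum>l=n-N..<n. ?u l) \<le> real (card {n-N..<n}) * (\<bar>D\<bar> + \<eta> * real n)"
        proof (rule sum_bounded_above)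
          fix l assume "l \<in> {n-N..<n}"
          then have "\<eta> * real l \<le> \<eta> * real n" using eta by (intro mult_left_mono) auto
          then show "?u l \<le> \<bar>D\<bar> + \<eta> * real n" using D[rule_format, of l] by linarith
        qed
        also have "\<dots> \<le> real N * (\<bar>D\<bar> + \<eta> * real n)"
          using eta by (intro mult_right_mono) auto
        also have "\<dots> \<le> real N * \<bar>D\<bar> + \<epsilon> / 2 * real n"
          using mult_right_mono[OF etaN, of "real n"] by (simp add: algebra_simps)
        finally show "(\<Sum>l=j..<n. of_bool (?bad l) * ?u l) + (\<Sum>l=n-N..<n. ?u l)
            \<le> (C + real N * \<bar>D\<bar>) + \<epsilon> * real n" using 1 by (simp add: algebra_simps)
      qed (use r in auto)
      finally show ?thesis .
    qed
    then show ?case by (intro exI[of _ "C + real N * \<bar>D\<bar>"]) auto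
  qed
  then show thesis by (rule that)
qed

end

section \<open>Distances to subspaces\<close>

lemma infdist_subspace_attained:
  fixes V :: "'v::euclidean_space set"
  assumes "subspace V"
  obtains u where "u \<in> V" "norm (v - u) = infdist v V"
proof -
  have "closed V" "V \<noteq> {}" using assms closed_subspace subspace_0 by auto
  then obtain u where "u \<in> V" "infdist v V = dist v u" using infdist_attains_inf by metis
  then show thesis using that by (simp add: dist_norm)
qed

text \<open>For a subspace \<open>V\<close>, \<open>infdist v V\<close> is the norm of the class of
  \<open>v\<close> in the quotient by \<open>V\<close>. This invariance,
  \<open>infdist_subspace_scaleR\<close> and \<open>infdist_linear_ge\<close> make it possible to
  estimate the cocycle induced on quotients without forming quotient spaces.\<close>

lemma infdist_subspace_add:
  fixes V :: "'v::euclidean_space set"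
  assumes V: "subspace V" and u: "u \<in> V"
  shows "infdist (v + u) V = infdist v V"
proof -
  have le: "infdist (v + u) V \<le> infdist v V" if u: "u \<in> V" for u v
  proof -
    obtain p where p: "p \<in> V" "norm (v - p) = infdist v V"
      by (rule infdist_subspace_attained[OF V])
    have "infdist (v + u) V \<le> dist (v + u) (p + u)"
      using p(1) u V by (intro infdist_le) (simp add: subspace_add)
    then show ?thesis using p by (simp add: dist_norm)
  qed
  have "infdist v V \<le> infdist (v + u) V"
    using le[of "- u" "v + u"] u V by (simp add: subspace_neg)
  then show ?thesis using le[OF u, of v] by simp
qed

lemma infdist_subspace_le_norm:
  fixes V :: "'v::euclidean_space set"
  shows "subspace V \<Longrightarrow> infdist v V \<le> norm v"
  using infdist_le[of 0 V v] subspace_0 by auto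

lemma infdist_subspace_scaleR:
  fixes V :: "'v::euclidean_space set"
  assumes V: "subspace V"
  shows "infdist (c *\<^sub>R v) V = \<bar>c\<bar> * infdist v V"
proof -
  have le: "infdist (c *\<^sub>R v) V \<le> \<bar>c\<bar> * infdist v V" for c v
  proof -
    obtain p where p: "p \<in> V" "norm (v - p) = infdist v V"
      by (rule infdist_subspace_attained[OF V])
    have "infdist (c *\<^sub>R v) V \<le> dist (c *\<^sub>R v) (c *\<^sub>R p)"
      using p(1) V by (intro infdist_le) (simp add: subspace_scale)
    also have "\<dots> = \<bar>c\<bar> * norm (v - p)"
      by (simp add: dist_norm flip: scaleR_diff_right)
    finally show ?thesis using p by simp
  qed
  show ?thesis
  proof (cases "c = 0")
    case True
    then show ?thesis using subspace_0[OF V] by simp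
  next
    case False
    have "\<bar>c\<bar> * infdist v V \<le> \<bar>c\<bar> * (\<bar>inverse c\<bar> * infdist (c *\<^sub>R v) V)"
      using le[of "inverse c" "c *\<^sub>R v"] False by (intro mult_left_mono) auto
    also have "\<dots> = infdist (c *\<^sub>R v) V" using False by (simp flip: abs_mult mult.assoc)
    finally show ?thesis using le[of c v] by simp
  qed
qed

lemma infdist_linear_ge:
  fixes V :: "'v::euclidean_space set" and T :: "'v \<Rightarrow> 'v"
  assumes T: "linear T" and ge: "\<And>v. c * norm v \<le> norm (T v)" and c: "c \<ge> 0" and V: "subspace V"
  shows "c * infdist v V \<le> infdist (T v) (T ` V)"
proof -
  obtain p where p: "p \<in> T ` V" "norm (T v - p) = infdist (T v) (T ` V)"
    using infdist_subspace_attained[OF linear_subspace_image[OF T V]] by blast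
  then obtain u where u: "u \<in> V" "p = T u" by blast
  have "c * infdist v V \<le> c * norm (v - u)"
    using u c by (intro mult_left_mono) (auto simp: infdist_le simp flip: dist_norm)
  also have "\<dots> \<le> norm (T (v - u))" by (rule ge)
  finally show ?thesis using p u T by (simp add: linear_diff)
qed

text \<open>It suffices to bound the maps on the finitely many vectors of an orthonormal basis of
  \<open>V\<close>, because the coefficients of \<open>v\<close> are at most
  \<open>norm v\<close>.\<close>

lemma linear_uniform_bound:
  fixes V :: "'v::euclidean_space set" and T :: "nat \<Rightarrow> 'v \<Rightarrow> 'w::real_normed_vector"
  assumes V: "subspace V" and T: "\<And>n. linear (T n)"
    and bd: "\<And>v. v \<in> V \<Longrightarrow> \<exists>R. \<forall>n. norm (T n v) \<le> R * e n"
  obtains R where "R > 0" "\<And>v n. v \<in> V \<Longrightarrow> norm (T n v) \<le> R * \<bar>e n\<bar> * norm v"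
proof -
  obtain b where b: "b \<subseteq> V" "pairwise orthogonal b" "\<And>x. x \<in> b \<Longrightarrow> norm x = 1"
    "independent b" "card b = dim V" "span b = V"
    using orthonormal_basis_subspace[OF V] by blast
  have fin: "finite b" using b(4) by (rule independent_imp_finite)
  obtain R where R: "\<And>v n. v \<in> b \<Longrightarrow> norm (T n v) \<le> R v * e n"
    using bd b(1) by (metis subsetD)
  define K where "K = (\<Sum>v\<in>b. \<bar>R v\<bar>) + 1"
  show thesis
  proof (rule that)
    show "K > 0" unfolding K_def by (simp add: add_nonneg_pos sum_nonneg)
    fix v n assume v: "v \<in> V"
    have exp: "v = (\<Sum>c\<in>b. (v \<bullet> c) *\<^sub>R c)"
      using orthonormal_basis_expand[OF b(2,3) _ fin, of v] v b(6) by simp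
    have "norm (T n v) = norm (\<Sum>c\<in>b. (v \<bullet> c) *\<^sub>R T n c)"
      by (subst exp) (simp add: linear_sum[OF T] linear_scale[OF T])
    also have "\<dots> \<le> (\<Sum>c\<in>b. \<bar>v \<bullet> c\<bar> * norm (T n c))"
      by (rule order_trans[OF norm_sum]) simp
    also have "\<dots> \<le> (\<Sum>c\<in>b. norm v * (\<bar>R c\<bar> * \<bar>e n\<bar>))"
    proof (intro sum_mono mult_mono)
      fix c assume c: "c \<in> b"
      show "\<bar>v \<bullet> c\<bar> \<le> norm v" using Cauchy_Schwarz_ineq2[of v c] b(3)[OF c] by simp
      have "norm (T n c) \<le> R c * e n" by (rule R[OF c])
      also have "\<dots> \<le> \<bar>R c\<bar> * \<bar>e n\<bar>" by (metis abs_ge_self abs_mult)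
      finally show "norm (T n c) \<le> \<bar>R c\<bar> * \<bar>e n\<bar>" .
    qed auto
    also have "\<dots> = (\<Sum>c\<in>b. \<bar>R c\<bar>) * (\<bar>e n\<bar> * norm v)"
      by (simp add: sum_distrib_left sum_distrib_right mult_ac)
    also have "\<dots> \<le> K * (\<bar>e n\<bar> * norm v)"
      unfolding K_def by (intro mult_right_mono) auto
    finally show "norm (T n v) \<le> K * \<bar>e n\<bar> * norm v" by (simp add: mult_ac)
  qed
qed

section \<open>Testing vectors on a countable dense sequence\<close>

lemma dense_sequence_exists:
  "\<exists>d :: nat \<Rightarrow> 'v::second_countable_topology. \<forall>S. open S \<longrightarrow> S \<noteq> {} \<longrightarrow> (\<exists>i. d i \<in> S)"
proof -
  obtain D :: "'v set" where D: "countable D" "\<And>S. open S \<Longrightarrow> S \<noteq> {} \<Longrightarrow> \<exists>d\<in>D. d \<in> S"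
    by (rule countable_dense_setE) blast
  have "D \<noteq> {}" using D(2)[of UNIV] by auto
  then have "range (from_nat_into D) = D" using D(1) by (rule range_from_nat_into)
  then show ?thesis using D(2) by (intro exI[of _ "from_nat_into D"]) (metis rangeE)
qed

text \<open>Conditions on all vectors are tested on this sequence to obtain measurable sets of base
  points; \<open>closed_dense_seq\<close> returns from the sequence to all vectors when the
  condition is closed.\<close>

definition dense_seq :: "nat \<Rightarrow> 'v::second_countable_topology" where
  "dense_seq = (SOME d. \<forall>S. open S \<longrightarrow> S \<noteq> {} \<longrightarrow> (\<exists>i. d i \<in> S))"

lemma dense_seq: "open S \<Longrightarrow> S \<noteq> {} \<Longrightarrow> \<exists>i. dense_seq i \<in> S"
  using someI_ex[OF dense_sequence_exists] unfolding dense_seq_def by blast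

lemma closed_dense_seq:
  assumes "closed S" "\<And>i. dense_seq i \<in> S"
  shows "v \<in> S"
proof (rule ccontr)
  assume "v \<notin> S"
  then show False using dense_seq[of "- S"] assms by (auto simp: open_Compl)
qed

section \<open>Growth spaces of a linear cocycle\<close>

primrec cocycle_iter :: "('a \<Rightarrow> 'a) \<Rightarrow> ('a \<Rightarrow> 'v \<Rightarrow> 'v) \<Rightarrow> nat \<Rightarrow> 'a \<Rightarrow> 'v \<Rightarrow> 'v" where
  "cocycle_iter f B 0 x v = v"
| "cocycle_iter f B (Suc n) x v = B ((f ^^ n) x) (cocycle_iter f B n x v)"

text \<open>An exponential bound with a constant depending on \<open>v\<close>, instead of a limit
  of rates: it makes sense at points where no limit exists, and at Oseledets points it collects the
  exponents below \<open>s\<close> whenever \<open>s\<close> is not itself an exponent.\<close>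

definition growth_space ::
    "('a \<Rightarrow> 'a) \<Rightarrow> ('a \<Rightarrow> 'v \<Rightarrow> 'v) \<Rightarrow> 'a \<Rightarrow> real \<Rightarrow> 'v::real_normed_vector set" where
  "growth_space f B x s = {v. \<exists>R. \<forall>n. norm (cocycle_iter f B n x v) \<le> R * exp (s * real n)}"

lemma cocycle_iter_add:
  "cocycle_iter f B (m + n) x v = cocycle_iter f B m ((f ^^ n) x) (cocycle_iter f B n x v)"
  by (induction m) (simp_all add: funpow_add)

lemma cocycle_iter_Suc_right: "cocycle_iter f B (Suc n) x v = cocycle_iter f B n (f x) (B x v)"
  using cocycle_iter_add[of f B n 1 x v] by simp

lemma linear_cocycle_iter:
  assumes "\<And>x. linear (B x)" shows "linear (cocycle_iter f B n x)"
proof (induction n)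
  case 0
  then show ?case by (simp add: linear_iff)
next
  case (Suc n)
  then show ?case using assms[of "(f ^^ n) x"] by (simp add: linear_iff)
qed

lemma growth_space_mono: "s \<le> t \<Longrightarrow> growth_space f B x s \<subseteq> growth_space f B x t"
proof
  fix v assume st: "s \<le> t" and "v \<in> growth_space f B x s"
  then obtain R where R: "\<And>n. norm (cocycle_iter f B n x v) \<le> R * exp (s * real n)"
    unfolding growth_space_def by blast
  have "R \<ge> 0" using order_trans[OF norm_ge_zero R[of 0]] by simp
  then have "R * exp (s * real n) \<le> R * exp (t * real n)" for n
    using st by (intro mult_left_mono) (auto intro: mult_right_mono)
  then show "v \<in> growth_space f B x t"
    using R unfolding growth_space_def by (blast intro: order_trans)
qed

lemma subspace_growth_space:
  fixes B :: "'a \<Rightarrow> 'v::real_normed_vector \<Rightarrow> 'v"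
  assumes "\<And>x. linear (B x)" shows "subspace (growth_space f B x s)"
proof -
  note lin = linear_cocycle_iter[of B f _ x, OF assms]
  show ?thesis
  proof (unfold subspace_def, safe)
    show "0 \<in> growth_space f B x s"
      using linear_0[OF lin] unfolding growth_space_def by (auto intro!: exI[of _ 0])
  next
    fix v w assume "v \<in> growth_space f B x s" "w \<in> growth_space f B x s"
    then obtain R S where "\<And>n. norm (cocycle_iter f B n x v) \<le> R * exp (s * real n)"
      "\<And>n. norm (cocycle_iter f B n x w) \<le> S * exp (s * real n)"
      unfolding growth_space_def by blast
    then have "norm (cocycle_iter f B n x (v + w)) \<le> (R + S) * exp (s * real n)" for n
      using linear_add[OF lin] by (simp add: distrib_right norm_triangle_mono)
    then show "v + w \<in> growth_space f B x s" unfolding growth_space_def by blast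
  next
    fix c v assume "v \<in> growth_space f B x s"
    then obtain R where "\<And>n. norm (cocycle_iter f B n x v) \<le> R * exp (s * real n)"
      unfolding growth_space_def by blast
    then have "norm (cocycle_iter f B n x (c *\<^sub>R v)) \<le> (\<bar>c\<bar> * R) * exp (s * real n)" for n
      by (simp add: linear_scale[OF lin] mult.assoc mult_left_mono)
    then show "c *\<^sub>R v \<in> growth_space f B x s" unfolding growth_space_def by blast
  qed
qed

lemma growth_space_step_iff: "v \<in> growth_space f B x s \<longleftrightarrow> B x v \<in> growth_space f B (f x) s"
proof
  assume "v \<in> growth_space f B x s"
  then obtain R where R: "\<And>n. norm (cocycle_iter f B n x v) \<le> R * exp (s * real n)"
    unfolding growth_space_def by blast
  have "norm (cocycle_iter f B n (f x) (B x v)) \<le> (R * exp s) * exp (s * real n)" for n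
    using R[of "Suc n"] by (simp add: cocycle_iter_Suc_right exp_add algebra_simps del: cocycle_iter.simps)
  then show "B x v \<in> growth_space f B (f x) s" unfolding growth_space_def by blast
next
  assume "B x v \<in> growth_space f B (f x) s"
  then obtain R where R: "\<And>n. norm (cocycle_iter f B n (f x) (B x v)) \<le> R * exp (s * real n)"
    unfolding growth_space_def by blast
  \<comment> \<open>The entry \<open>norm v\<close> takes care of time 0, which is not seen from
    \<open>f x\<close>.\<close>
  let ?R = "max (norm v) (R * exp (- s))"
  have "norm (cocycle_iter f B n x v) \<le> ?R * exp (s * real n)" for n
  proof (cases n)
    case (Suc k)
    have "norm (cocycle_iter f B n x v) \<le> R * exp (s * real k)"
      using R[of k] by (simp add: Suc cocycle_iter_Suc_right del: cocycle_iter.simps)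
    also have "\<dots> = (R * exp (- s)) * exp (s * real n)"
      by (simp add: Suc mult.assoc flip: exp_add) (simp add: algebra_simps)
    also have "\<dots> \<le> ?R * exp (s * real n)" by (intro mult_right_mono) auto
    finally show ?thesis .
  qed simp
  then show "v \<in> growth_space f B x s" unfolding growth_space_def by blast
qed

lemma growth_space_iter_iff:
  "cocycle_iter f B n x v \<in> growth_space f B ((f ^^ n) x) s \<longleftrightarrow> v \<in> growth_space f B x s"
  by (induction n) (simp_all add: growth_space_step_iff[symmetric])

text \<open>All quantifiers on the right are countable, which is the source of measurability. For
  the converse, test vectors obeying the first \<open>N\<close> growth bounds stay in a compact ball
  around \<open>w\<close>; a limit point obeys all the bounds because \<open>R\<close> does not
  depend on \<open>N\<close>. The rational \<open>q\<close> keeps the inequality strict in the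
  limit.\<close>

lemma infdist_growth_space_less_iff:
  fixes B :: "'a \<Rightarrow> 'v::euclidean_space \<Rightarrow> 'v"
  assumes lin: "\<And>x. linear (B x)"
  shows "infdist w (growth_space f B x s) < r \<longleftrightarrow>
    (\<exists>R::nat. \<exists>q::rat. of_rat q < r \<and> (\<forall>N. \<exists>i. norm (dense_seq i - w) < of_rat q \<and>
      (\<forall>n\<le>N. norm (cocycle_iter f B n x (dense_seq i)) < real R * exp (s * real n))))"
    (is "?L \<longleftrightarrow> ?R")
proof
  note cont = linear_continuous_on[OF linear_conv_bounded_linear[THEN iffD1, OF linear_cocycle_iter[of B, OF lin]]]
  let ?V = "growth_space f B x s"
  have V: "subspace ?V" by (rule subspace_growth_space[OF lin])
  {
    assume ?L
    obtain u where u: "u \<in> ?V" "norm (w - u) = infdist w ?V"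
      by (rule infdist_subspace_attained[OF V])
    obtain q :: rat where q: "infdist w ?V < of_rat q" "of_rat q < r" using \<open>?L\<close> of_rat_dense by blast
    obtain R where R: "\<And>n. norm (cocycle_iter f B n x u) \<le> R * exp (s * real n)"
      using u unfolding growth_space_def by blast
    obtain K :: nat where K: "R < real K" using reals_Archimedean2 by blast
    have "\<exists>i. norm (dense_seq i - w) < of_rat q \<and>
      (\<forall>n\<le>N. norm (cocycle_iter f B n x (dense_seq i)) < real K * exp (s * real n))" for N
    proof -
      let ?S = "{v. norm (v - w) < of_rat q} \<inter>
        (\<Inter>n\<in>{..N}. {v. norm (cocycle_iter f B n x v) < real K * exp (s * real n)})"
      have "open ?S"
        by (intro open_Int open_INT ballI finite_atMost open_Collect_less continuous_intros cont)
      moreover have "u \<in> ?S"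
      proof (safe, goal_cases)
        case 1
        then show ?case using u q by (simp add: norm_minus_commute)
      next
        case (2 n)
        have "R * exp (s * real n) < real K * exp (s * real n)" using K by simp
        then show ?case using R[of n] by linarith
      qed
      ultimately obtain i where "dense_seq i \<in> ?S" using dense_seq[of ?S] by blast
      then show ?thesis by (intro exI[of _ i]) auto
    qed
    then show ?R using q by blast
  next
    assume ?R
    then obtain K :: nat and q :: rat where q: "of_rat q < r"
      and ex: "\<And>N. \<exists>i. norm (dense_seq i - w) < of_rat q \<and>
        (\<forall>n\<le>N. norm (cocycle_iter f B n x (dense_seq i)) < real K * exp (s * real n))" by blast
    obtain i where i: "\<And>N. norm (dense_seq (i N) - w) < of_rat q"
      "\<And>N n. n \<le> N \<Longrightarrow> norm (cocycle_iter f B n x (dense_seq (i N))) < real K * exp (s * real n)"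
      using ex by metis
    have "\<forall>N. dense_seq (i N) \<in> cball w (of_rat q)"
      using i(1) by (simp add: dist_norm norm_minus_commute less_imp_le)
    then obtain u \<sigma> where u: "u \<in> cball w (of_rat q)" "strict_mono \<sigma>"
      "((\<lambda>N. dense_seq (i N)) \<circ> \<sigma>) \<longlonglongrightarrow> u"
      using compact_cball[of w "of_rat q"] unfolding compact_def by meson
    have "norm (cocycle_iter f B n x u) \<le> real K * exp (s * real n)" for n
    proof (rule LIMSEQ_le_const2)
      show "(\<lambda>k. norm (cocycle_iter f B n x (dense_seq (i (\<sigma> k))))) \<longlonglongrightarrow> norm (cocycle_iter f B n x u)"
        using u(3) cont[of UNIV f n x]
        by (intro tendsto_norm continuous_on_tendsto_compose[of UNIV "cocycle_iter f B n x"]) (auto simp: o_def)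
      have "norm (cocycle_iter f B n x (dense_seq (i (\<sigma> k)))) \<le> real K * exp (s * real n)" if "k \<ge> n" for k
        using i(2)[of n "\<sigma> k"] strict_mono_imp_increasing[OF u(2), of k] that by (simp add: less_imp_le)
      then show "\<exists>N. \<forall>k\<ge>N. norm (cocycle_iter f B n x (dense_seq (i (\<sigma> k)))) \<le> real K * exp (s * real n)"
        by blast
    qed
    then have "u \<in> ?V" unfolding growth_space_def by blast
    then have "infdist w ?V \<le> dist w u" by (rule infdist_le)
    then show ?L using u(1) q by simp
  }
qed

locale linear_cocycle = ergodic_system M f for M :: "'a measure" and f +
  fixes B :: "'a \<Rightarrow> 'v::euclidean_space \<Rightarrow> 'v" and g :: "'a \<Rightarrow> real"
  assumes linear_B: "linear (B x)"
    and B_measurable [measurable]: "(\<lambda>x. B x v) \<in> borel_measurable M"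
    and g_integrable: "integrable M g"
    and B_upper: "norm (B x v) \<le> exp (g x) * norm v"
    and B_lower: "exp (- g x) * norm v \<le> norm (B x v)"
begin

abbreviation iter where "iter \<equiv> cocycle_iter f B"
abbreviation grow where "grow \<equiv> growth_space f B"

lemma linear_iter: "linear (iter n x)"
  by (rule linear_cocycle_iter[OF linear_B])

lemma subspace_grow: "subspace (grow x s)"
  by (rule subspace_growth_space[OF linear_B])

lemma g_nonneg: "g x \<ge> 0"
proof -
  obtain v :: 'v where "v \<in> Basis" using nonempty_Basis by blast
  then have "norm v = 1" by simp
  then have "exp (- g x) \<le> exp (g x)"
    using order_trans[OF B_lower[of x v] B_upper[of x v]] by simp
  then show ?thesis by simp
qed

lemma surj_B: "surj (B x)"
proof -
  have "v = 0" if "B x v = 0" for v using B_lower[of x v] that by (simp add: mult_le_0_iff)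
  then have "inj (B x)" using linear_injective_0[OF linear_B] by blast
  then show ?thesis using linear_inj_imp_surj[OF linear_B] by blast
qed

lemma surj_iter: "\<exists>u. iter n x u = v"
proof (induction n arbitrary: v)
  case (Suc n)
  obtain w where "B ((f ^^ n) x) w = v" using surj_B by (metis surjD)
  then show ?case using Suc[of w] by auto
qed simp

lemma B_image_grow: "B x ` grow x s = grow (f x) s"
  using surj_B[of x] growth_space_step_iff[of _ f B x s] by (auto simp: image_iff) (metis surjD)

lemma iter_image_grow: "iter n x ` grow x s = grow ((f ^^ n) x) s"
  using surj_iter[of n x] growth_space_iter_iff[of f B n x _ s] by (auto simp: image_iff) metis

text \<open>The locale gives measurability only for fixed vectors; expanding \<open>h x\<close> in
  the basis reduces a variable vector to these.\<close>

lemma B_comp_measurable: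
  assumes [measurable]: "T \<in> M \<rightarrow>\<^sub>M M" "h \<in> borel_measurable M"
  shows "(\<lambda>x. B (T x) (h x)) \<in> borel_measurable M"
proof -
  have "B (T x) (h x) = (\<Sum>b\<in>Basis. (h x \<bullet> b) *\<^sub>R B (T x) b)" for x
    by (subst (1) euclidean_representation[symmetric, of "h x"])
      (simp add: linear_sum[OF linear_B] linear_scale[OF linear_B])
  then show ?thesis by simp
qed

lemma iter_measurable [measurable (raw)]:
  assumes [measurable]: "T \<in> M \<rightarrow>\<^sub>M M" "h \<in> borel_measurable M"
  shows "(\<lambda>x. iter n (T x) (h x)) \<in> borel_measurable M"
proof (induction n)
  case (Suc n)
  have "(\<lambda>x. (f ^^ n) (T x)) \<in> M \<rightarrow>\<^sub>M M" by measurable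
  then show ?case using B_comp_measurable[OF _ Suc] by simp
qed simp

lemma infdist_grow_measurable [measurable (raw)]:
  assumes [measurable]: "T \<in> M \<rightarrow>\<^sub>M M" "h \<in> borel_measurable M"
  shows "(\<lambda>x. infdist (h x) (grow (T x) s)) \<in> borel_measurable M"
  unfolding borel_measurable_iff_less infdist_growth_space_less_iff[OF linear_B]
  by measurable

end

section \<open>Uniform growth rates\<close>

lemma exp_power_eventually:
  fixes s t R :: real
  assumes "s < t"
  obtains m :: nat where "m \<ge> 1" "R * exp (s * real m) \<le> exp (t * real m)"
proof -
  obtain k :: nat where k: "ln (max R 1) / (t - s) \<le> real k" using real_arch_simple by blast
  define m where "m = Suc k"
  have "ln (max R 1) \<le> (t - s) * real k" using k assms by (simp add: field_simps)
  also have "\<dots> \<le> (t - s) * real m" using assms by (simp add: m_def)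
  finally have "max R 1 \<le> exp ((t - s) * real m)"
    using exp_le_cancel_iff[of "ln (max R 1)" "(t - s) * real m"] by (simp del: exp_le_cancel_iff)
  then have "R * exp (s * real m) \<le> exp ((t - s) * real m) * exp (s * real m)"
    by (intro mult_right_mono) auto
  then show thesis using that[of m] by (simp add: m_def algebra_simps flip: exp_add)
qed

context linear_cocycle
begin

text \<open>At almost every \<open>x\<close> the space \<open>grow x s\<close> has a uniform bound
  with the smaller rate \<open>s1\<close>, so after some number \<open>m\<close> of steps the rate
  \<open>s\<close> holds with constant 1. Blocks of this kind are concatenated greedily. The free
  starting time \<open>j\<close> serves \<open>quotient_growth\<close>, where vectors appear in the
  middle of an orbit.\<close>

lemma nearly_upper:
  assumes s: "s1 < s" and ae: "AE x in M. grow x s \<subseteq> grow x s1" and e: "\<epsilon> > 0"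
  shows "nearly (\<lambda>(C::real) x. \<forall>n. \<forall>j\<le>n. \<forall>z\<in>grow ((f ^^ j) x) s.
    norm (iter (n - j) ((f ^^ j) x) z) \<le> exp (C + \<epsilon> * real n + s * real (n - j)) * norm z)"
proof -
  \<comment> \<open>The sum over the basis dominates the operator norm of \<open>iter m x\<close>.
    With this weight on the distance to \<open>grow x s\<close>, the inequality for all vectors is
    equivalent to the one on \<open>grow x s\<close>, and being a closed condition it can be tested
    on \<open>dense_seq\<close>.\<close>
  define c where "c m x = exp (s * real m) + (\<Sum>b\<in>Basis. norm (iter m x b))" for m x
  define ok where "ok m x \<longleftrightarrow> (\<forall>i. norm (iter m x (dense_seq i))
    \<le> exp (s * real m) * norm (dense_seq i :: 'v) + c m x * infdist (dense_seq i) (grow x s))" for m x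
  define bad where "bad N = {x \<in> space M. \<not> (\<exists>m\<in>{1..N}. ok m x)}" for N :: nat
  have [measurable]: "Measurable.pred M (ok m)" for m unfolding ok_def c_def by measurable
  have bad_meas: "bad N \<in> events" for N unfolding bad_def by measurable
  have ok_iff: "ok m x \<longleftrightarrow> (\<forall>v\<in>grow x s. norm (iter m x v) \<le> exp (s * real m) * norm v)" for m x
  proof
    assume ok: "ok m x"
    have cont: "continuous_on UNIV (iter m x)"
      by (simp add: linear_continuous_on linear_conv_bounded_linear[symmetric] linear_iter)
    have *: "v \<in> {v. norm (iter m x v) \<le> exp (s * real m) * norm v + c m x * infdist v (grow x s)}" for v
      by (rule closed_dense_seq)
        (use ok in \<open>auto simp: ok_def intro!: closed_Collect_le continuous_intros cont\<close>)
    show "\<forall>v\<in>grow x s. norm (iter m x v) \<le> exp (s * real m) * norm v"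
    proof
      fix v assume "v \<in> grow x s"
      then show "norm (iter m x v) \<le> exp (s * real m) * norm v" using *[of v] by simp
    qed
  next
    assume *: "\<forall>v\<in>grow x s. norm (iter m x v) \<le> exp (s * real m) * norm v"
    have "norm (iter m x v) \<le> exp (s * real m) * norm v + c m x * infdist v (grow x s)" for v
    proof -
      obtain p where p: "p \<in> grow x s" "norm (v - p) = infdist v (grow x s)"
        by (rule infdist_subspace_attained[OF subspace_grow])
      have 1: "norm (iter m x (v - p)) \<le> (\<Sum>b\<in>Basis. norm (iter m x b)) * norm (v - p)"
      proof -
        have "norm (iter m x w) \<le> (\<Sum>b\<in>Basis. norm (iter m x b)) * norm w" for w
        proof -
          have "norm (iter m x w) = norm (\<Sum>b\<in>Basis. (w \<bullet> b) *\<^sub>R iter m x b)"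
            by (subst (1) euclidean_representation[symmetric, of w])
              (simp add: linear_sum[OF linear_iter] linear_scale[OF linear_iter])
          also have "\<dots> \<le> (\<Sum>b\<in>Basis. norm w * norm (iter m x b))"
            by (rule order_trans[OF norm_sum]) (auto intro!: sum_mono mult_right_mono Basis_le_norm)
          finally show ?thesis by (simp add: sum_distrib_left mult.commute)
        qed
        then show ?thesis .
      qed
      have "norm p \<le> norm v + norm (v - p)" using norm_triangle_sub[of p v] by (simp add: norm_minus_commute)
      then have 2: "norm (iter m x p) \<le> exp (s * real m) * (norm v + norm (v - p))"
        using *[rule_format, OF p(1)] by (meson exp_ge_zero mult_left_mono order_trans)
      have "iter m x v = iter m x p + iter m x (v - p)"
        using linear_add[OF linear_iter, of m x p "v - p"] by simp
      then have "norm (iter m x v) \<le> norm (iter m x p) + norm (iter m x (v - p))"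
        using norm_triangle_ineq by metis
      then show ?thesis using 1 2 p(2) by (simp add: c_def algebra_simps)
    qed
    then show "ok m x" unfolding ok_def by blast
  qed
  have ae_ok: "AE x in M. \<exists>N. x \<notin> bad N"
    using ae
  proof eventually_elim
    case (elim x)
    have "\<exists>R. \<forall>n. norm (iter n x v) \<le> R * exp (s1 * real n)" if "v \<in> grow x s" for v
      using elim that unfolding growth_space_def by blast
    then obtain R where R: "R > 0" "\<And>v n. v \<in> grow x s \<Longrightarrow> norm (iter n x v) \<le> R * \<bar>exp (s1 * real n)\<bar> * norm v"
      using linear_uniform_bound[OF subspace_grow[of x s], of "\<lambda>n. iter n x" "\<lambda>n. exp (s1 * real n)", OF linear_iter]
      by blast
    obtain m :: nat where m: "m \<ge> 1" "R * exp (s1 * real m) \<le> exp (s * real m)"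
      by (rule exp_power_eventually[OF s])
    have "ok m x"
      unfolding ok_iff
    proof
      fix v assume "v \<in> grow x s"
      then have "norm (iter m x v) \<le> R * exp (s1 * real m) * norm v" using R(2)[of v m] by simp
      also have "\<dots> \<le> exp (s * real m) * norm v" using m by (intro mult_right_mono) auto
      finally show "norm (iter m x v) \<le> exp (s * real m) * norm v" .
    qed
    then show ?case using m unfolding bad_def by (intro exI[of _ m]) auto
  qed
  \<comment> \<open>The greedy bound is applied to norms divided by \<open>exp (s * l)\<close>, and
    this normalization adds at most \<open>\<bar>s\<bar>\<close> to the logarithmic growth of one
    step.\<close>
  have u: "integrable M (\<lambda>x. g x + \<bar>s\<bar>)" "\<And>x. 0 \<le> g x + \<bar>s\<bar>"
    using g_integrable g_nonneg by auto
  have dec: "bad (Suc N) \<subseteq> bad N" for N unfolding bad_def by force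
  obtain N where N: "nearly (\<lambda>(C::real) x. \<forall>r. (\<forall>l. r l \<ge> 0) \<and> (\<forall>l. r (Suc l) \<le> exp (g ((f ^^ l) x) + \<bar>s\<bar>) * r l) \<and>
        (\<forall>l. (f ^^ l) x \<notin> bad N \<longrightarrow> (\<exists>m\<in>{1..N}. r (l + m) \<le> r l)) \<longrightarrow>
        (\<forall>n. \<forall>j\<le>n. r n \<le> exp (C + \<epsilon> * real n) * r j))"
    using nearly_greedy[OF u bad_meas dec ae_ok e] by blast
  then show ?thesis
  proof (rule nearly_mono, intro exI allI impI ballI)
    fix C x n j z
    assume *: "\<forall>r. (\<forall>l. r l \<ge> 0) \<and> (\<forall>l. r (Suc l) \<le> exp (g ((f ^^ l) x) + \<bar>s\<bar>) * r l) \<and>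
        (\<forall>l. (f ^^ l) x \<notin> bad N \<longrightarrow> (\<exists>m\<in>{1..N}. r (l + m) \<le> r l)) \<longrightarrow>
        (\<forall>n. \<forall>j\<le>n. r n \<le> exp (C + \<epsilon> * real n) * r j)"
      and j: "j \<le> n" and z: "z \<in> grow ((f ^^ j) x) s"
    obtain v where v: "v \<in> grow x s" "z = iter j x v" using z iter_image_grow[of j x s] by blast
    define r where "r l = norm (iter l x v) * exp (- s * real l)" for l
    have "r n \<le> exp (C + \<epsilon> * real n) * r j"
    proof (rule *[rule_format, OF _ j], safe)
      fix l
      show "0 \<le> r l" by (simp add: r_def)
      have "r (Suc l) \<le> (exp (g ((f ^^ l) x)) * norm (iter l x v)) * (exp \<bar>s\<bar> * exp (- s * real l))"
        unfolding r_def
      proof (intro mult_mono)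
        show "exp (- s * real (Suc l)) \<le> exp \<bar>s\<bar> * exp (- s * real l)"
          by (auto simp: algebra_simps simp flip: exp_add)
      qed (simp_all add: B_upper)
      then show "r (Suc l) \<le> exp (g ((f ^^ l) x) + \<bar>s\<bar>) * r l"
        by (simp add: r_def exp_add mult_ac)
      assume "(f ^^ l) x \<notin> bad N"
      then obtain m where m: "m \<in> {1..N}" "ok m ((f ^^ l) x)" unfolding bad_def space_UNIV by blast
      have "norm (iter (l + m) x v) \<le> exp (s * real m) * norm (iter l x v)"
        using m(2) v(1) unfolding ok_iff by (simp add: growth_space_iter_iff cocycle_iter_add add.commute[of l m])
      then have "r (l + m) \<le> (exp (s * real m) * norm (iter l x v)) * exp (- s * real (l + m))"
        unfolding r_def by (intro mult_right_mono) auto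
      also have "\<dots> = r l" by (simp add: r_def mult_ac flip: exp_add) (simp add: algebra_simps)
      finally show "\<exists>m\<in>{1..N}. r (l + m) \<le> r l" using m(1) by blast
    qed
    then have "norm (iter n x v) * exp (- s * real n) * exp (s * real n)
        \<le> exp (C + \<epsilon> * real n) * (norm z * exp (- s * real j)) * exp (s * real n)"
      unfolding r_def v(2) by (intro mult_right_mono) auto
    moreover have "iter n x v = iter (n - j) ((f ^^ j) x) z"
      using cocycle_iter_add[of f B "n - j" j x v] j v(2) by simp
    ultimately show "norm (iter (n - j) ((f ^^ j) x) z) \<le> exp (C + \<epsilon> * real n + s * real (n - j)) * norm z"
      using j by (simp add: exp_add of_nat_diff exp_minus exp_diff field_simps)
  qed
qed

text \<open>The components inside the invariant subspace that are created along the orbit of \<open>w\<close> grow at a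
  rate at most \<open>s\<close> by \<open>nearly_upper\<close>.\<close>

lemma quotient_growth:
  assumes C: "\<forall>n. \<forall>j\<le>n. \<forall>z\<in>grow ((f ^^ j) x) s.
      norm (iter (n - j) ((f ^^ j) x) z) \<le> exp (C + \<epsilon> * real n + s * real (n - j)) * norm z"
    and D: "\<forall>n. g ((f ^^ n) x) \<le> D + \<epsilon> * real n" and e: "\<epsilon> > 0"
    and q: "\<And>n. infdist (iter n x w) (grow ((f ^^ n) x) s) \<le> exp (s * real n)"
  shows "w \<in> grow x (s + 3 * \<epsilon>)"
proof -
  let ?V = "\<lambda>n. grow ((f ^^ n) x) s"
  have "\<exists>p. p \<in> ?V n \<and> norm (iter n x w - p) \<le> exp (s * real n)" for n
    using infdist_subspace_attained[OF subspace_grow[of "(f ^^ n) x" s], of "iter n x w"] q[of n] by metis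
  then obtain p where p: "\<And>n. p n \<in> ?V n" "\<And>n. norm (iter n x w - p n) \<le> exp (s * real n)" by metis
  \<comment> \<open>The factor \<open>exp (- s)\<close> arises because an increment of size about
    \<open>exp (s * l)\<close> is carried over the remaining \<open>n - l - 1\<close> steps, so that
    the exponents add up to \<open>n - 1\<close>.\<close>
  define K where "K = exp (C - s) * (exp D + exp s)"
  have K: "K \<ge> 0" by (simp add: K_def)
  have step: "norm (p (Suc l) - B ((f ^^ l) x) (p l)) \<le> (exp D + exp s) * exp (s * real l + \<epsilon> * real n)"
    if "l \<le> n" for l n
  proof -
    have el: "\<epsilon> * real l \<le> \<epsilon> * real n" using that e by (intro mult_left_mono) auto
    have "p (Suc l) - B ((f ^^ l) x) (p l)
        = B ((f ^^ l) x) (iter l x w - p l) - (iter (Suc l) x w - p (Suc l))"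
      by (simp add: linear_diff[OF linear_B])
    then have "norm (p (Suc l) - B ((f ^^ l) x) (p l))
        \<le> norm (B ((f ^^ l) x) (iter l x w - p l)) + norm (iter (Suc l) x w - p (Suc l))"
      using norm_triangle_ineq4 by metis
    also have "norm (B ((f ^^ l) x) (iter l x w - p l)) \<le> exp (g ((f ^^ l) x)) * norm (iter l x w - p l)"
      by (rule B_upper)
    also have "\<dots> \<le> exp (D + \<epsilon> * real n) * exp (s * real l)"
      using D[rule_format, of l] el by (intro mult_mono p) auto
    also have "norm (iter (Suc l) x w - p (Suc l)) \<le> exp (s * real (Suc l))" by (rule p)
    also have "\<dots> \<le> exp s * exp (s * real l + \<epsilon> * real n)"
      using e by (simp add: algebra_simps flip: exp_add)
    finally show ?thesis by (simp add: exp_add algebra_simps)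
  qed
  \<comment> \<open>The approximant \<open>p l\<close> is carried to time \<open>n\<close>. Passing
    from \<open>l\<close> to \<open>Suc l\<close> adds the increment
    \<open>p (Suc l) - B ((f ^^ l) x) (p l)\<close>, which lies in the invariant subspace and is
    therefore controlled by \<open>C\<close>.\<close>
  have ind: "norm (iter (n - l) ((f ^^ l) x) (p l))
      \<le> exp (C + \<epsilon> * real n + s * real n) * norm (p 0) + real l * (K * exp (2 * \<epsilon> * real n + s * real n))"
    if "l \<le> n" for l n
    using that
  proof (induction l)
    case 0
    show ?case using C[rule_format, of 0 n "p 0"] p(1)[of 0] by simp
  next
    case (Suc l)
    let ?z = "p (Suc l) - B ((f ^^ l) x) (p l)" and ?y = "(f ^^ Suc l) x"
    have B_mem: "B ((f ^^ l) x) (p l) \<in> ?V (Suc l)"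
      using p(1)[of l] growth_space_step_iff[of "p l" f B "(f ^^ l) x" s] by simp
    then have z: "?z \<in> ?V (Suc l)" using p(1) subspace_grow by (blast intro: subspace_diff)
    have "iter (n - l) ((f ^^ l) x) (p l) = iter (n - Suc l) ?y (B ((f ^^ l) x) (p l))"
      using Suc.prems cocycle_iter_Suc_right[of f B "n - Suc l" "(f ^^ l) x" "p l"]
      by (simp add: Suc_diff_Suc del: cocycle_iter.simps)
    then have "iter (n - Suc l) ?y (p (Suc l)) = iter (n - l) ((f ^^ l) x) (p l) + iter (n - Suc l) ?y ?z"
      by (simp add: linear_diff[OF linear_iter])
    then have "norm (iter (n - Suc l) ?y (p (Suc l)))
        \<le> norm (iter (n - l) ((f ^^ l) x) (p l)) + norm (iter (n - Suc l) ?y ?z)"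
      using norm_triangle_ineq by metis
    moreover have "norm (iter (n - Suc l) ?y ?z) \<le> K * exp (2 * \<epsilon> * real n + s * real n)"
    proof -
      have "norm (iter (n - Suc l) ?y ?z) \<le> exp (C + \<epsilon> * real n + s * real (n - Suc l)) * norm ?z"
        using C[rule_format, OF Suc.prems z] .
      also have "\<dots> \<le> exp (C + \<epsilon> * real n + s * real (n - Suc l)) *
          ((exp D + exp s) * exp (s * real l + \<epsilon> * real n))"
        using Suc.prems by (intro mult_left_mono step) auto
      also have "\<dots> = (exp D + exp s) * exp ((C + \<epsilon> * real n + s * real (n - Suc l)) + (s * real l + \<epsilon> * real n))"
        unfolding exp_add[of "C + \<epsilon> * real n + s * real (n - Suc l)"] by (simp add: mult_ac)
      also have "(C + \<epsilon> * real n + s * real (n - Suc l)) + (s * real l + \<epsilon> * real n)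
          = (C - s) + (2 * \<epsilon> * real n + s * real n)"
        using Suc.prems by (simp add: of_nat_diff algebra_simps)
      finally show ?thesis by (simp add: K_def exp_add mult_ac)
    qed
    ultimately show ?case using Suc by (simp add: algebra_simps)
  qed
  \<comment> \<open>Of the three \<epsilon>, one is the loss in \<open>C\<close>, one the tempered
    growth of \<open>g\<close> in \<open>D\<close>, and one absorbs the number \<open>n\<close> of
    increments.\<close>
  have "norm (iter n x w) \<le> (exp C * norm (p 0) + K / \<epsilon> + 1) * exp ((s + 3 * \<epsilon>) * real n)" for n
  proof -
    let ?e = "exp ((s + 3 * \<epsilon>) * real n)"
    have "\<epsilon> * real n \<le> exp (\<epsilon> * real n)" using exp_ge_add_one_self[of "\<epsilon> * real n"] by linarith
    then have n: "real n \<le> exp (\<epsilon> * real n) / \<epsilon>" using e by (simp add: field_simps)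
    have "norm (iter n x w) \<le> norm (p n) + norm (iter n x w - p n)"
      using norm_triangle_sub[of "iter n x w" "p n"] by simp
    also have "norm (p n) \<le> exp (C + \<epsilon> * real n + s * real n) * norm (p 0)
        + real n * (K * exp (2 * \<epsilon> * real n + s * real n))" using ind[of n n] by simp
    also have "exp (C + \<epsilon> * real n + s * real n) * norm (p 0) \<le> exp C * norm (p 0) * ?e"
    proof -
      have "exp (C + \<epsilon> * real n + s * real n) \<le> exp (C + (s + 3 * \<epsilon>) * real n)"
        using e by (simp add: algebra_simps)
      then have "exp (C + \<epsilon> * real n + s * real n) * norm (p 0) \<le> exp (C + (s + 3 * \<epsilon>) * real n) * norm (p 0)"
        by (rule mult_right_mono) simp
      then show ?thesis by (simp add: exp_add mult_ac)
    qed
    also have "real n * (K * exp (2 * \<epsilon> * real n + s * real n))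
        \<le> exp (\<epsilon> * real n) / \<epsilon> * (K * exp (2 * \<epsilon> * real n + s * real n))"
      using K by (intro mult_right_mono n) auto
    also have "\<dots> = K / \<epsilon> * ?e" by (simp add: algebra_simps exp_add)
       (simp add: mult.assoc[symmetric] flip: exp_add)
    also have "norm (iter n x w - p n) \<le> ?e"
      using p(2)[of n] e by (rule_tac order_trans[OF p(2)]) (simp add: algebra_simps)
    finally show ?thesis by (simp add: algebra_simps)
  qed
  then show ?thesis unfolding growth_space_def by blast
qed

text \<open>If at \<open>x\<close> no block length expands all quotient vectors at rate
  \<open>s\<close>, compactness of the sphere yields a unit vector at distance 1 from
  \<open>grow x s\<close> whose quotient norms never exceed \<open>exp (s * m)\<close>. By
  \<open>quotient_growth\<close> it lies in \<open>grow x s2\<close>, hence in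
  \<open>grow x s\<close>, which is absurd. So blocks exist almost everywhere and the greedy
  argument applies.\<close>

lemma nearly_lower:
  assumes s: "s1 < s" "s < s2" and ae: "AE x in M. grow x s2 \<subseteq> grow x s1" and e: "\<epsilon> > 0"
  shows "nearly (\<lambda>(C::real) x. \<forall>n v. exp (- C - \<epsilon> * real n + s * real n) * infdist v (grow x s)
    \<le> infdist (iter n x v) (grow ((f ^^ n) x) s))"
proof -
  let ?V = "\<lambda>x. grow x s"
  \<comment> \<open>Failing at all times up to \<open>N\<close> is an open condition on the vector,
    so some \<open>dense_seq i\<close> witnesses it. Conversely, \<open>good\<close> reaches all
    vectors because a finite union of closed sets is closed.\<close>
  define bad where "bad N = {x \<in> space M. \<exists>i. \<forall>m\<in>{1..N}.
    infdist (iter m x (dense_seq i)) (?V ((f ^^ m) x)) < exp (s * real m) * infdist (dense_seq i) (?V x)}" for N :: nat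
  have bad_meas: "bad N \<in> events" for N unfolding bad_def by measurable
  have cont: "continuous_on UNIV (iter m x)" for m x
    by (simp add: linear_continuous_on linear_conv_bounded_linear[symmetric] linear_iter)
  have good: "\<exists>m\<in>{1..N}. exp (s * real m) * infdist v (?V x) \<le> infdist (iter m x v) (?V ((f ^^ m) x))"
    if "x \<notin> bad N" for x N v
  proof -
    have "v \<in> (\<Union>m\<in>{1..N}. {v. exp (s * real m) * infdist v (?V x) \<le> infdist (iter m x v) (?V ((f ^^ m) x))})"
    proof (rule closed_dense_seq)
      show "dense_seq i \<in> (\<Union>m\<in>{1..N}. {v. exp (s * real m) * infdist v (?V x) \<le> infdist (iter m x v) (?V ((f ^^ m) x))})" for i
        using that unfolding bad_def space_UNIV by (auto simp: not_less)
    qed (intro closed_UN finite_atLeastAtMost ballI closed_Collect_le continuous_intros cont)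
    then show ?thesis by blast
  qed
  \<comment> \<open>The loss of 3 \<eta> in \<open>quotient_growth\<close> then leads exactly from
    \<open>s\<close> to \<open>s2\<close>.\<close>
  define \<eta> where "\<eta> = (s2 - s) / 3"
  have eta: "\<eta> > 0" using s by (simp add: \<eta>_def)
  have ae1: "AE x in M. grow x s \<subseteq> grow x s1"
    using ae by eventually_elim (use growth_space_mono[of s s2] s in force)
  have ae_ok: "AE x in M. \<exists>N. x \<notin> bad N"
    using ae AE_of_nearly[OF nearly_upper[OF s(1) ae1 eta]] AE_of_nearly[OF nearly_tempered[OF g_integrable eta]]
  proof eventually_elim
    case (elim x)
    note V = subspace_grow
    obtain C D where C: "\<forall>n. \<forall>j\<le>n. \<forall>z\<in>grow ((f ^^ j) x) s.
      norm (iter (n - j) ((f ^^ j) x) z) \<le> exp (C + \<eta> * real n + s * real (n - j)) * norm z"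
      and D: "\<forall>n. g ((f ^^ n) x) \<le> D + \<eta> * real n" using elim by blast
    show ?case
    proof (rule ccontr)
      assume "\<not> ?thesis"
      then have "\<exists>v. \<forall>m\<in>{1..N}. infdist (iter m x v) (?V ((f ^^ m) x)) < exp (s * real m) * infdist v (?V x)" for N
        unfolding bad_def by blast
      \<comment> \<open>The range up to \<open>Suc N\<close> contains the time 1, and the strict
        inequality there forces \<open>v\<close> to have positive distance from
        \<open>grow x s\<close>.\<close>
      then have ex: "\<exists>v. \<forall>m\<in>{1..Suc N}. infdist (iter m x v) (?V ((f ^^ m) x)) < exp (s * real m) * infdist v (?V x)" for N
        by blast
      have "\<exists>w. norm w = 1 \<and> infdist w (?V x) = 1 \<and>
        (\<forall>m\<in>{1..Suc N}. infdist (iter m x w) (?V ((f ^^ m) x)) \<le> exp (s * real m))" for N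
      proof -
        obtain v where v: "\<And>m. m \<in> {1..Suc N} \<Longrightarrow> infdist (iter m x v) (?V ((f ^^ m) x)) < exp (s * real m) * infdist v (?V x)"
          using ex by blast
        let ?c = "infdist v (?V x)"
        have c: "?c > 0" using v[of 1] infdist_nonneg[of "iter 1 x v" "?V ((f ^^ 1) x)"] infdist_nonneg[of v "?V x"]
          by (cases "?c = 0") auto
        obtain u where u: "u \<in> ?V x" "norm (v - u) = ?c" by (rule infdist_subspace_attained[OF V])
        have inf_diff: "infdist (iter m x (v - u)) (?V ((f ^^ m) x)) = infdist (iter m x v) (?V ((f ^^ m) x))" for m
        proof -
          have "- iter m x u \<in> ?V ((f ^^ m) x)"
            using u(1) by (simp add: growth_space_iter_iff subspace_neg[OF V])
          from infdist_subspace_add[OF V this, of "iter m x v"] show ?thesis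
            by (simp add: linear_diff[OF linear_iter])
        qed
        let ?w = "inverse ?c *\<^sub>R (v - u)"
        show ?thesis
        proof (intro exI[of _ ?w] conjI ballI)
          show "norm ?w = 1" using u c by simp
          show "infdist ?w (?V x) = 1"
            using inf_diff[of 0] c by (simp add: infdist_subspace_scaleR[OF V])
          fix m assume m: "m \<in> {1..Suc N}"
          have "infdist (iter m x ?w) (?V ((f ^^ m) x)) = inverse ?c * infdist (iter m x v) (?V ((f ^^ m) x))"
            using inf_diff[of m] c
            by (simp add: linear_scale[OF linear_iter] infdist_subspace_scaleR[OF V])
          also have "\<dots> \<le> inverse ?c * (exp (s * real m) * ?c)"
            using v[OF m] c by (intro mult_left_mono) auto
          finally show "infdist (iter m x ?w) (?V ((f ^^ m) x)) \<le> exp (s * real m)"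
            using c by (simp add: field_simps)
        qed
      qed
      then obtain w where w: "\<And>N. norm (w N) = 1" "\<And>N. infdist (w N) (?V x) = 1"
        "\<And>N m. m \<in> {1..Suc N} \<Longrightarrow> infdist (iter m x (w N)) (?V ((f ^^ m) x)) \<le> exp (s * real m)" by metis
      have "\<forall>N. w N \<in> sphere 0 1" using w(1) by simp
      then obtain u \<sigma> where u: "u \<in> sphere 0 1" "strict_mono \<sigma>" "(w \<circ> \<sigma>) \<longlonglongrightarrow> u"
        using compact_sphere[of 0 "1::real"] unfolding compact_def by meson
      have lim: "(\<lambda>k. infdist (iter m x (w (\<sigma> k))) (?V ((f ^^ m) x))) \<longlonglongrightarrow> infdist (iter m x u) (?V ((f ^^ m) x))" for m
        using u(3) cont[of m x]
        by (intro tendsto_infdist continuous_on_tendsto_compose[of UNIV "iter m x"]) (auto simp: o_def)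
      have "infdist (iter m x u) (?V ((f ^^ m) x)) \<le> exp (s * real m)" for m
      proof (cases "m = 0")
        case True
        have "infdist u (?V x) \<le> norm u" by (rule infdist_subspace_le_norm[OF V])
        then show ?thesis using True u(1) by simp
      next
        case False
        have "infdist (iter m x (w (\<sigma> k))) (?V ((f ^^ m) x)) \<le> exp (s * real m)" if "k \<ge> m" for k
          using w(3)[of m "\<sigma> k"] strict_mono_imp_increasing[OF u(2), of k] that False by simp
        then show ?thesis by (intro LIMSEQ_le_const2[OF lim]) blast
      qed
      then have "u \<in> grow x (s + 3 * \<eta>)" by (rule quotient_growth[OF C D eta])
      moreover have "s + 3 * \<eta> = s2" by (simp add: \<eta>_def field_simps)
      ultimately have "u \<in> grow x s2" by simp
      then have "u \<in> ?V x" using elim(1) growth_space_mono[of s1 s] s by fastforce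
      then have "infdist u (?V x) = 0" by simp
      moreover have "infdist u (?V x) = 1" using lim[of 0] w(2) by (simp add: LIMSEQ_const_iff)
      ultimately show False by simp
    qed
  qed
  have u: "integrable M (\<lambda>x. g x + \<bar>s\<bar>)" "\<And>x. 0 \<le> g x + \<bar>s\<bar>"
    using g_integrable g_nonneg by auto
  have dec: "bad (Suc N) \<subseteq> bad N" for N unfolding bad_def by force
  obtain N where N: "nearly (\<lambda>(C::real) x. \<forall>r. (\<forall>l. r l \<ge> 0) \<and> (\<forall>l. r (Suc l) \<le> exp (g ((f ^^ l) x) + \<bar>s\<bar>) * r l) \<and>
        (\<forall>l. (f ^^ l) x \<notin> bad N \<longrightarrow> (\<exists>m\<in>{1..N}. r (l + m) \<le> r l)) \<longrightarrow>
        (\<forall>n. \<forall>j\<le>n. r n \<le> exp (C + \<epsilon> * real n) * r j))"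
    using nearly_greedy[OF u bad_meas dec ae_ok e] by blast
  then show ?thesis
  proof (rule nearly_mono, intro exI allI impI)
    fix C x n v
    assume *: "\<forall>r. (\<forall>l. r l \<ge> 0) \<and> (\<forall>l. r (Suc l) \<le> exp (g ((f ^^ l) x) + \<bar>s\<bar>) * r l) \<and>
        (\<forall>l. (f ^^ l) x \<notin> bad N \<longrightarrow> (\<exists>m\<in>{1..N}. r (l + m) \<le> r l)) \<longrightarrow>
        (\<forall>n. \<forall>j\<le>n. r n \<le> exp (C + \<epsilon> * real n) * r j)"
    define q where "q l = infdist (iter l x v) (?V ((f ^^ l) x))" for l
    have q_step: "exp (- g ((f ^^ l) x)) * q l \<le> q (Suc l)" for l
      using infdist_linear_ge[OF linear_B[of "(f ^^ l) x"] B_lower _ subspace_grow[of "(f ^^ l) x" s]]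
      by (simp add: q_def B_image_grow)
    show "exp (- C - \<epsilon> * real n + s * real n) * infdist v (?V x) \<le> infdist (iter n x v) (?V ((f ^^ n) x))"
    proof (cases "q 0 > 0")
      case False
      then have "infdist v (?V x) = 0" using infdist_nonneg[of v "?V x"] by (simp add: q_def)
      then show ?thesis by (simp add: infdist_nonneg)
    next
      case True
      have q_pos: "q l > 0" for l
      proof (induction l)
        case (Suc l)
        then have "exp (- g ((f ^^ l) x)) * q l > 0" by simp
        then show ?case using q_step[of l] by linarith
      qed (rule True)
      \<comment> \<open>The reciprocal turns the upper bound of the greedy argument into a lower
        bound for the quotient norms.\<close>
      define r where "r l = exp (s * real l) / q l" for l
      have "r n \<le> exp (C + \<epsilon> * real n) * r 0"
      proof (rule *[rule_format, of r 0 n], safe)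
        fix l
        show "0 \<le> r l" using q_pos[of l] by (simp add: r_def)
        have "r (Suc l) \<le> exp (s * real (Suc l)) / (exp (- g ((f ^^ l) x)) * q l)"
          unfolding r_def using q_step[of l] q_pos[of l] by (intro divide_left_mono) (auto simp: q_pos)
        also have "\<dots> = exp (g ((f ^^ l) x) + s) * r l"
          by (simp add: r_def exp_add exp_minus field_simps)
        also have "\<dots> \<le> exp (g ((f ^^ l) x) + \<bar>s\<bar>) * r l"
          using q_pos[of l] by (intro mult_right_mono) (auto simp: r_def)
        finally show "r (Suc l) \<le> exp (g ((f ^^ l) x) + \<bar>s\<bar>) * r l" .
        assume "(f ^^ l) x \<notin> bad N"
        from good[OF this, of "iter l x v"] obtain m where m: "m \<in> {1..N}" "exp (s * real m) * q l \<le> q (l + m)"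
          by (auto simp: q_def cocycle_iter_add funpow_add add.commute[of l])
        have "r (l + m) \<le> exp (s * real (l + m)) / (exp (s * real m) * q l)"
          unfolding r_def using m(2) q_pos[of l] by (intro divide_left_mono) (auto simp: q_pos)
        also have "\<dots> = r l" by (simp add: r_def exp_add algebra_simps)
        finally show "\<exists>m\<in>{1..N}. r (l + m) \<le> r l" using m(1) by blast
      qed
      then have "exp (s * real n) * q 0 \<le> exp (C + \<epsilon> * real n) * q n"
        using q_pos[of n] q_pos[of 0] by (simp add: r_def field_simps)
      then have "exp (- C - \<epsilon> * real n) * (exp (s * real n) * q 0) \<le> exp (- C - \<epsilon> * real n) * (exp (C + \<epsilon> * real n) * q n)"
        by (intro mult_left_mono) auto
      then show ?thesis by (simp add: q_def mult.assoc[symmetric] flip: exp_add)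
    qed
  qed
qed

end

section \<open>Dependence of growth spaces on the base point\<close>

text \<open>Hoelder estimates compare two points, both of which must be taken from the same good
  set.\<close>

definition (in prob_space) nearly_pair :: "('c \<Rightarrow> 'a \<Rightarrow> 'a \<Rightarrow> bool) \<Rightarrow> bool" where
  "nearly_pair Q \<longleftrightarrow> (\<forall>\<delta>>0. \<exists>S\<in>events. \<exists>C. prob S \<ge> 1 - \<delta> \<and> (\<forall>x\<in>S. \<forall>y\<in>S. Q C x y))"

context prob_space
begin

lemma nearly_pairI:
  assumes "nearly P" and "\<And>C. \<exists>C'. \<forall>x y. P C x \<longrightarrow> P C y \<longrightarrow> Q C' x y"
  shows "nearly_pair Q"
  unfolding nearly_pair_def
proof (intro allI impI)
  fix \<delta> :: real assume "\<delta> > 0"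
  then obtain S C where S: "S \<in> events" "prob S \<ge> 1 - \<delta>" "\<forall>x\<in>S. P C x"
    using assms(1) unfolding nearly_def by blast
  obtain C' where "\<forall>x y. P C x \<longrightarrow> P C y \<longrightarrow> Q C' x y" using assms(2) by blast
  then show "\<exists>S\<in>events. \<exists>C. prob S \<ge> 1 - \<delta> \<and> (\<forall>x\<in>S. \<forall>y\<in>S. Q C x y)"
    using S by (intro bexI[of _ S] exI[of _ C']) auto
qed

lemma nearly_pair_mono:
  assumes "nearly_pair P" and "\<And>C. \<exists>C'. \<forall>x y. P C x y \<longrightarrow> Q C' x y"
  shows "nearly_pair Q"
  unfolding nearly_pair_def
proof (intro allI impI)
  fix \<delta> :: real assume "\<delta> > 0"
  then obtain S C where S: "S \<in> events" "prob S \<ge> 1 - \<delta>" "\<forall>x\<in>S. \<forall>y\<in>S. P C x y"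
    using assms(1) unfolding nearly_pair_def by blast
  obtain C' where "\<forall>x y. P C x y \<longrightarrow> Q C' x y" using assms(2) by blast
  then show "\<exists>S\<in>events. \<exists>C. prob S \<ge> 1 - \<delta> \<and> (\<forall>x\<in>S. \<forall>y\<in>S. Q C x y)"
    using S by (intro bexI[of _ S] exI[of _ C']) auto
qed

lemma nearly_pair_conj:
  assumes "nearly_pair P" "nearly_pair Q"
  shows "nearly_pair (\<lambda>(C, D) x y. P C x y \<and> Q D x y)"
  unfolding nearly_pair_def
proof (intro allI impI)
  fix \<delta> :: real assume "\<delta> > 0"
  then have h: "\<delta> / 2 > 0" by simp
  obtain S C where S: "S \<in> events" "prob S \<ge> 1 - \<delta> / 2" "\<forall>x\<in>S. \<forall>y\<in>S. P C x y"
    using assms(1) h unfolding nearly_pair_def by blast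
  obtain T D where T: "T \<in> events" "prob T \<ge> 1 - \<delta> / 2" "\<forall>x\<in>T. \<forall>y\<in>T. Q D x y"
    using assms(2) h unfolding nearly_pair_def by blast
  show "\<exists>S\<in>events. \<exists>C. prob S \<ge> 1 - \<delta> \<and>
      (\<forall>x\<in>S. \<forall>y\<in>S. (case C of (C, D) \<Rightarrow> \<lambda>x y. P C x y \<and> Q D x y) x y)"
    using S T prob_Int_ge[OF S(1) T(1) S(2) T(2)]
    by (intro bexI[of _ "S \<inter> T"] exI[of _ "(C, D)"]) auto
qed

text \<open>Where the subspaces meet only in 0, the compact unit sphere of \<open>V x\<close> has
  positive distance from the closed set \<open>W x\<close>; this angle gives a constant at
  \<open>x\<close>, and \<open>nearly_AE_nat\<close> makes it uniform.\<close>

lemma nearly_transversal: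
  fixes V W :: "'a \<Rightarrow> 'v::euclidean_space set"
  assumes V: "\<And>x. subspace (V x)" and W: "\<And>x. subspace (W x)"
    and V_meas [measurable]: "\<And>v. (\<lambda>x. infdist v (V x)) \<in> borel_measurable M"
    and W_meas [measurable]: "\<And>v. (\<lambda>x. infdist v (W x)) \<in> borel_measurable M"
    and ae: "AE x in M. V x \<inter> W x = {0}"
  shows "nearly (\<lambda>(C::real) x. \<forall>v\<in>V x. \<forall>w\<in>W x. norm v \<le> C * norm (v + w))"
proof -
  \<comment> \<open>A form meaningful for every vector, hence testable on \<open>dense_seq\<close>.
    For vectors of \<open>V x\<close> the second term vanishes and the wanted inequality remains;
    for the others that term pays for projecting onto \<open>V x\<close>.\<close>
  have "nearly (\<lambda>C x. \<forall>i. norm (dense_seq i :: 'v)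
      \<le> real C * infdist (dense_seq i) (W x) + (real C + 1) * infdist (dense_seq i) (V x))"
  proof (rule nearly_AE_nat)
    show "{x \<in> space M. \<forall>i. norm (dense_seq i :: 'v)
        \<le> real C * infdist (dense_seq i) (W x) + (real C + 1) * infdist (dense_seq i) (V x)} \<in> events" for C
      by measurable
    show "\<forall>i. norm (dense_seq i :: 'v)
        \<le> real (Suc C) * infdist (dense_seq i) (W x) + (real (Suc C) + 1) * infdist (dense_seq i) (V x)"
      if *: "\<forall>i. norm (dense_seq i :: 'v)
        \<le> real C * infdist (dense_seq i) (W x) + (real C + 1) * infdist (dense_seq i) (V x)" for C x
    proof
      fix i
      show "norm (dense_seq i :: 'v)
        \<le> real (Suc C) * infdist (dense_seq i) (W x) + (real (Suc C) + 1) * infdist (dense_seq i) (V x)"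
        using *[rule_format, of i] infdist_nonneg[of "dense_seq i" "V x"] infdist_nonneg[of "dense_seq i" "W x"]
        by (simp add: algebra_simps)
    qed
    show "AE x in M. \<exists>C. \<forall>i. norm (dense_seq i :: 'v)
        \<le> real C * infdist (dense_seq i) (W x) + (real C + 1) * infdist (dense_seq i) (V x)"
      using ae
    proof eventually_elim
      case (elim x)
      have c: "compact (sphere 0 1 \<inter> V x)" by (rule compact_Int_closed[OF compact_sphere closed_subspace[OF V]])
      have disj: "sphere 0 1 \<inter> V x \<inter> W x = {}" by (simp add: Int_assoc elim)
      obtain d where d: "d > 0" "\<And>v w. v \<in> sphere 0 1 \<inter> V x \<Longrightarrow> w \<in> W x \<Longrightarrow> d \<le> dist v w"
        using separate_compact_closed[OF c closed_subspace[OF W] disj] by meson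
      have dV: "d * norm v \<le> norm (v - w)" if v: "v \<in> V x" and w: "w \<in> W x" for v w
      proof (cases "v = 0")
        case False
        have "d \<le> dist (inverse (norm v) *\<^sub>R v) (inverse (norm v) *\<^sub>R w)"
          using v w False by (intro d) (auto simp: subspace_scale[OF V] subspace_scale[OF W])
        also have "\<dots> = inverse (norm v) * norm (v - w)"
          by (simp add: dist_norm flip: scaleR_diff_right)
        finally show ?thesis using False by (simp add: field_simps)
      qed simp
      obtain C :: nat where C: "1 / d \<le> real C" using real_arch_simple by blast
      have "norm v \<le> real C * infdist v (W x) + (real C + 1) * infdist v (V x)" for v
      proof -
        obtain p where p: "p \<in> V x" "norm (v - p) = infdist v (V x)" by (rule infdist_subspace_attained[OF V])
        obtain q where q: "q \<in> W x" "norm (v - q) = infdist v (W x)" by (rule infdist_subspace_attained[OF W])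
        have "norm (p - q) \<le> norm (v - q) + norm (v - p)"
          using norm_triangle_ineq4[of "v - q" "v - p"] by simp
        have "norm p \<le> 1 / d * norm (p - q)" using dV[OF p(1) q(1)] d(1) by (simp add: field_simps)
        also have "\<dots> \<le> real C * (norm (v - q) + norm (v - p))"
          by (rule mult_mono[OF C \<open>norm (p - q) \<le> _\<close>]) auto
        finally have "norm p \<le> real C * (infdist v (W x) + infdist v (V x))" unfolding p(2) q(2) .
        moreover have "norm v \<le> norm p + infdist v (V x)" using norm_triangle_sub[of v p] p(2) by simp
        ultimately show ?thesis by (simp add: distrib_left distrib_right)
      qed
      then show ?case by blast
    qed
  qed
  then show ?thesis
  proof (rule nearly_mono, intro exI allI impI ballI)
    fix C x v w
    assume *: "\<forall>i. norm (dense_seq i :: 'v)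
      \<le> real C * infdist (dense_seq i) (W x) + (real C + 1) * infdist (dense_seq i) (V x)"
      and v: "v \<in> V x" and w: "w \<in> W x"
    have "v \<in> {v. norm v \<le> real C * infdist v (W x) + (real C + 1) * infdist v (V x)}"
      by (rule closed_dense_seq)
        (use * in \<open>auto intro!: closed_Collect_le continuous_intros\<close>)
    then have "norm v \<le> real C * infdist v (W x)" using v by simp
    also have "infdist v (W x) \<le> dist v (- w)" using w by (intro infdist_le) (simp add: subspace_neg[OF W])
    finally show "norm v \<le> real C * norm (v + w)" by (simp add: dist_norm mult_left_mono)
  qed
qed

end

text \<open>With \<alpha> and \<beta> one quarter and three quarters of the way from
  \<open>a\<close> to \<open>b\<close>, this is (\<beta> - \<alpha>) / (max b \<kappa> - \<alpha>),
  the power produced by \<open>optimize_rate\<close>. The maximum with \<open>b\<close> keeps it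
  below 1.\<close>

definition gap_exponent :: "real \<Rightarrow> real \<Rightarrow> real \<Rightarrow> real" where
  "gap_exponent a b \<kappa> = (b - a) / 2 / (max b \<kappa> - a - (b - a) / 4)"

lemma gap_exponent_bounds:
  assumes "a < b" shows "0 < gap_exponent a b \<kappa>" "gap_exponent a b \<kappa> < 1"
proof -
  have "m - a - (b - a) / 4 > 0" "m - a - (b - a) / 4 > (b - a) / 2" if "m \<ge> b" for m
    using that assms by (simp_all add: field_simps)
  note 2 = this[OF max.cobounded1]
  show "0 < gap_exponent a b \<kappa>" "gap_exponent a b \<kappa> < 1"
    unfolding gap_exponent_def by (rule divide_pos_pos, use assms 2[of \<kappa>] in simp)
      (use 2[of \<kappa>] in \<open>simp_all only: divide_less_eq_1_pos\<close>)
qed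

text \<open>The two terms in the bound balance at \<open>n \<approx> - ln \<delta> / (\<kappa> - \<alpha>)\<close>.\<close>

lemma optimize_rate:
  fixes w K \<alpha> \<beta> \<kappa> \<delta> :: real
  assumes le: "\<And>n::nat. w \<le> K * exp (- \<beta> * real n) * (exp (\<alpha> * real n) + exp (\<kappa> * real n) * \<delta>)"
    and K: "K \<ge> 0" and d: "0 < \<delta>" "\<delta> \<le> 1" and ab: "\<alpha> < \<beta>" "\<beta> \<le> \<kappa>"
  shows "w \<le> 2 * K * exp (\<beta> - \<alpha>) * \<delta> powr ((\<beta> - \<alpha>) / (\<kappa> - \<alpha>))"
proof -
  define \<theta> where "\<theta> = \<kappa> - \<alpha>"
  have th: "\<theta> > 0" using ab by (simp add: \<theta>_def)
  define t where "t = - ln \<delta> / \<theta>"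
  \<comment> \<open>Rounding down keeps the second term below the first; being at most 1 below the
    optimal time costs the factor \<open>exp (\<beta> - \<alpha>)\<close>.\<close>
  define n where "n = nat \<lfloor>t\<rfloor>"
  have "t \<ge> 0" using d th by (simp add: t_def field_simps)
  then have n: "real n \<le> t" "t \<le> real n + 1" unfolding n_def by linarith+
  have "\<kappa> * real n + ln \<delta> \<le> \<alpha> * real n"
    using n(1) th by (simp add: t_def \<theta>_def field_simps)
  then have "exp (\<kappa> * real n) * \<delta> \<le> exp (\<alpha> * real n)"
    using d by (metis exp_add exp_le_cancel_iff exp_ln)
  then have "w \<le> K * exp (- \<beta> * real n) * (exp (\<alpha> * real n) + exp (\<alpha> * real n))"
    using K by (intro order_trans[OF le[of n]] mult_left_mono) auto
  also have "\<dots> = 2 * K * exp ((\<alpha> - \<beta>) * real n)"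
    by (simp add: algebra_simps flip: exp_add)
  also have "\<dots> \<le> 2 * K * exp ((\<beta> - \<alpha>) + (\<alpha> - \<beta>) * t)"
  proof -
    have "(\<beta> - \<alpha>) * t \<le> (\<beta> - \<alpha>) * (real n + 1)" using ab n by (intro mult_left_mono) auto
    then have "(\<alpha> - \<beta>) * real n \<le> (\<beta> - \<alpha>) + (\<alpha> - \<beta>) * t" by (simp add: algebra_simps)
    then show ?thesis using K by (intro mult_left_mono) auto
  qed
  also have "(\<beta> - \<alpha>) + (\<alpha> - \<beta>) * t = (\<beta> - \<alpha>) + (\<beta> - \<alpha>) / (\<kappa> - \<alpha>) * ln \<delta>"
    using th by (simp add: t_def field_simps flip: \<theta>_def)
  finally show ?thesis using d by (simp add: exp_add powr_def mult.assoc)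
qed

text \<open>The factor \<open>exp (g x + g y)\<close> in the Hoelder condition is there for the
  inverse cocycle: inverses of matrices vary in a Hoelder way only up to the norms of the inverses
  at both points.\<close>

locale hoelder_linear_cocycle = linear_cocycle M f B g
  for M :: "'a::metric_space measure" and f and B :: "'a \<Rightarrow> 'v::euclidean_space \<Rightarrow> 'v" and g +
  fixes H L \<nu> :: real
  assumes H_nonneg: "H \<ge> 0" and L_ge_1: "L \<ge> 1" and nu_pos: "\<nu> > 0"
    and f_lipschitz: "dist (f x) (f y) \<le> L * dist x y"
    and B_hoelder: "norm (B x v - B y v) \<le> H * exp (g x + g y) * dist x y powr \<nu> * norm v"
begin

lemma dist_funpow: "dist ((f ^^ n) x) ((f ^^ n) y) \<le> L ^ n * dist x y"
proof (induction n)
  case (Suc n)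
  have "dist ((f ^^ Suc n) x) ((f ^^ Suc n) y) \<le> L * dist ((f ^^ n) x) ((f ^^ n) y)"
    using f_lipschitz by simp
  also have "\<dots> \<le> L * (L ^ n * dist x y)" using Suc L_ge_1 by (intro mult_left_mono) auto
  finally show ?case by simp
qed simp

text \<open>Telescoping over the time \<open>j\<close> at which the product switches from the orbit
  of \<open>y\<close> to that of \<open>x\<close>: each difference contains one factor
  \<open>B\<close> at two points at distance at most \<open>L ^ j * dist x y\<close>. In the 5, one
  unit is lost in the product along \<open>x\<close>, one in the product along \<open>y\<close>, two
  in the values of \<open>g\<close>, and one in the number of terms.\<close>

lemma iter_diff_bound:
  assumes s: "s \<ge> 0"
    and x: "\<forall>n. \<forall>j\<le>n. \<forall>z. norm (iter (n - j) ((f ^^ j) x) z) \<le> exp (C + real n + s * real (n - j)) * norm z"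
    and y: "\<forall>n. \<forall>j\<le>n. \<forall>z. norm (iter (n - j) ((f ^^ j) y) z) \<le> exp (C + real n + s * real (n - j)) * norm z"
    and gx: "\<forall>n. g ((f ^^ n) x) \<le> D + real n" and gy: "\<forall>n. g ((f ^^ n) y) \<le> D + real n"
  shows "norm (iter n x v - iter n y v)
    \<le> H * exp (2 * C + 2 * D) * exp ((s + 5 + \<nu> * ln L) * real n) * dist x y powr \<nu> * norm v"
proof -
  let ?d = "dist x y powr \<nu>" and ?K = "H * exp (2 * C + 2 * D)" and ?q = "s + 4 + \<nu> * ln L"
  have lnL: "\<nu> * ln L \<ge> 0" using nu_pos L_ge_1 by simp
  have q: "?q \<ge> 0" using s lnL by simp
  define E where "E j = iter (n - j) ((f ^^ j) x) (iter j y v)" for j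
  have step: "norm (E j - E (Suc j)) \<le> ?K * exp (?q * real n) * ?d * norm v" if j: "j < n" for j
  proof -
    let ?xj = "(f ^^ j) x" and ?yj = "(f ^^ j) y" and ?z = "iter j y v"
    have "E j = iter (n - Suc j) ((f ^^ Suc j) x) (B ?xj ?z)"
      using j cocycle_iter_Suc_right[of f B "n - Suc j" ?xj ?z]
      by (simp add: E_def Suc_diff_Suc del: cocycle_iter.simps)
    then have "E j - E (Suc j) = iter (n - Suc j) ((f ^^ Suc j) x) (B ?xj ?z - B ?yj ?z)"
      by (simp add: E_def linear_diff[OF linear_iter])
    then have "norm (E j - E (Suc j)) \<le> exp (C + real n + s * real (n - Suc j)) * norm (B ?xj ?z - B ?yj ?z)"
      using x[rule_format, OF Suc_leI[OF j]] by metis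
    also have "\<dots> \<le> exp (C + real n + s * real (n - Suc j)) * (H * exp (2 * D + 2 * real j)
        * (exp (\<nu> * ln L * real j) * ?d) * (exp (C + real j + s * real j) * norm v))"
    proof (rule mult_left_mono)
      have 1: "g ?xj + g ?yj \<le> 2 * D + 2 * real j" using gx[rule_format, of j] gy[rule_format, of j] by simp
      have "dist ?xj ?yj powr \<nu> \<le> (L ^ j * dist x y) powr \<nu>"
        using nu_pos by (intro powr_mono2 dist_funpow) auto
      also have "\<dots> = (L ^ j) powr \<nu> * ?d" using L_ge_1 by (simp add: powr_mult)
      also have "(L ^ j) powr \<nu> = exp (\<nu> * ln L * real j)"
        using L_ge_1 by (simp add: powr_def ln_realpow)
      finally have 2: "dist ?xj ?yj powr \<nu> \<le> exp (\<nu> * ln L * real j) * ?d" .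
      have 3: "norm ?z \<le> exp (C + real j + s * real j) * norm v" using y[rule_format, of 0 j v] by simp
      have "norm (B ?xj ?z - B ?yj ?z) \<le> H * exp (g ?xj + g ?yj) * dist ?xj ?yj powr \<nu> * norm ?z"
        by (rule B_hoelder)
      also have "\<dots> \<le> H * exp (2 * D + 2 * real j)
        * (exp (\<nu> * ln L * real j) * ?d) * (exp (C + real j + s * real j) * norm v)"
        using H_nonneg 1 by (intro mult_mono[OF mult_mono[OF mult_left_mono 2] 3]) auto
      finally show "norm (B ?xj ?z - B ?yj ?z) \<le> H * exp (2 * D + 2 * real j)
        * (exp (\<nu> * ln L * real j) * ?d) * (exp (C + real j + s * real j) * norm v)" .
    qed simp
    also have "\<dots> = ?K * exp (real n + s * real (n - Suc j) + 3 * real j + \<nu> * ln L * real j + s * real j) * ?d * norm v"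
    proof -
      have "exp A * (H * exp Q * (exp N * d) * (exp P * r)) = H * exp (A + Q + N + P) * d * r" for A Q N P d r :: real
        by (simp add: exp_add)
      moreover have "(C + real n + s * real (n - Suc j)) + (2 * D + 2 * real j) + \<nu> * ln L * real j
          + (C + real j + s * real j)
        = (2 * C + 2 * D) + (real n + s * real (n - Suc j) + 3 * real j + \<nu> * ln L * real j + s * real j)"
        by simp
      ultimately show ?thesis by (simp only: exp_add[of "2 * C + 2 * D"] mult.assoc)
    qed
    also have "\<dots> \<le> ?K * exp (?q * real n) * ?d * norm v"
    proof -
      have "n - Suc j + j = n - 1" using j by simp
      then have "s * real (n - Suc j) + s * real j = s * real (n - 1)"
        by (metis of_nat_add distrib_left)
      also have "\<dots> \<le> s * real n" using s by (intro mult_left_mono) auto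
      finally have 1: "s * real (n - Suc j) + s * real j \<le> s * real n" .
      have "\<nu> * ln L * real j \<le> \<nu> * ln L * real n" using j lnL by (intro mult_left_mono) auto
      then have "real n + s * real (n - Suc j) + 3 * real j + \<nu> * ln L * real j + s * real j \<le> ?q * real n"
        using 1 j by (simp add: algebra_simps)
      then show ?thesis using H_nonneg by (intro mult_right_mono mult_left_mono) auto
    qed
    finally show ?thesis .
  qed
  have "norm (E 0 - E j) \<le> real j * (?K * exp (?q * real n) * ?d * norm v)" if "j \<le> n" for j
    using that
  proof (induction j)
    case (Suc j)
    have "norm (E 0 - E (Suc j)) \<le> norm (E 0 - E j) + norm (E j - E (Suc j))"
      using norm_triangle_ineq[of "E 0 - E j" "E j - E (Suc j)"] by simp
    then show ?case using Suc step[of j] by (simp add: algebra_simps)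
  qed simp
  from this[of n] have "norm (iter n x v - iter n y v) \<le> real n * (?K * exp (?q * real n) * ?d * norm v)"
    by (simp add: E_def)
  also have "\<dots> \<le> exp (real n) * (?K * exp (?q * real n) * ?d * norm v)"
  proof (rule mult_right_mono)
    show "real n \<le> exp (real n)" using exp_ge_add_one_self[of "real n"] by linarith
  qed (use H_nonneg in auto)
  also have "\<dots> = ?K * exp (?q * real n + real n) * ?d * norm v"
    by (simp add: exp_add)
  finally show ?thesis by (simp add: algebra_simps)
qed

text \<open>Let \<open>u\<close> be the point of \<open>grow y t\<close> nearest to
  \<open>v\<close>. The growth of \<open>v - u\<close> along \<open>y\<close> is bounded below by
  the quotient rate times the distance sought, and above by the slow growth of \<open>v\<close>
  along \<open>x\<close>, that of \<open>u\<close> along \<open>y\<close>, and the separation of the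
  two cocycles. \<open>optimize_rate\<close> then selects the time.\<close>

theorem nearly_pair_grow:
  assumes ab: "a < b" and t: "t \<in> {a<..<b}"
    and gap: "AE x in M. \<forall>s\<in>{a<..<b}. grow x s = grow x t"
    and top: "AE x in M. \<forall>s>c. grow x s = UNIV"
  shows "nearly_pair (\<lambda>K x y. K > 0 \<and> (dist x y < 1 \<longrightarrow> (\<forall>v\<in>grow x t. infdist v (grow y t)
    \<le> K * dist x y powr (\<nu> * gap_exponent a b (max 0 c + 6 + \<nu> * ln L)) * norm v)))"
proof -
  \<comment> \<open>Level \<open>a + 2 * h\<close> with loss \<open>2 * h\<close> gives the slow
    rate \<alpha> = a + 4 h, and level \<open>a + 14 * h\<close> with the same loss gives the fast
    rate \<beta> = a + 12 h. These are the quarter points used in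
    \<open>gap_exponent\<close>.\<close>
  define h where "h = (b - a) / 16"
  have h: "h > 0" using ab by (simp add: h_def)
  have b: "b = a + 16 * h" unfolding h_def by (simp add: field_simps)
  have h2: "2 * h > 0" using h by simp
  define \<alpha> where "\<alpha> = a + 4 * h"
  define \<beta> where "\<beta> = a + 12 * h"
  define s where "s = max 0 c + 1"
  define \<kappa> where "\<kappa> = max b (s + 5 + \<nu> * ln L)"
  let ?V = "\<lambda>x. grow x t"
  have up: "nearly (\<lambda>(C::real) x. \<forall>n. \<forall>z\<in>?V x. norm (iter n x z) \<le> exp (C + \<alpha> * real n) * norm z)"
  proof -
    have ae: "AE x in M. grow x (a + 2 * h) \<subseteq> grow x (a + h)"
      using gap by eventually_elim (use h in \<open>auto simp: b\<close>)
    have ae': "AE x in M. grow x (a + 2 * h) = ?V x"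
      using gap by eventually_elim (use h in \<open>auto simp: b\<close>)
    have "a + h < a + 2 * h" using h by simp
    from nearly_conj[OF nearly_upper[OF this ae h2] nearly_AE[OF ae']] show ?thesis
    proof (rule nearly_mono, intro exI allI impI ballI)
      fix p :: "real \<times> unit" and x n z
      assume "(case p of (C, D) \<Rightarrow> \<lambda>x. (\<forall>n. \<forall>j\<le>n. \<forall>z\<in>grow ((f ^^ j) x) (a + 2 * h).
          norm (iter (n - j) ((f ^^ j) x) z) \<le> exp (C + 2 * h * real n + (a + 2 * h) * real (n - j)) * norm z) \<and>
          grow x (a + 2 * h) = ?V x) x" and z: "z \<in> ?V x"
      then have "norm (iter (n - 0) ((f ^^ 0) x) z) \<le> exp (fst p + 2 * h * real n + (a + 2 * h) * real (n - 0)) * norm z"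
        unfolding case_prod_beta by (metis funpow_0 le0)
      then show "norm (iter n x z) \<le> exp (fst p + \<alpha> * real n) * norm z"
        by (simp add: \<alpha>_def algebra_simps)
    qed
  qed
  have low: "nearly (\<lambda>(C::real) x. \<forall>n v. exp (- C + \<beta> * real n) * infdist v (?V x) \<le> norm (iter n x v))"
  proof -
    have ae: "AE x in M. grow x (a + 15 * h) \<subseteq> grow x (a + 12 * h)"
      using gap by eventually_elim (use h in \<open>auto simp: b\<close>)
    have ae': "AE x in M. grow x (a + 14 * h) = ?V x"
      using gap by eventually_elim (use h in \<open>auto simp: b\<close>)
    have "a + 12 * h < a + 14 * h" "a + 14 * h < a + 15 * h" using h by simp_all
    from nearly_conj[OF nearly_lower[OF this ae h2] nearly_AE[OF ae']] show ?thesis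
    proof (rule nearly_mono, intro exI allI impI)
      fix p :: "real \<times> unit" and x n v
      assume "(case p of (C, D) \<Rightarrow> \<lambda>x. (\<forall>n v. exp (- C - 2 * h * real n + (a + 14 * h) * real n) * infdist v (grow x (a + 14 * h))
          \<le> infdist (iter n x v) (grow ((f ^^ n) x) (a + 14 * h))) \<and> grow x (a + 14 * h) = ?V x) x"
      then have "exp (- fst p - 2 * h * real n + (a + 14 * h) * real n) * infdist v (?V x)
          \<le> infdist (iter n x v) (grow ((f ^^ n) x) (a + 14 * h))"
        unfolding case_prod_beta by metis
      also have "\<dots> \<le> norm (iter n x v)" by (rule infdist_subspace_le_norm[OF subspace_grow])
      finally show "exp (- fst p + \<beta> * real n) * infdist v (?V x) \<le> norm (iter n x v)"
        by (simp add: \<beta>_def algebra_simps)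
    qed
  qed
  \<comment> \<open>Above the top rate \<open>c\<close> the growth space is everything, at all
    points of the orbit. A loss at rate 1 is acceptable because this estimate enters only through
    \<kappa>.\<close>
  have all: "nearly (\<lambda>(C::real) x. \<forall>n. \<forall>j\<le>n. \<forall>z.
      norm (iter (n - j) ((f ^^ j) x) z) \<le> exp (C + real n + s * real (n - j)) * norm z)"
  proof -
    have ae: "AE x in M. grow x s \<subseteq> grow x (s - 1 / 2)"
      using top by eventually_elim (auto simp: s_def)
    have ae': "AE x in M. \<forall>j. grow ((f ^^ j) x) s = UNIV"
      using AE_orbit[OF top] by eventually_elim (auto simp: s_def)
    have "s - 1 / 2 < s" by simp
    from nearly_conj[OF nearly_upper[OF this ae zero_less_one] nearly_AE[OF ae']] show ?thesis
    proof (rule nearly_mono, intro exI allI impI)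
      fix p :: "real \<times> unit" and x z and n j :: nat
      assume "(case p of (C, D) \<Rightarrow> \<lambda>x. (\<forall>n. \<forall>j\<le>n. \<forall>z\<in>grow ((f ^^ j) x) s.
          norm (iter (n - j) ((f ^^ j) x) z) \<le> exp (C + 1 * real n + s * real (n - j)) * norm z) \<and>
          (\<forall>j. grow ((f ^^ j) x) s = UNIV)) x" and "j \<le> n"
      then show "norm (iter (n - j) ((f ^^ j) x) z) \<le> exp (fst p + real n + s * real (n - j)) * norm z"
        unfolding case_prod_beta by simp
    qed
  qed
  have tempered: "nearly (\<lambda>(D::real) x. \<forall>n. g ((f ^^ n) x) \<le> D + real n)"
    using nearly_tempered[OF g_integrable zero_less_one] by simp
  have ineq: "infdist v (?V y) \<le> 2 * (exp C2 * (3 * exp C1 + H * exp (2 * C3 + 2 * D))) * exp (8 * h)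
      * dist x y powr (\<nu> * gap_exponent a b (max 0 c + 6 + \<nu> * ln L)) * norm v"
    if Ux: "\<forall>n. \<forall>z\<in>?V x. norm (iter n x z) \<le> exp (C1 + \<alpha> * real n) * norm z"
      and Uy: "\<forall>n. \<forall>z\<in>?V y. norm (iter n y z) \<le> exp (C1 + \<alpha> * real n) * norm z"
      and Ly: "\<forall>n v. exp (- C2 + \<beta> * real n) * infdist v (?V y) \<le> norm (iter n y v)"
      and Tx: "\<forall>n. \<forall>j\<le>n. \<forall>z. norm (iter (n - j) ((f ^^ j) x) z) \<le> exp (C3 + real n + s * real (n - j)) * norm z"
      and Ty: "\<forall>n. \<forall>j\<le>n. \<forall>z. norm (iter (n - j) ((f ^^ j) y) z) \<le> exp (C3 + real n + s * real (n - j)) * norm z"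
      and gx: "\<forall>n. g ((f ^^ n) x) \<le> D + real n" and gy: "\<forall>n. g ((f ^^ n) y) \<le> D + real n"
      and d: "dist x y < 1" and v: "v \<in> ?V x"
    for C1 C2 C3 D x y v
  proof (cases "x = y")
    case True
    then show ?thesis using v by simp
  next
    case False
    let ?\<delta> = "dist x y powr \<nu>" and ?H = "H * exp (2 * C3 + 2 * D)"
    let ?K = "exp C2 * (3 * exp C1 + ?H)"
    have H: "?H \<ge> 0" using H_nonneg by simp
    have \<delta>: "0 < ?\<delta>" "?\<delta> \<le> 1" using False d nu_pos powr_mono2[of \<nu> "dist x y" 1] by auto
    obtain u where u: "u \<in> ?V y" "norm (v - u) = infdist v (?V y)"
      by (rule infdist_subspace_attained[OF subspace_grow])
    have "norm u \<le> norm v + norm (v - u)" using norm_triangle_sub[of u v] by (simp add: norm_minus_commute)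
    also have "\<dots> \<le> 2 * norm v" using u(2) infdist_subspace_le_norm[OF subspace_grow[of y t], of v] by simp
    finally have norm_u: "norm u \<le> 2 * norm v" .
    have inf_eq: "infdist (v - u) (?V y) = infdist v (?V y)"
      using infdist_subspace_add[OF subspace_grow subspace_neg[OF subspace_grow u(1)], of v] by simp
    have "infdist v (?V y) \<le> (?K * norm v) * exp (- \<beta> * real n) * (exp (\<alpha> * real n) + exp (\<kappa> * real n) * ?\<delta>)" for n
    proof -
      have "norm (iter n x v - iter n y v) \<le> ?H * exp ((s + 5 + \<nu> * ln L) * real n) * ?\<delta> * norm v"
        by (rule iter_diff_bound[OF _ Tx Ty gx gy]) (simp add: s_def)
      also have "\<dots> \<le> ?H * exp (\<kappa> * real n) * ?\<delta> * norm v"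
      proof -
        have "(s + 5 + \<nu> * ln L) * real n \<le> \<kappa> * real n" unfolding \<kappa>_def by (rule mult_right_mono) auto
        then show ?thesis using H by (intro mult_right_mono mult_left_mono) auto
      qed
      finally have 1: "norm (iter n x v - iter n y v) \<le> ?H * exp (\<kappa> * real n) * ?\<delta> * norm v" .
      have 2: "norm (iter n x v) \<le> exp (C1 + \<alpha> * real n) * norm v" using Ux v by blast
      have "norm (iter n y u) \<le> exp (C1 + \<alpha> * real n) * norm u" using Uy u by blast
      also have "\<dots> \<le> exp (C1 + \<alpha> * real n) * (2 * norm v)" using norm_u by (intro mult_left_mono) auto
      finally have 3: "norm (iter n y u) \<le> exp (C1 + \<alpha> * real n) * (2 * norm v)" .
      have "iter n y (v - u) = (iter n x v - iter n y u) - (iter n x v - iter n y v)"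
        by (simp add: linear_diff[OF linear_iter])
      then have "norm (iter n y (v - u)) \<le> norm (iter n x v - iter n y u) + norm (iter n x v - iter n y v)"
        by (simp only: norm_triangle_ineq4)
      then have "norm (iter n y (v - u)) \<le> norm (iter n x v) + norm (iter n y u) + norm (iter n x v - iter n y v)"
        using norm_triangle_ineq4[of "iter n x v" "iter n y u"] by linarith
      then have "exp (- C2 + \<beta> * real n) * infdist v (?V y)
          \<le> 3 * exp (C1 + \<alpha> * real n) * norm v + ?H * exp (\<kappa> * real n) * ?\<delta> * norm v"
        using Ly[rule_format, of n "v - u"] 1 2 3 inf_eq by simp
      also have "\<dots> \<le> ((3 * exp C1 + ?H) * norm v) * (exp (\<alpha> * real n) + exp (\<kappa> * real n) * ?\<delta>)"
      proof -
        have "3 * (c * A) * N + k * X * e * N \<le> ((3 * c + k) * N) * (A + X * e)"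
          if "c \<ge> 0" "A \<ge> 0" "N \<ge> 0" "k \<ge> 0" "X \<ge> 0" "e \<ge> 0" for c A N k X e :: real
        proof -
          have "0 \<le> 3 * c * N * (X * e) + k * N * A" using that by simp
          then show ?thesis by (simp add: algebra_simps)
        qed
        from this[of "exp C1" "exp (\<alpha> * real n)" "norm v" ?H "exp (\<kappa> * real n)" ?\<delta>] H show ?thesis
          by (simp only: exp_add exp_ge_zero norm_ge_zero powr_ge_zero)
      qed
      finally have "exp (C2 - \<beta> * real n) * (exp (- C2 + \<beta> * real n) * infdist v (?V y))
        \<le> exp (C2 - \<beta> * real n) * (((3 * exp C1 + ?H) * norm v) * (exp (\<alpha> * real n) + exp (\<kappa> * real n) * ?\<delta>))"
        by (intro mult_left_mono) auto
      moreover have "exp (C2 - \<beta> * real n) * (exp (- C2 + \<beta> * real n) * infdist v (?V y)) = infdist v (?V y)"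
        by (simp add: mult.assoc[symmetric] flip: exp_add)
      moreover have "exp (C2 - \<beta> * real n) * (((3 * exp C1 + ?H) * norm v) * (exp (\<alpha> * real n) + exp (\<kappa> * real n) * ?\<delta>))
        = (?K * norm v) * exp (- \<beta> * real n) * (exp (\<alpha> * real n) + exp (\<kappa> * real n) * ?\<delta>)"
        by (simp add: exp_diff exp_minus divide_inverse mult_ac)
      ultimately show ?thesis by (simp only:)
    qed
    then have "infdist v (?V y) \<le> 2 * (?K * norm v) * exp (\<beta> - \<alpha>) * ?\<delta> powr ((\<beta> - \<alpha>) / (\<kappa> - \<alpha>))"
    proof (rule optimize_rate)
      show "0 \<le> ?K * norm v" using H by simp
      show "\<alpha> < \<beta>" "\<beta> \<le> \<kappa>" using h by (auto simp: \<alpha>_def \<beta>_def \<kappa>_def b)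
    qed (rule \<delta>)+
    moreover have "(\<beta> - \<alpha>) / (\<kappa> - \<alpha>) = gap_exponent a b (max 0 c + 6 + \<nu> * ln L)"
      by (simp add: gap_exponent_def \<alpha>_def \<beta>_def \<kappa>_def s_def b algebra_simps)
    moreover have "\<beta> - \<alpha> = 8 * h" by (simp add: \<alpha>_def \<beta>_def)
    ultimately have "infdist v (?V y) \<le> 2 * (?K * norm v) * exp (8 * h)
        * dist x y powr (\<nu> * gap_exponent a b (max 0 c + 6 + \<nu> * ln L))"
      by (simp only: powr_powr)
    then show ?thesis by (simp only: mult_ac)
  qed
  from nearly_conj[OF nearly_conj[OF up low] nearly_conj[OF all tempered]] show ?thesis
  proof (rule nearly_pairI, goal_cases)
    case (1 p)
    obtain C1 C2 C3 D where p: "p = ((C1, C2), (C3, D))" by (metis surj_pair)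
    define K where "K = 2 * (exp C2 * (3 * exp C1 + H * exp (2 * C3 + 2 * D))) * exp (8 * h)"
    have "K > 0" unfolding K_def using H_nonneg by (simp add: add_pos_nonneg)
    show ?case
      unfolding p prod.case
    proof (intro exI[of _ K] allI impI conjI ballI, goal_cases)
      case (2 x y v)
      note x = 2(1) and y = 2(2)
      show ?case
        unfolding K_def
        by (rule ineq[OF conjunct1[OF conjunct1[OF x]] conjunct1[OF conjunct1[OF y]]
              conjunct2[OF conjunct1[OF y]] conjunct1[OF conjunct2[OF x]] conjunct1[OF conjunct2[OF y]]
              conjunct2[OF conjunct2[OF x]] conjunct2[OF conjunct2[OF y]] 2(3,4)])
    qed (rule \<open>K > 0\<close>)
  qed
qed

end

section \<open>Regularity of measures and exponential rates\<close>

text \<open>The open neighbourhoods of radius \<open>1 / (n + 1)\<close> decrease to the closed set.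
  The empty set is treated apart, since \<open>infdist\<close> to it is 0 by convention.\<close>

lemma closed_outer_regular:
  fixes M :: "'a::metric_space measure"
  assumes M: "finite_measure M" "sets M = sets borel" and S: "closed S" and e: "e > 0"
  obtains U where "open U" "S \<subseteq> U" "measure M (U - S) < e"
proof (cases "S = {}")
  case True
  show thesis by (rule that[of "{}"]) (use True e in auto)
next
  case False
  interpret finite_measure M by fact
  define U where "U n = {x. infdist x S < inverse (real (Suc n))}" for n
  have U_open: "open (U n)" for n
    unfolding U_def by (intro open_Collect_less continuous_intros)
  have meas: "U n \<in> sets M" "S \<in> sets M" for n using U_open S M(2) by auto
  have SU: "S \<subseteq> U n" for n by (auto simp: U_def)
  have dec: "decseq (\<lambda>n. U n - S)"
  proof (intro decseq_SucI)
    fix n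
    have "inverse (real (Suc (Suc n))) \<le> inverse (real (Suc n))" by (intro le_imp_inverse_le) auto
    then have "U (Suc n) \<subseteq> U n" unfolding U_def by (meson Collect_mono less_le_trans)
    then show "U (Suc n) - S \<subseteq> U n - S" by blast
  qed
  have inter: "(\<Inter>n. U n - S) = {}"
  proof (rule ccontr)
    assume "(\<Inter>n. U n - S) \<noteq> {}"
    then obtain x where x: "\<And>n. x \<in> U n" "x \<notin> S" by blast
    have "infdist x S > 0" using infdist_pos_not_in_closed[OF S False x(2)] .
    then obtain n where "inverse (real (Suc n)) < infdist x S" using reals_Archimedean by blast
    then show False using x(1)[of n] by (simp add: U_def)
  qed
  have "(\<lambda>n. measure M (U n - S)) \<longlonglongrightarrow> measure M (\<Inter>n. U n - S)"
    using meas by (intro finite_Lim_measure_decseq dec) auto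
  then have "(\<lambda>n. measure M (U n - S)) \<longlonglongrightarrow> 0" by (simp only: inter measure_empty)
  then have "eventually (\<lambda>n. measure M (U n - S) < e) sequentially" using order_tendstoD(2) e by blast
  then obtain n where "measure M (U n - S) < e" by (auto simp: eventually_sequentially)
  then show thesis using that[of "U n"] U_open SU by blast
qed

text \<open>Induction over the sigma-algebra generated by the closed sets. Asking for closed and
  open approximations together makes the property stable under complements, which exchange the
  two.\<close>

lemma borel_regular:
  fixes M :: "'a::metric_space measure"
  assumes M: "finite_measure M" "sets M = sets borel" and S: "S \<in> sets M" and e: "e > 0"
  shows "\<exists>F U. closed F \<and> open U \<and> F \<subseteq> S \<and> S \<subseteq> U \<and> measure M (U - F) < e"
proof -
  interpret finite_measure M by fact
  have "S \<in> sigma_sets UNIV (Collect closed)" using S M(2) by (simp add: borel_eq_closed)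
  then show ?thesis using e
  proof (induction arbitrary: e)
    case (Basic S)
    then have S: "closed S" by simp
    obtain U where "open U" "S \<subseteq> U" "measure M (U - S) < e"
      by (rule closed_outer_regular[OF M S Basic(2)])
    then show ?case using S by (intro exI[of _ S] exI[of _ U] conjI order_refl)
  next
    case Empty
    then show ?case by (intro exI[of _ "{}"]) auto
  next
    case (Compl S)
    obtain F U where FU: "closed F" "open U" "F \<subseteq> S" "S \<subseteq> U" "measure M (U - F) < e"
      using Compl.IH[OF Compl.prems] by (elim exE conjE)
    have "- F - - U = U - F" by blast
    then have "measure M (- F - - U) < e" using FU(5) by (simp only:)
    moreover have "- U \<subseteq> UNIV - S" "UNIV - S \<subseteq> - F" using FU by blast+
    ultimately show ?case
      using closed_Compl[OF FU(2)] open_Compl[OF FU(1)] by (intro exI[of _ "- U"] exI[of _ "- F"] conjI)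
  next
    case (Union S)
    have "\<exists>F U. closed F \<and> open U \<and> F \<subseteq> S n \<and> S n \<subseteq> U \<and> measure M (U - F) < e / 2 * (1 / 2) ^ Suc n" for n
    proof (rule Union.IH)
      show "0 < e / 2 * (1 / 2) ^ Suc n" using Union.prems by (intro mult_pos_pos) auto
    qed
    then obtain F U where FU: "\<And>n. closed (F n)" "\<And>n. open (U n)" "\<And>n. F n \<subseteq> S n" "\<And>n. S n \<subseteq> U n"
      "\<And>n. measure M (U n - F n) < e / 2 * (1 / 2) ^ Suc n" by metis
    have meas [simp]: "F n \<in> sets M" "U n \<in> sets M" for n using FU M(2) by auto
    have Un_meas [simp]: "(\<Union>n\<in>I. F n) \<in> sets M" "(\<Union>n\<in>I. U n) \<in> sets M" for I :: "nat set"
      using sets.countable_UN''[of I F] sets.countable_UN''[of I U] by auto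
    \<comment> \<open>An infinite union of closed sets may fail to be closed, so the inner set is a
      finite union \<open>?G N\<close>. The truncation costs one half of \<open>e\<close>; the other
      half is spread over the sets as a geometric series.\<close>
    let ?U = "\<Union>n. U n" and ?F = "\<Union>n. F n" and ?G = "\<lambda>N. \<Union>n\<le>N. F n"
    have sums: "(\<lambda>n. e / 2 * (1 / 2) ^ Suc n) sums (e / 2)"
      using sums_mult[OF power_half_series, of "e / 2"] by simp
    have summ: "summable (\<lambda>n. measure M (U n - F n))"
      using FU(5) sums by (intro summable_comparison_test[OF _ sums_summable[OF sums]])
        (auto intro!: exI[of _ 0] less_imp_le)
    have "measure M (?U - ?F) \<le> measure M (\<Union>n. U n - F n)"
      by (intro finite_measure_mono sets.countable_UN) auto
    also have "\<dots> \<le> (\<Sum>n. measure M (U n - F n))"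
      using summ by (intro finite_measure_subadditive_countably) auto
    also have "\<dots> \<le> e / 2"
      using FU(5) suminf_le[OF _ summ sums_summable[OF sums]] sums_unique[OF sums] by (simp add: less_imp_le)
    finally have 1: "measure M (?U - ?F) \<le> e / 2" .
    have "(\<lambda>N. measure M (?F - ?G N)) \<longlonglongrightarrow> measure M (\<Inter>N. ?F - ?G N)"
    proof (intro finite_Lim_measure_decseq decseq_SucI)
      show "?F - ?G (Suc n) \<subseteq> ?F - ?G n" for n by (auto simp: atMost_Suc)
    qed auto
    moreover have "(\<Inter>N. ?F - ?G N) = {}" by auto
    ultimately have "(\<lambda>N. measure M (?F - ?G N)) \<longlonglongrightarrow> 0" by (simp only: measure_empty)
    moreover have "e / 2 > 0" using Union.prems by simp
    ultimately have "eventually (\<lambda>N. measure M (?F - ?G N) < e / 2) sequentially"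
      using order_tendstoD(2) by blast
    then obtain N where N: "measure M (?F - ?G N) < e / 2" by (auto simp: eventually_sequentially)
    have "measure M (?U - ?G N) \<le> measure M ((?U - ?F) \<union> (?F - ?G N))"
    proof (rule finite_measure_mono)
      show "?U - ?G N \<subseteq> (?U - ?F) \<union> (?F - ?G N)" by blast
    qed (rule sets.Un sets.Diff Un_meas)+
    also have "\<dots> \<le> measure M (?U - ?F) + measure M (?F - ?G N)"
      by (intro measure_Un_le sets.Diff Un_meas)
    finally have "measure M (?U - ?G N) < e" using 1 N by simp
    moreover have "closed (?G N)" using FU by (intro closed_UN) auto
    moreover have "open ?U" using FU by (intro open_UN) auto
    moreover have "?G N \<subseteq> (\<Union>n. S n)" using FU(3) by fast
    moreover have "(\<Union>n. S n) \<subseteq> ?U" using FU(4) by fast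
    ultimately show ?case by (intro exI[of _ "?G N"] exI[of _ ?U] conjI)
  qed
qed

text \<open>A closed inner approximation is intersected with a large compact set provided by
  tightness, each costing half of \<open>e\<close>.\<close>

lemma compact_inner_approx:
  fixes M :: "'a::metric_space measure"
  assumes M: "prob_space M" "sets M = sets borel" and tight: "tight_measure M"
    and S: "S \<in> sets M" and e: "e > 0"
  obtains K where "compact K" "K \<subseteq> S" "measure M K \<ge> measure M S - e"
proof -
  interpret prob_space M by fact
  have e2: "e / 2 > 0" using e by simp
  obtain K where K: "compact K" "measure M K \<ge> 1 - e / 2"
    using tight e2 unfolding tight_measure_def by blast
  obtain F U where F: "closed F" "open U" "F \<subseteq> S" "S \<subseteq> U" "measure M (U - F) < e / 2"
    using borel_regular[OF finite_measure_axioms M(2) S e2] by blast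
  have meas: "K \<in> events" "F \<in> events" "U \<in> events"
    using borel_closed[OF compact_imp_closed[OF K(1)]] F M(2) by auto
  have "measure M S \<le> measure M (F \<union> (U - F))"
    using F meas by (intro finite_measure_mono) auto
  also have "\<dots> \<le> measure M F + measure M (U - F)"
    using meas by (intro measure_Un_le) auto
  finally have "measure M F \<ge> 1 - (1 - measure M S + e / 2)" using F(5) by simp
  then have "measure M (F \<inter> K) \<ge> 1 - ((1 - measure M S + e / 2) + e / 2)"
    using meas K(2) by (intro prob_Int_ge) auto
  then have "measure M (F \<inter> K) \<ge> measure M S - e" by simp
  moreover have "compact (F \<inter> K)" using F(1) K(1) by (rule closed_Int_compact)
  ultimately show thesis using that F(3) by blast
qed

section \<open>Exponential rates and membership in growth spaces\<close>

lemma exp_bound_of_rate: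
  fixes a :: "nat \<Rightarrow> real"
  assumes lim: "(\<lambda>n. ln (a n) / real n) \<longlonglongrightarrow> \<rho>" and "\<rho> < s" and pos: "\<And>n. a n \<ge> 0"
  shows "\<exists>R. \<forall>n. a n \<le> R * exp (s * real n)"
proof -
  obtain N where N: "\<And>n. n \<ge> N \<Longrightarrow> ln (a n) / real n < s"
    using order_tendstoD(2)[OF lim \<open>\<rho> < s\<close>] by (auto simp: eventually_sequentially)
  \<comment> \<open>The sum dominates the terms up to and including \<open>N\<close>; the remaining
    indices are positive, so the quotient by \<open>real n\<close> can be cleared.\<close>
  define R where "R = 1 + (\<Sum>n<Suc N. a n / exp (s * real n))"
  have sum_nonneg: "(\<Sum>n<Suc N. a n / exp (s * real n)) \<ge> 0" using pos by (intro sum_nonneg) auto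
  have "a n \<le> R * exp (s * real n)" for n
  proof (cases "n < Suc N")
    case True
    have "a n / exp (s * real n) \<le> (\<Sum>n<Suc N. a n / exp (s * real n))"
      using True pos by (intro member_le_sum) auto
    then have "a n / exp (s * real n) \<le> R" by (simp add: R_def)
    then show ?thesis by (simp add: field_simps)
  next
    case False
    have R: "R \<ge> 1" using sum_nonneg by (simp add: R_def)
    have "a n \<le> 1 * exp (s * real n)"
    proof (cases "a n = 0")
      case False
      have "ln (a n) \<le> s * real n" using N[of n] \<open>\<not> n < Suc N\<close> by (simp add: field_simps)
      then show ?thesis using False pos[of n] by (metis exp_le_cancel_iff exp_ln le_less mult_1)
    qed simp
    also have "\<dots> \<le> R * exp (s * real n)" using R by (intro mult_right_mono) auto
    finally show ?thesis .
  qed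
  then show ?thesis by blast
qed

lemma not_exp_bound_of_rate:
  fixes a :: "nat \<Rightarrow> real"
  assumes lim: "(\<lambda>n. ln (a n) / real n) \<longlonglongrightarrow> \<rho>" and "s < \<rho>" and pos: "\<And>n. a n > 0"
  shows "\<not> (\<exists>R. \<forall>n. a n \<le> R * exp (s * real n))"
proof
  assume "\<exists>R. \<forall>n. a n \<le> R * exp (s * real n)"
  then obtain R where R: "\<And>n. a n \<le> R * exp (s * real n)" by blast
  have R_pos: "R > 0" using R[of 0] pos[of 0] by simp
  have "(\<lambda>n. ln R / real n + s) \<longlonglongrightarrow> 0 + s"
    by (intro tendsto_add tendsto_const lim_const_over_n)
  moreover have "\<exists>N. \<forall>n\<ge>N. ln (a n) / real n \<le> ln R / real n + s"
  proof (intro exI[of _ 1] allI impI)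
    fix n :: nat assume n: "n \<ge> 1"
    have "ln (a n) \<le> ln (R * exp (s * real n))" using R[of n] pos[of n] by (metis ln_mono)
    also have "\<dots> = ln R + s * real n" using R_pos by (simp add: ln_mult)
    finally show "ln (a n) / real n \<le> ln R / real n + s" using n by (simp add: field_simps)
  qed
  ultimately have "\<rho> \<le> 0 + s" using lim by (rule LIMSEQ_le[rotated])
  then show False using \<open>s < \<rho>\<close> by simp
qed

lemma growth_space_of_rate:
  fixes B :: "'a \<Rightarrow> 'v::real_normed_vector \<Rightarrow> 'v"
  assumes lim: "(\<lambda>n. ln (norm (cocycle_iter f B n x v)) / real n) \<longlonglongrightarrow> \<rho>"
    and inj: "\<And>n. cocycle_iter f B n x v \<noteq> 0"
  shows "\<rho> < s \<Longrightarrow> v \<in> growth_space f B x s" "s < \<rho> \<Longrightarrow> v \<notin> growth_space f B x s"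
  using exp_bound_of_rate[OF lim] not_exp_bound_of_rate[OF lim] inj
  unfolding growth_space_def by auto

text \<open>Among the nonzero components with rate above \<open>s\<close>, take the one with the
  largest rate and a level \<open>t\<close> just below that rate, above \<open>s\<close> and the
  rates of the other such components. All other components and the total lie in \<open>G t\<close>,
  hence so does the chosen one, which is absurd. The family \<open>G\<close> is abstract in order to
  cover both time directions.\<close>

lemma growth_space_direct_sum:
  fixes G :: "real \<Rightarrow> 'v::real_vector set" and E :: "'i \<Rightarrow> 'v set"
  assumes G: "\<And>s. subspace (G s)" and mono: "\<And>s t. s \<le> t \<Longrightarrow> G s \<subseteq> G t"
    and rate: "\<And>i v s. i \<in> I \<Longrightarrow> v \<in> E i \<Longrightarrow> v \<noteq> 0 \<Longrightarrow>
      (\<rho> i < s \<longrightarrow> v \<in> G s) \<and> (s < \<rho> i \<longrightarrow> v \<notin> G s)"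
    and inj: "inj_on \<rho> I" and I: "finite I" and u: "\<And>i. i \<in> I \<Longrightarrow> u i \<in> E i"
    and s: "\<And>i. i \<in> I \<Longrightarrow> \<rho> i \<noteq> s"
  shows "(\<Sum>i\<in>I. u i) \<in> G s \<longleftrightarrow> (\<forall>i\<in>I. s < \<rho> i \<longrightarrow> u i = 0)"
proof
  assume "\<forall>i\<in>I. s < \<rho> i \<longrightarrow> u i = 0"
  then have "u i \<in> G s" if "i \<in> I" for i
    using that s[OF that] rate[OF that u[OF that], of s] subspace_0[OF G, of s]
    by (cases "u i = 0") auto
  then show "(\<Sum>i\<in>I. u i) \<in> G s" by (intro subspace_sum G)
next
  assume sum: "(\<Sum>i\<in>I. u i) \<in> G s"
  show "\<forall>i\<in>I. s < \<rho> i \<longrightarrow> u i = 0"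
  proof (rule ccontr)
    define J where "J = {i \<in> I. s < \<rho> i \<and> u i \<noteq> 0}"
    assume "\<not> ?thesis"
    then have J: "finite J" "J \<noteq> {}" using I by (auto simp: J_def)
    obtain m where m: "m \<in> J" "\<And>i. i \<in> J \<Longrightarrow> \<rho> i \<le> \<rho> m"
    proof -
      have "Max (\<rho> ` J) \<in> \<rho> ` J" using J by simp
      then obtain m where "m \<in> J" "\<rho> m = Max (\<rho> ` J)" by auto
      then show thesis using that[of m] J by simp
    qed
    have mI: "m \<in> I" "s < \<rho> m" "u m \<noteq> 0" using m by (auto simp: J_def)
    define T where "T = insert s (\<rho> ` (J - {m}))"
    have T: "finite T" "T \<noteq> {}" using J by (auto simp: T_def)
    have "t < \<rho> m" if "t \<in> T" for t
      using that mI m inj unfolding T_def inj_on_def J_def by fastforce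
    then have "Max T < \<rho> m" using T by simp
    then obtain t where t: "Max T < t" "t < \<rho> m" using dense by blast
    have tT: "r < t" if "r \<in> T" for r using that T t(1) Max_ge[of T r] by simp
    have "u i \<in> G t" if i: "i \<in> I - {m}" for i
    proof (cases "u i = 0 \<or> \<rho> i < s")
      case True
      moreover have "s < t" using tT[of s] by (simp add: T_def)
      ultimately have "u i = 0 \<or> \<rho> i < t" by auto
      then show ?thesis
        using rate[of i "u i" t] u i subspace_0[OF G, of t] by (cases "u i = 0") auto
    next
      case False
      then have "\<rho> i \<in> T" using s[of i] i unfolding T_def J_def by auto
      then show ?thesis using False rate[of i "u i" t] u i tT by auto
    qed
    then have "(\<Sum>i\<in>I - {m}. u i) \<in> G t" by (intro subspace_sum G)
    moreover have "(\<Sum>i\<in>I. u i) \<in> G t" using sum mono[of s t] tT[of s] by (auto simp: T_def)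
    ultimately have "(\<Sum>i\<in>I. u i) - (\<Sum>i\<in>I - {m}. u i) \<in> G t" by (intro subspace_diff G)
    then have "u m \<in> G t" using mI I by (simp add: sum_diff1)
    then show False using rate[OF mI(1) u[OF mI(1)] mI(3), of t] t by simp
  qed
qed

text \<open>In the application, \<open>F\<close> and \<open>F0\<close> are the forward filtration
  spaces of index i and i - 1, \<open>G\<close> is the backward space complementary to
  \<open>F0\<close>, and \<open>E\<close> is the intersection of \<open>F\<close> and
  \<open>G\<close>. The projection \<open>p\<close> of \<open>v\<close> to \<open>F\<close> is moved
  to a point \<open>e\<close> of \<open>E\<close> by an element of \<open>F0\<close>; then
  \<open>p - q\<close> splits into \<open>p - e\<close> in \<open>F0\<close> and
  \<open>e - q\<close> in \<open>G\<close>, so transversality bounds \<open>p - e\<close>.\<close>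

lemma infdist_intersection_bound:
  fixes v :: "'v::euclidean_space"
  assumes F: "subspace F" and G: "subspace G"
    and split: "\<And>u. u \<in> F \<Longrightarrow> \<exists>e\<in>E. u - e \<in> F0" and EG: "E \<subseteq> G"
    and trans: "\<And>a b. a \<in> F0 \<Longrightarrow> b \<in> G \<Longrightarrow> norm a \<le> C * norm (a + b)" and C: "C \<ge> 0"
  shows "infdist v E \<le> (C + 1) * infdist v F + C * infdist v G"
proof -
  obtain p where p: "p \<in> F" "norm (v - p) = infdist v F" by (rule infdist_subspace_attained[OF F])
  obtain q where q: "q \<in> G" "norm (v - q) = infdist v G" by (rule infdist_subspace_attained[OF G])
  obtain e where e: "e \<in> E" "p - e \<in> F0" using split[OF p(1)] by blast
  have "e - q \<in> G" using e EG q G by (blast intro: subspace_diff)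
  from trans[OF e(2) this] have "norm (p - e) \<le> C * norm (p - q)" by simp
  also have "norm (p - q) \<le> infdist v G + infdist v F"
    using norm_triangle_ineq4[of "v - q" "v - p"] p q by simp
  then have "C * norm (p - q) \<le> C * (infdist v G + infdist v F)" using C by (rule mult_left_mono)
  finally have 1: "norm (p - e) \<le> C * (infdist v G + infdist v F)" .
  have "infdist v E \<le> dist v e" using e(1) by (rule infdist_le)
  also have "\<dots> \<le> norm (v - p) + norm (p - e)"
    using norm_triangle_ineq[of "v - p" "p - e"] by (simp add: dist_norm)
  finally show ?thesis using 1 p(2) by (simp add: algebra_simps)
qed

lemma subspace_dist_le:
  fixes V W :: "(real^'d) set"
  assumes V: "subspace V" "V \<noteq> {0}" and W: "subspace W" "W \<noteq> {0}"
    and VW: "\<And>v. v \<in> V \<Longrightarrow> infdist v W \<le> c * norm v"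
    and WV: "\<And>v. v \<in> W \<Longrightarrow> infdist v V \<le> c * norm v"
  shows "subspace_dist V W \<le> c"
proof -
  have ne: "{v \<in> V. norm v = 1} \<noteq> {}" if nz: "subspace V" "V \<noteq> {0}" for V :: "(real^'d) set"
  proof -
    have "0 \<in> V" using nz(1) by (rule subspace_0)
    then obtain v where v: "v \<in> V" "v \<noteq> 0" using nz(2) by blast
    then have "inverse (norm v) *\<^sub>R v \<in> V" "norm (inverse (norm v) *\<^sub>R v) = 1"
      using subspace_scale[OF nz(1)] by auto
    then show ?thesis by blast
  qed
  show ?thesis
    unfolding subspace_dist_def
    using VW WV by (intro max.boundedI cSUP_least ne V W) fastforce+
qed

section \<open>The matrix cocycle and its inverse\<close>

lemma matrix_inv_vector:
  fixes A :: "real^'n^'n"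
  assumes "invertible A"
  shows "matrix_inv A *v (A *v v) = v" "A *v (matrix_inv A *v v) = v"
proof -
  have "A ** matrix_inv A = mat 1 \<and> matrix_inv A ** A = mat 1"
    unfolding matrix_inv_def by (rule someI_ex) (use assms in \<open>simp add: invertible_def\<close>)
  then show "matrix_inv A *v (A *v v) = v" "A *v (matrix_inv A *v v) = v"
    by (simp_all add: matrix_vector_mul_assoc)
qed

lemma opnorm_bound: "norm (A *v v) \<le> opnorm A * norm v"
  unfolding opnorm_def by (rule onorm) (rule matrix_vector_mul_bounded_linear)

lemma norm_le_exp_ln_opnorm:
  assumes "A *v u \<noteq> 0"
  shows "norm (A *v v) \<le> exp \<bar>ln (opnorm A)\<bar> * norm v"
proof -
  have "opnorm A > 0"
  proof (rule ccontr)
    assume "\<not> opnorm A > 0"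
    then have "opnorm A * norm u \<le> 0" by (simp add: mult_nonpos_nonneg)
    moreover have "norm (A *v u) > 0" using assms by simp
    ultimately show False using opnorm_bound[of A u] by linarith
  qed
  then have "opnorm A \<le> exp \<bar>ln (opnorm A)\<bar>" by (metis abs_ge_self exp_le_cancel_iff exp_ln)
  then have "opnorm A * norm v \<le> exp \<bar>ln (opnorm A)\<bar> * norm v" by (rule mult_right_mono) simp
  then show ?thesis using opnorm_bound order_trans by blast
qed

text \<open>The integrable function \<open>g\<close> of the locale. It treats a matrix and its
  inverse alike, so it serves the forward and the inverse cocycle.\<close>

definition log_size :: "real^'n^'n \<Rightarrow> real" where
  "log_size A = \<bar>ln (opnorm A)\<bar> + \<bar>ln (opnorm (matrix_inv A))\<bar>"

lemma log_size_nonneg: "log_size A \<ge> 0"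
  by (simp add: log_size_def)

lemma log_size_bounds:
  fixes A :: "real^'n^'n"
  assumes A: "invertible A"
  shows "norm (A *v v) \<le> exp (log_size A) * norm v"
    and "norm (matrix_inv A *v v) \<le> exp (log_size A) * norm v"
    and "exp (- log_size A) * norm v \<le> norm (A *v v)"
    and "exp (- log_size A) * norm v \<le> norm (matrix_inv A *v v)"
proof -
  let ?u = "axis undefined 1 :: real^'n"
  have u: "?u \<noteq> 0" by (simp add: axis_eq_0_iff)
  have "A *v (matrix_inv A *v ?u) \<noteq> 0" "matrix_inv A *v (A *v ?u) \<noteq> 0"
    using u by (simp_all only: matrix_inv_vector[OF A] not_False_eq_True)
  note n = norm_le_exp_ln_opnorm[OF this(1)] norm_le_exp_ln_opnorm[OF this(2)]
  have le: "exp \<bar>ln (opnorm A)\<bar> * norm v \<le> exp (log_size A) * norm v"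
    "exp \<bar>ln (opnorm (matrix_inv A))\<bar> * norm v \<le> exp (log_size A) * norm v" for v :: "real^'n"
    by (auto simp: log_size_def intro!: mult_right_mono)
  show 1: "norm (A *v v) \<le> exp (log_size A) * norm v" for v
    by (rule order_trans[OF n(1) le(1)])
  show 2: "norm (matrix_inv A *v v) \<le> exp (log_size A) * norm v" for v
    by (rule order_trans[OF n(2) le(2)])
  show "exp (- log_size A) * norm v \<le> norm (A *v v)"
    using 2[of "A *v v"] by (simp add: matrix_inv_vector[OF A] exp_minus field_simps)
  show "exp (- log_size A) * norm v \<le> norm (matrix_inv A *v v)"
    using 1[of "matrix_inv A *v v"] by (simp add: matrix_inv_vector[OF A] exp_minus field_simps)
qed

lemma cocycle_iter_matrix: "cocycle_iter f (\<lambda>x. (*v) (A x)) n x v = cocycle_fwd f A n x *v v"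
  by (induction n) (simp_all add: matrix_vector_mul_assoc)

lemma cocycle_iter_inverse:
  "cocycle_iter (inv f) (\<lambda>x. (*v) (matrix_inv (A (inv f x)))) n x v = cocycle_bwd f A n x *v v"
  by (induction n) (simp_all add: matrix_vector_mul_assoc)

text \<open>Continuity is the route to measurability of the cocycles. The constant and the radius
  may depend on \<open>x\<close>, as they do for inverse matrices.\<close>

lemma continuous_on_of_powr_bound:
  fixes h :: "'a::metric_space \<Rightarrow> 'w::real_normed_vector"
  assumes nu: "\<nu> > 0"
    and bd: "\<And>x. \<exists>C. \<exists>e>0. \<forall>y. dist x y < e \<longrightarrow> norm (h y - h x) \<le> C * dist x y powr \<nu>"
  shows "continuous_on UNIV h"
  unfolding continuous_on_def
proof
  fix x
  obtain C e where e: "e > 0" and C: "\<And>y. dist x y < e \<Longrightarrow> norm (h y - h x) \<le> C * dist x y powr \<nu>"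
    using bd[of x] by blast
  have "((\<lambda>y. dist x y) \<longlongrightarrow> dist x x) (at x)" by (intro tendsto_intros)
  then have d: "((\<lambda>y. dist x y) \<longlongrightarrow> 0) (at x)" by simp
  have "((\<lambda>y. C * dist x y powr \<nu>) \<longlongrightarrow> C * 0) (at x)"
    by (intro tendsto_mult tendsto_const tendsto_zero_powrI[OF d tendsto_const _ nu]) simp
  then have lim: "((\<lambda>y. C * dist x y powr \<nu>) \<longlongrightarrow> 0) (at x)" by simp
  have "eventually (\<lambda>y. dist x y < e) (at x)" using order_tendstoD(2)[OF d e] .
  then have "eventually (\<lambda>y. norm (h y - h x) \<le> C * dist x y powr \<nu>) (at x)"
    by (rule eventually_mono) (rule C)
  then have "((\<lambda>y. h y - h x) \<longlongrightarrow> 0) (at x)" by (rule Lim_null_comparison[OF _ lim])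
  then show "(h \<longlongrightarrow> h x) (at x within UNIV)" by (simp add: LIM_zero_iff)
qed

text \<open>The identity behind it is that the difference of the inverses of A and B is the inverse
  of A times B - A times the inverse of B.\<close>

lemma matrix_inv_diff_bound:
  fixes A B :: "real^'n^'n"
  assumes A: "invertible A" and B: "invertible B" and d: "opnorm (B - A) \<le> d"
  shows "norm (matrix_inv A *v v - matrix_inv B *v v) \<le> exp (log_size A) * (d * norm (matrix_inv B *v v))"
proof -
  have "matrix_inv A *v v - matrix_inv B *v v = matrix_inv A *v ((B - A) *v (matrix_inv B *v v))"
    by (simp add: matrix_vector_mult_diff_rdistrib matrix_vector_mult_diff_distrib matrix_inv_vector[OF A] matrix_inv_vector[OF B])
  then have "norm (matrix_inv A *v v - matrix_inv B *v v)
      \<le> exp (log_size A) * norm ((B - A) *v (matrix_inv B *v v))"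
    by (simp only: log_size_bounds[OF A])
  also have "\<dots> \<le> exp (log_size A) * (d * norm (matrix_inv B *v v))"
    by (intro mult_left_mono order_trans[OF opnorm_bound] mult_right_mono d) auto
  finally show ?thesis .
qed

section \<open>The forward and the inverse matrix cocycle as instances of the abstract one\<close>

context
  fixes f :: "'m::metric_space \<Rightarrow> 'm" and \<mu> :: "'m measure" and A :: "'m \<Rightarrow> real^'d^'d" and \<nu> :: real
  assumes erg: "ergodic_borel_prob f \<mu>" and nu: "\<nu> > 0" and hoelder: "hoelder_cocycle \<nu> A"
    and int: "integrable \<mu> (\<lambda>x. ln (opnorm (A x)))" "integrable \<mu> (\<lambda>x. ln (opnorm (matrix_inv (A x))))"
begin

lemma A_invertible: "invertible (A x)"
  using hoelder by (simp add: hoelder_cocycle_def)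

lemma obtain_hoelder_constant:
  obtains H where "H > 0" "\<And>x y. opnorm (A x - A y) \<le> H * dist x y powr \<nu>"
  using hoelder unfolding hoelder_cocycle_def by blast

lemma sets_borel: "sets \<mu> = sets borel"
  using erg by (simp add: ergodic_borel_prob_def)

lemma borel_measurable_of_continuous:
  "continuous_on UNIV h \<Longrightarrow> h \<in> borel_measurable \<mu>"
  using borel_measurable_continuous_onI measurable_cong_sets[OF sets_borel refl] by blast

lemma ergodic_system_forward: "ergodic_system \<mu> f"
proof -
  interpret prob_space \<mu> using erg by (simp add: ergodic_borel_prob_def)
  show ?thesis
  proof
    show "space \<mu> = UNIV" using sets_eq_imp_space_eq[OF sets_borel] by simp
  qed (use erg in \<open>auto simp: ergodic_borel_prob_def\<close>)
qed

lemma log_size_integrable: "integrable \<mu> (\<lambda>x. log_size (A x))"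
  unfolding log_size_def using int by (intro Bochner_Integration.integrable_add integrable_abs)

lemma A_diff_bound:
  assumes "\<And>x y. opnorm (A x - A y) \<le> H * dist x y powr \<nu>"
  shows "norm (A x *v v - A y *v v) \<le> H * dist x y powr \<nu> * norm v"
proof -
  have "norm (A x *v v - A y *v v) \<le> opnorm (A x - A y) * norm v"
    using opnorm_bound[of "A x - A y" v] by (simp add: matrix_vector_mult_diff_rdistrib)
  also have "\<dots> \<le> H * dist x y powr \<nu> * norm v" by (intro mult_right_mono assms) simp
  finally show ?thesis .
qed

lemma hoelder_linear_cocycle_forward:
  assumes L: "L \<ge> 1" "\<And>x y. dist (f x) (f y) \<le> L * dist x y"
  obtains H where "hoelder_linear_cocycle \<mu> f (\<lambda>x. (*v) (A x)) (\<lambda>x. log_size (A x)) H L \<nu>"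
proof -
  interpret ergodic_system \<mu> f by (rule ergodic_system_forward)
  obtain H where H: "H > 0" "\<And>x y. opnorm (A x - A y) \<le> H * dist x y powr \<nu>"
    by (rule obtain_hoelder_constant) blast
  have cont: "continuous_on UNIV (\<lambda>x. A x *v v)" for v
  proof (rule continuous_on_of_powr_bound[OF nu])
    fix x
    have "norm (A y *v v - A x *v v) \<le> (H * norm v) * dist x y powr \<nu>" for y
      using A_diff_bound[OF H(2), of y v x] by (simp add: dist_commute mult_ac)
    then show "\<exists>C. \<exists>e>0. \<forall>y. dist x y < e \<longrightarrow> norm (A y *v v - A x *v v) \<le> C * dist x y powr \<nu>"
      using zero_less_one by blast
  qed
  have "hoelder_linear_cocycle \<mu> f (\<lambda>x. (*v) (A x)) (\<lambda>x. log_size (A x)) H L \<nu>"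
  proof
    fix x y v
    show "(\<lambda>x. A x *v v) \<in> borel_measurable \<mu>" by (rule borel_measurable_of_continuous[OF cont])
    show "norm (A x *v v - A y *v v) \<le> H * exp (log_size (A x) + log_size (A y)) * dist x y powr \<nu> * norm v"
    proof (rule order_trans[OF A_diff_bound[OF H(2)]], intro mult_right_mono)
      show "H \<le> H * exp (log_size (A x) + log_size (A y))"
        using H(1) log_size_nonneg[of "A x"] log_size_nonneg[of "A y"] by simp
    qed auto
  qed (use H L nu log_size_bounds[OF A_invertible] log_size_integrable
      matrix_vector_mul_linear in \<open>auto simp: linear_add linear_scale\<close>)
  then show thesis by (rule that)
qed

text \<open>A set invariant under \<open>inv f\<close> is invariant under \<open>f\<close>, and the
  measure is preserved by both, so \<open>inv f\<close> is again an ergodic system. The generator at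
  \<open>x\<close> is the inverse of the matrix at the preimage of \<open>x\<close>.\<close>

lemma hoelder_linear_cocycle_backward:
  assumes bij: "bij f" and L: "L \<ge> 1" "\<And>x y. dist (inv f x) (inv f y) \<le> L * dist x y"
  obtains H where "hoelder_linear_cocycle \<mu> (inv f) (\<lambda>x. (*v) (matrix_inv (A (inv f x))))
    (\<lambda>x. log_size (A (inv f x))) H L \<nu>"
proof -
  interpret F: ergodic_system \<mu> f by (rule ergodic_system_forward)
  obtain H where H: "H > 0" "\<And>x y. opnorm (A x - A y) \<le> H * dist x y powr \<nu>"
    by (rule obtain_hoelder_constant) blast
  have "L-lipschitz_on UNIV (inv f)" using L by (intro lipschitz_onI) auto
  then have inv_cont: "continuous_on UNIV (inv f)" by (rule lipschitz_on_continuous_on)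
  have inv_meas: "inv f \<in> \<mu> \<rightarrow>\<^sub>M \<mu>"
    using borel_measurable_of_continuous[OF inv_cont] measurable_cong_sets[OF refl sets_borel] by blast
  have distr_inv: "distr \<mu> \<mu> (inv f) = \<mu>"
  proof -
    have "distr \<mu> \<mu> (inv f) = distr (distr \<mu> \<mu> f) \<mu> (inv f)" by (simp only: F.f_invariant)
    also have "\<dots> = distr \<mu> \<mu> (inv f \<circ> f)" by (rule distr_distr[OF inv_meas F.f_measurable])
    also have "inv f \<circ> f = (\<lambda>x. x)" using bij by (simp add: bij_is_inj o_def)
    finally show ?thesis by (simp add: distr_id)
  qed
  interpret B: ergodic_system \<mu> "inv f"
  proof
    fix S assume S: "S \<in> sets \<mu>" "inv f -` S = S"
    have "f -` S = f -` (inv f -` S)" by (simp only: S(2))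
    also have "\<dots> = S" using bij by (auto simp: bij_is_inj)
    finally show "F.prob S = 0 \<or> F.prob S = 1" by (rule F.ergodic[OF S(1)])
  qed (use F.space_UNIV inv_meas distr_inv in auto)
  have cont_inv: "continuous_on UNIV (\<lambda>x. matrix_inv (A x) *v v)" for v
  proof (rule continuous_on_of_powr_bound[OF nu])
    fix x
    let ?K = "exp (log_size (A x))"
    \<comment> \<open>Within this radius \<open>?K * H * dist x y powr \<nu>\<close> is at most 1/2,
      so the term with the inverse at \<open>y\<close> can be absorbed, leaving twice the norm at
      \<open>x\<close>.\<close>
    define e where "e = inverse (2 * H * ?K) powr (1 / \<nu>)"
    have e: "e > 0" using H(1) by (simp add: e_def)
    have "norm (matrix_inv (A y) *v v - matrix_inv (A x) *v v) \<le> (?K * (H * (2 * norm (matrix_inv (A x) *v v)))) * dist x y powr \<nu>"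
      if y: "dist x y < e" for y
    proof -
      let ?d = "H * dist x y powr \<nu>" and ?w = "norm (matrix_inv (A y) *v v)"
      have "dist x y powr \<nu> \<le> e powr \<nu>" using y nu by (intro powr_mono2) auto
      also have "e powr \<nu> = inverse (2 * H * ?K)" using nu H(1) by (simp add: e_def powr_powr)
      finally have "?K * ?d \<le> 1 / 2" using H(1) by (simp add: field_simps)
      then have half: "?K * (?d * ?w) \<le> ?w / 2"
        using mult_right_mono[of "?K * ?d" "1 / 2" ?w] by (simp add: mult_ac)
      have "opnorm (A y - A x) \<le> ?d" using H(2)[of y x] by (simp add: dist_commute)
      from matrix_inv_diff_bound[OF A_invertible A_invertible this, of v]
      have 1: "norm (matrix_inv (A x) *v v - matrix_inv (A y) *v v) \<le> ?K * (?d * ?w)" .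
      have "?w \<le> norm (matrix_inv (A x) *v v) + norm (matrix_inv (A x) *v v - matrix_inv (A y) *v v)"
        using norm_triangle_sub[of "matrix_inv (A y) *v v" "matrix_inv (A x) *v v"] by (simp add: norm_minus_commute)
      then have "?w \<le> 2 * norm (matrix_inv (A x) *v v)" using 1 half by linarith
      then have "?K * (?d * ?w) \<le> ?K * (?d * (2 * norm (matrix_inv (A x) *v v)))"
        using H(1) by (intro mult_left_mono) auto
      then show ?thesis using 1 by (simp add: norm_minus_commute mult_ac)
    qed
    then show "\<exists>C. \<exists>e>0. \<forall>y. dist x y < e \<longrightarrow>
        norm (matrix_inv (A y) *v v - matrix_inv (A x) *v v) \<le> C * dist x y powr \<nu>"
      using e by blast
  qed
  have cont: "continuous_on UNIV (\<lambda>x. matrix_inv (A (inv f x)) *v v)" for v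
    using continuous_on_compose2[OF cont_inv inv_cont] by simp
  have "hoelder_linear_cocycle \<mu> (inv f) (\<lambda>x. (*v) (matrix_inv (A (inv f x))))
    (\<lambda>x. log_size (A (inv f x))) (H * L powr \<nu>) L \<nu>"
  proof
    fix x y v
    show "(\<lambda>x. matrix_inv (A (inv f x)) *v v) \<in> borel_measurable \<mu>"
      by (rule borel_measurable_of_continuous[OF cont])
    let ?x = "inv f x" and ?y = "inv f y"
    let ?d = "H * (L powr \<nu> * dist x y powr \<nu>)"
    have "opnorm (A ?y - A ?x) \<le> H * dist ?x ?y powr \<nu>" using H(2)[of ?y ?x] by (simp add: dist_commute)
    also have "\<dots> \<le> H * (L * dist x y) powr \<nu>"
      using H(1) nu L(2) by (intro mult_left_mono powr_mono2) auto
    also have "\<dots> = ?d" using L(1) by (simp add: powr_mult)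
    finally have "norm (matrix_inv (A ?x) *v v - matrix_inv (A ?y) *v v)
        \<le> exp (log_size (A ?x)) * (?d * norm (matrix_inv (A ?y) *v v))"
      by (rule matrix_inv_diff_bound[OF A_invertible A_invertible])
    also have "\<dots> \<le> exp (log_size (A ?x)) * (?d * (exp (log_size (A ?y)) * norm v))"
      using H(1) log_size_bounds(2)[OF A_invertible] by (intro mult_left_mono) auto
    finally show "norm (matrix_inv (A ?x) *v v - matrix_inv (A ?y) *v v)
        \<le> H * L powr \<nu> * exp (log_size (A ?x) + log_size (A ?y)) * dist x y powr \<nu> * norm v"
      by (simp add: exp_add mult_ac)
  qed (use H L nu log_size_bounds[OF A_invertible] B.integrable_comp(1)[OF log_size_integrable]
      matrix_vector_mul_linear in \<open>auto simp: linear_add linear_scale\<close>)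
  then show thesis by (rule that)
qed

end

section \<open>Growth spaces and Oseledets subspaces\<close>

lemma cocycle_fwd_nonzero:
  fixes A :: "'m \<Rightarrow> real^'d^'d"
  assumes A: "\<And>x. invertible (A x)" and v: "v \<noteq> 0"
  shows "cocycle_fwd f A n x *v v \<noteq> 0"
proof (induction n)
  case (Suc n)
  then show ?case
    using matrix_inv_vector(1)[OF A, of "(f ^^ n) x" "cocycle_fwd f A n x *v v"]
    by (auto simp flip: matrix_vector_mul_assoc)
qed (simp add: v)

lemma cocycle_bwd_nonzero:
  fixes A :: "'m \<Rightarrow> real^'d^'d"
  assumes A: "\<And>x. invertible (A x)" and v: "v \<noteq> 0"
  shows "cocycle_bwd f A n x *v v \<noteq> 0"
proof (induction n)
  case (Suc n)
  then show ?case
    using matrix_inv_vector(2)[OF A, of "(inv f ^^ Suc n) x" "cocycle_bwd f A n x *v v"]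
    by (auto simp flip: matrix_vector_mul_assoc simp del: funpow.simps)
qed (simp add: v)

text \<open>A nonzero vector first enters the filtration at some index \<open>j\<close> and then has
  the exact rate \<open>lyap j\<close>; as \<open>s\<close> separates the exponents up to
  \<open>i\<close> from the later ones, comparing \<open>j\<close> with \<open>i\<close> decides
  membership.\<close>

lemma growth_space_eq_filtration:
  fixes A :: "'m \<Rightarrow> real^'d^'d"
  assumes A: "\<And>x. invertible (A x)" and os: "oseledets_filtration_at f A k lyap F x"
    and i: "i \<le> k" and lo: "\<And>j. j \<in> {1..i} \<Longrightarrow> lyap j < s" and hi: "\<And>j. j \<in> {i<..k} \<Longrightarrow> s < lyap j"
  shows "growth_space f (\<lambda>x. (*v) (A x)) x s = F i x"
proof -
  let ?G = "growth_space f (\<lambda>x. (*v) (A x)) x s"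
  note os' = os[unfolded oseledets_filtration_at_def]
  have F0: "F 0 x = {0}" and Fk: "F k x = UNIV" using os' by simp_all
  have sub: "F i x \<subset> F (Suc i) x" if "i < k" for i using os' that by simp
  have rate: "(\<lambda>n. ln (norm (cocycle_fwd f A n x *v v)) / real n) \<longlonglongrightarrow> lyap i"
    if "i \<in> {1..k}" "v \<in> F i x - F (i - 1) x" for i v using os' that by simp
  have mono: "F j x \<subseteq> F l x" if "j \<le> l" "l \<le> k" for j l
    using that
  proof (induction l)
    case (Suc l)
    then show ?case using sub[of l] by (cases "j = Suc l") auto
  qed simp
  have "v \<in> ?G \<longleftrightarrow> v \<in> F i x" for v
  proof (cases "v = 0")
    case True
    have "subspace ?G" by (rule subspace_growth_space) (rule matrix_vector_mul_linear)
    moreover have "0 \<in> F i x" using mono[of 0 i] i F0 by auto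
    ultimately show ?thesis using True by (simp add: subspace_0)
  next
    case False
    define j where "j = (LEAST j. v \<in> F j x)"
    have vj: "v \<in> F j x" unfolding j_def by (rule LeastI[of _ k]) (simp add: Fk)
    have jk: "j \<le> k" unfolding j_def by (rule Least_le) (simp add: Fk)
    have least: "v \<notin> F l x" if "l < j" for l using that unfolding j_def by (rule not_less_Least)
    have j0: "j > 0" using vj False F0 by (cases j) auto
    have "(\<lambda>n. ln (norm (cocycle_fwd f A n x *v v)) / real n) \<longlonglongrightarrow> lyap j"
      using j0 jk vj least[of "j - 1"] by (intro rate) auto
    then have lim: "(\<lambda>n. ln (norm (cocycle_iter f (\<lambda>x. (*v) (A x)) n x v)) / real n) \<longlonglongrightarrow> lyap j"
      by (simp add: cocycle_iter_matrix)
    have nz: "cocycle_iter f (\<lambda>x. (*v) (A x)) n x v \<noteq> 0" for n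
      by (simp add: cocycle_iter_matrix cocycle_fwd_nonzero[OF A False])
    show ?thesis
    proof (cases "j \<le> i")
      case True
      then have "v \<in> F i x" using mono[of j i] i vj by blast
      moreover have "v \<in> ?G" using growth_space_of_rate(1)[OF lim nz] lo[of j] True j0 by auto
      ultimately show ?thesis by simp
    next
      case False
      then have "v \<notin> F i x" using least[of i] by simp
      moreover have "v \<notin> ?G" using growth_space_of_rate(2)[OF lim nz] hi[of j] False jk by auto
      ultimately show ?thesis by simp
    qed
  qed
  then show ?thesis by blast
qed

text \<open>Under the inverse cocycle \<open>E j x\<close> grows at rate \<open>- lyap j\<close>,
  because dividing by a negative time reverses the sign. The backward growth space at level
  \<open>- s\<close> thus collects the exponents above \<open>s\<close>.\<close>

lemma growth_space_splitting:
  fixes A :: "'m \<Rightarrow> real^'d^'d"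
  assumes A: "\<And>x. invertible (A x)" and os: "oseledets_splitting_at f A k lyap E x"
    and mono: "strict_mono_on {1..k} lyap"
    and u: "\<And>j. j \<in> {1..k} \<Longrightarrow> u j \<in> E j x" and s: "\<And>j. j \<in> {1..k} \<Longrightarrow> lyap j \<noteq> s"
  shows "(\<Sum>j=1..k. u j) \<in> growth_space f (\<lambda>x. (*v) (A x)) x s \<longleftrightarrow> (\<forall>j\<in>{1..k}. s < lyap j \<longrightarrow> u j = 0)"
    and "(\<Sum>j=1..k. u j) \<in> growth_space (inv f) (\<lambda>x. (*v) (matrix_inv (A (inv f x)))) x (- s)
      \<longleftrightarrow> (\<forall>j\<in>{1..k}. lyap j < s \<longrightarrow> u j = 0)"
proof -
  note rate = os[unfolded oseledets_splitting_at_def, THEN conjunct2, THEN conjunct2, THEN conjunct2, rule_format]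
  have inj: "inj_on lyap {1..k}" using mono by (rule strict_mono_on_imp_inj_on)
  let ?B = "\<lambda>x. (*v) (A x)" and ?B' = "\<lambda>x. (*v) (matrix_inv (A (inv f x)))"
  show "(\<Sum>j=1..k. u j) \<in> growth_space f ?B x s \<longleftrightarrow> (\<forall>j\<in>{1..k}. s < lyap j \<longrightarrow> u j = 0)"
  proof (rule growth_space_direct_sum[where E = "\<lambda>j. E j x"])
    show "subspace (growth_space f ?B x s)" for s
      by (rule subspace_growth_space) (rule matrix_vector_mul_linear)
    fix j v s assume j: "j \<in> {1..k}" and v: "v \<in> E j x" "v \<noteq> 0"
    have "((\<lambda>n. ln (norm (cocycle f A n x *v v)) / real_of_int n) \<longlongrightarrow> lyap j) at_top"
      using rate[OF j, of v] v by simp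
    then have "(\<lambda>n. ln (norm (cocycle f A (int n) x *v v)) / real_of_int (int n)) \<longlonglongrightarrow> lyap j"
      by (rule filterlim_compose[OF _ filterlim_int_sequentially])
    then have lim: "(\<lambda>n. ln (norm (cocycle_iter f ?B n x v)) / real n) \<longlonglongrightarrow> lyap j"
      by (simp add: cocycle_iter_matrix cocycle_def)
    have nz: "cocycle_iter f ?B n x v \<noteq> 0" for n
      by (simp add: cocycle_iter_matrix cocycle_fwd_nonzero[OF A v(2)])
    show "(lyap j < s \<longrightarrow> v \<in> growth_space f ?B x s) \<and> (s < lyap j \<longrightarrow> v \<notin> growth_space f ?B x s)"
      using growth_space_of_rate[OF lim nz] by blast
  next
    show "growth_space f ?B x s \<subseteq> growth_space f ?B x t" if "s \<le> t" for s t
      using that by (rule growth_space_mono)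
  qed (use inj in \<open>simp_all add: u s\<close>)
  have "(\<Sum>j=1..k. u j) \<in> growth_space (inv f) ?B' x (- s) \<longleftrightarrow> (\<forall>j\<in>{1..k}. - s < - lyap j \<longrightarrow> u j = 0)"
  proof (rule growth_space_direct_sum[where E = "\<lambda>j. E j x"])
    show "subspace (growth_space (inv f) ?B' x s)" for s
      by (rule subspace_growth_space) (rule matrix_vector_mul_linear)
    fix j v s assume j: "j \<in> {1..k}" and v: "v \<in> E j x" "v \<noteq> 0"
    have "((\<lambda>n. ln (norm (cocycle f A n x *v v)) / real_of_int n) \<longlongrightarrow> lyap j) at_bot"
      using rate[OF j, of v] v by simp
    moreover have "filterlim (\<lambda>n. - int n) at_bot sequentially"
      unfolding filterlim_at_bot eventually_sequentially
    proof
      show "\<exists>N. \<forall>n\<ge>N. - int n \<le> Z" for Z by (intro exI[of _ "nat (- Z)"]) auto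
    qed
    ultimately have "(\<lambda>n. ln (norm (cocycle f A (- int n) x *v v)) / real_of_int (- int n)) \<longlonglongrightarrow> lyap j"
      by (rule filterlim_compose)
    then have "(\<lambda>n. - (ln (norm (cocycle f A (- int n) x *v v)) / real_of_int (- int n))) \<longlonglongrightarrow> - lyap j"
      by (rule tendsto_minus)
    moreover have "cocycle f A (- int n) x = cocycle_bwd f A n x" for n
      by (cases "n = 0") (simp_all add: cocycle_def)
    ultimately have lim: "(\<lambda>n. ln (norm (cocycle_iter (inv f) ?B' n x v)) / real n) \<longlonglongrightarrow> - lyap j"
      by (simp add: cocycle_iter_inverse)
    have nz: "cocycle_iter (inv f) ?B' n x v \<noteq> 0" for n
      by (simp add: cocycle_iter_inverse cocycle_bwd_nonzero[OF A v(2)])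
    show "(- lyap j < s \<longrightarrow> v \<in> growth_space (inv f) ?B' x s) \<and> (s < - lyap j \<longrightarrow> v \<notin> growth_space (inv f) ?B' x s)"
      using growth_space_of_rate[OF lim nz] by blast
  next
    show "inj_on (\<lambda>j. - lyap j) {1..k}" using inj unfolding inj_on_def neg_equal_iff_equal .
    show "- lyap j \<noteq> - s" if "j \<in> {1..k}" for j using s[OF that] by simp
    show "growth_space (inv f) ?B' x s \<subseteq> growth_space (inv f) ?B' x t" if "s \<le> t" for s t
      using that by (rule growth_space_mono)
  qed (simp_all add: u)
  then show "(\<Sum>j=1..k. u j) \<in> growth_space (inv f) ?B' x (- s) \<longleftrightarrow> (\<forall>j\<in>{1..k}. lyap j < s \<longrightarrow> u j = 0)"
    by simp
qed

section \<open>Combining estimates for pairs of points\<close>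

context prob_space
begin

lemma nearly_pair_sym:
  assumes "nearly_pair Q"
  shows "nearly_pair (\<lambda>C x y. Q C x y \<and> Q C y x)"
  unfolding nearly_pair_def
proof (intro allI impI)
  fix \<delta> :: real assume "\<delta> > 0"
  then obtain S C where S: "S \<in> events" "prob S \<ge> 1 - \<delta>" "\<forall>x\<in>S. \<forall>y\<in>S. Q C x y"
    using assms unfolding nearly_pair_def by blast
  then show "\<exists>S\<in>events. \<exists>C. prob S \<ge> 1 - \<delta> \<and> (\<forall>x\<in>S. \<forall>y\<in>S. Q C x y \<and> Q C y x)"
    by (intro bexI[of _ S] exI[of _ C]) auto
qed

lemma nearly_pair_AE:
  assumes "nearly_pair Q" "AE x in M. R x"
  shows "nearly_pair (\<lambda>C x y. Q C x y \<and> R x \<and> R y)"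
proof -
  have "nearly_pair (\<lambda>(C::unit) x y. R x \<and> R y)"
    by (rule nearly_pairI[OF nearly_AE[OF assms(2)]]) auto
  from nearly_pair_conj[OF assms(1) this] show ?thesis
    by (rule nearly_pair_mono) auto
qed

lemma nearly_pair_finite:
  fixes Q :: "'i \<Rightarrow> real \<Rightarrow> 'a \<Rightarrow> 'a \<Rightarrow> bool"
  assumes "finite I" and "\<And>i. i \<in> I \<Longrightarrow> nearly_pair (Q i)"
    and mono: "\<And>i C D x y. C \<le> D \<Longrightarrow> Q i C x y \<Longrightarrow> Q i D x y"
  shows "nearly_pair (\<lambda>C x y. \<forall>i\<in>I. Q i C x y)"
  using assms(1,2)
proof (induction I)
  case empty
  show ?case unfolding nearly_pair_def
    by (intro allI impI bexI[of _ "space M"]) (auto simp: prob_space)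
next
  case (insert i I)
  then have "nearly_pair (Q i)" "nearly_pair (\<lambda>C x y. \<forall>i\<in>I. Q i C x y)" by simp_all
  from nearly_pair_conj[OF this] show ?case
  proof (rule nearly_pair_mono, goal_cases)
    case (1 p)
    obtain C D where p: "p = (C, D)" by (cases p)
    show ?case
      unfolding p prod.case
      by (intro exI[of _ "max C D"]) (auto intro: mono[OF max.cobounded1] mono[OF max.cobounded2])
  qed
qed

end

text \<open>The gap between the \<open>i\<close>-th and the next exponent; beyond the extreme exponents, gaps of
  length 2 make the trivial subspaces of the filtration accessible to the same argument.\<close>

definition gap_lo :: "(nat \<Rightarrow> real) \<Rightarrow> nat \<Rightarrow> real" where
  "gap_lo l i = (if i = 0 then l 1 - 2 else l i)"

definition gap_hi :: "nat \<Rightarrow> (nat \<Rightarrow> real) \<Rightarrow> nat \<Rightarrow> real" where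
  "gap_hi k l i = (if i = k then l k + 2 else l (Suc i))"

definition gap_mid :: "nat \<Rightarrow> (nat \<Rightarrow> real) \<Rightarrow> nat \<Rightarrow> real" where
  "gap_mid k l i = (gap_lo l i + gap_hi k l i) / 2"

lemma gap_less:
  assumes "strict_mono_on {1..k} l" "i \<le> k" "k \<ge> 1"
  shows "gap_lo l i < gap_hi k l i"
  using assms strict_mono_onD[OF assms(1), of i "Suc i"]
    strict_mono_on_leD[OF assms(1), of 1 k]
  by (auto simp: gap_lo_def gap_hi_def)

lemma gap_mid_bounds:
  assumes "strict_mono_on {1..k} l" "i \<le> k" "k \<ge> 1"
  shows "gap_mid k l i \<in> {gap_lo l i<..<gap_hi k l i}"
  using gap_less[OF assms] by (simp add: gap_mid_def field_simps)

lemma gap_separates: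
  assumes l: "strict_mono_on {1..k} l" and i: "i \<le> k" and s: "s \<in> {gap_lo l i<..<gap_hi k l i}"
  shows "j \<in> {1..i} \<Longrightarrow> l j < s" "j \<in> {i<..k} \<Longrightarrow> s < l j"
proof -
  assume j: "j \<in> {1..i}"
  then have "l j \<le> l i" using i by (intro strict_mono_on_leD[OF l]) auto
  then show "l j < s" using s j by (auto simp: gap_lo_def)
next
  assume j: "j \<in> {i<..k}"
  then have "l (Suc i) \<le> l j" by (intro strict_mono_on_leD[OF l]) auto
  then show "s < l j" using s j by (auto simp: gap_hi_def)
qed

lemma gap_separates_iff:
  assumes l: "strict_mono_on {1..k} l" and i: "i \<le> k" and s: "s \<in> {gap_lo l i<..<gap_hi k l i}"
    and j: "j \<in> {1..k}"
  shows "l j < s \<longleftrightarrow> j \<le> i" "s < l j \<longleftrightarrow> i < j" "l j \<noteq> s"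
  using gap_separates[OF l i s, of j] j by (cases "j \<le> i"; force)+

lemma oseledets_splitting_decomp:
  assumes "oseledets_splitting_at f A k lyap E x"
  obtains u where "\<forall>j\<in>{1..k}. u j \<in> E j x" "v = (\<Sum>j=1..k. u j)"
proof -
  have "\<exists>!u. u \<in> (\<Pi>\<^sub>E j\<in>{1..k}. E j x) \<and> v = (\<Sum>j=1..k. u j)"
    using assms by (simp add: oseledets_splitting_at_def)
  then obtain u where u: "u \<in> (\<Pi>\<^sub>E j\<in>{1..k}. E j x)" "v = (\<Sum>j=1..k. u j)"
    by (elim ex1E conjE)
  show thesis
  proof (rule that)
    show "\<forall>j\<in>{1..k}. u j \<in> E j x" using u(1) by (blast intro: PiE_mem)
  qed (rule u(2))
qed

lemma growth_space_splitting_gap: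
  fixes A :: "'m \<Rightarrow> real^'d^'d"
  assumes A: "\<And>x. invertible (A x)" and os: "oseledets_splitting_at f A k lyap E x"
    and mono: "strict_mono_on {1..k} lyap" and i: "i \<le> k" and s: "s \<in> {gap_lo lyap i<..<gap_hi k lyap i}"
    and u: "\<forall>j\<in>{1..k}. u j \<in> E j x"
  shows "(\<Sum>j=1..k. u j) \<in> growth_space f (\<lambda>x. (*v) (A x)) x s \<longleftrightarrow> (\<forall>j\<in>{1..k}. i < j \<longrightarrow> u j = 0)"
    and "(\<Sum>j=1..k. u j) \<in> growth_space (inv f) (\<lambda>x. (*v) (matrix_inv (A (inv f x)))) x (- s)
      \<longleftrightarrow> (\<forall>j\<in>{1..k}. j \<le> i \<longrightarrow> u j = 0)"
proof -
  note sep = gap_separates_iff[OF mono i s]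
  show "(\<Sum>j=1..k. u j) \<in> growth_space f (\<lambda>x. (*v) (A x)) x s \<longleftrightarrow> (\<forall>j\<in>{1..k}. i < j \<longrightarrow> u j = 0)"
    using growth_space_splitting(1)[OF A os mono bspec[OF u] sep(3)] sep(2) by simp
  show "(\<Sum>j=1..k. u j) \<in> growth_space (inv f) (\<lambda>x. (*v) (matrix_inv (A (inv f x)))) x (- s)
      \<longleftrightarrow> (\<forall>j\<in>{1..k}. j \<le> i \<longrightarrow> u j = 0)"
    using growth_space_splitting(2)[OF A os mono bspec[OF u] sep(3)] sep(1) by simp
qed

text \<open>The one-sided estimate of \<open>nearly_pair_grow\<close> is used in both directions.
  \<open>F i x\<close> is nonzero because it strictly contains \<open>F (i - 1) x\<close>, so the
  suprema in \<open>subspace_dist\<close> range over nonempty sets.\<close>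

lemma nearly_pair_filtration:
  fixes A :: "'m::metric_space \<Rightarrow> real^'d^'d"
  assumes hlc: "hoelder_linear_cocycle \<mu> f (\<lambda>x. (*v) (A x)) g H L \<nu>"
    and A: "\<And>x. invertible (A x)" and os: "oseledets_filtration \<mu> f A k lyap F" and i: "i \<in> {1..k}"
  shows "prob_space.nearly_pair \<mu> (\<lambda>K x y. dist x y < 1 \<longrightarrow> subspace_dist (F i x) (F i y)
    \<le> K * dist x y powr (\<nu> * gap_exponent (gap_lo lyap i) (gap_hi k lyap i) (max 0 (lyap k) + 6 + \<nu> * ln L)))"
proof -
  interpret hoelder_linear_cocycle \<mu> f "\<lambda>x. (*v) (A x)" g H L \<nu> by (rule hlc)
  have mono: "strict_mono_on {1..k} lyap" and ae: "AE x in \<mu>. oseledets_filtration_at f A k lyap F x"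
    using os by (simp_all add: oseledets_filtration_def)
  have ik: "i \<le> k" "k \<ge> 1" using i by simp_all
  let ?t = "gap_mid k lyap i"
  note t = gap_mid_bounds[OF mono ik]
  have eq: "grow x s = F i x" if "oseledets_filtration_at f A k lyap F x" "s \<in> {gap_lo lyap i<..<gap_hi k lyap i}" for x s
    by (rule growth_space_eq_filtration[OF A that(1) ik(1)]) (rule gap_separates[OF mono ik(1) that(2)], assumption)+
  have gap: "AE x in \<mu>. \<forall>s\<in>{gap_lo lyap i<..<gap_hi k lyap i}. grow x s = grow x ?t"
    using ae
  proof eventually_elim
    case (elim x)
    show ?case using eq[OF elim] eq[OF elim t] by simp
  qed
  have top: "AE x in \<mu>. \<forall>s>lyap k. grow x s = UNIV"
    using ae
  proof eventually_elim
    case (elim x)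
    show ?case
    proof (intro allI impI)
      fix s assume s: "s > lyap k"
      have "grow x s = F k x"
      proof (rule growth_space_eq_filtration[OF A elim order_refl])
        fix j assume "j \<in> {1..k}"
        then have "lyap j \<le> lyap k" by (intro strict_mono_on_leD[OF mono]) auto
        then show "lyap j < s" using s by simp
      qed simp
      then show "grow x s = UNIV" using elim by (simp add: oseledets_filtration_at_def)
    qed
  qed
  have R: "AE x in \<mu>. grow x ?t = F i x \<and> F i x \<noteq> {0}"
    using ae
  proof eventually_elim
    case (elim x)
    have "i - 1 < k" "Suc (i - 1) = i" using i by auto
    then have "F (i - 1) x \<subset> F i x" "subspace (F (i - 1) x)"
      using elim unfolding oseledets_filtration_at_def by (metis, metis less_imp_le)
    then have "F i x \<noteq> {0}" using subspace_0[of "F (i - 1) x"] by auto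
    then show ?case using eq[OF elim t] by simp
  qed
  from nearly_pair_AE[OF nearly_pair_sym[OF nearly_pair_grow[OF gap_less[OF mono ik] t gap top]] R]
  show ?thesis
  proof (rule nearly_pair_mono, goal_cases)
    case (1 K)
    let ?e = "\<nu> * gap_exponent (gap_lo lyap i) (gap_hi k lyap i) (max 0 (lyap k) + 6 + \<nu> * ln L)"
    have main: "subspace_dist (F i x) (F i y) \<le> K * dist x y powr ?e"
      if x: "grow x ?t = F i x" "F i x \<noteq> {0}" and y: "grow y ?t = F i y" "F i y \<noteq> {0}"
        and xy: "\<forall>v\<in>grow x ?t. infdist v (grow y ?t) \<le> K * dist x y powr ?e * norm v"
        and yx: "\<forall>v\<in>grow y ?t. infdist v (grow x ?t) \<le> K * dist y x powr ?e * norm v" for x y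
      using subspace_grow[of x ?t] subspace_grow[of y ?t] xy yx x(2) y(2) unfolding x(1) y(1)
      by (intro subspace_dist_le) (simp_all add: dist_commute)
    show ?case
      by (intro exI[of _ K] allI impI, elim conjE, intro main) (simp_all add: dist_commute)
  qed
qed

text \<open>The Oseledets subspaces are the intersections of the forward and the backward filtrations,
  and the uniform transversality of the two makes the intersection vary as regularly as they do.\<close>

lemma nearly_pair_splitting:
  fixes A :: "'m::metric_space \<Rightarrow> real^'d^'d"
  assumes fwd: "hoelder_linear_cocycle \<mu> f (\<lambda>x. (*v) (A x)) g H L \<nu>"
    and bwd: "hoelder_linear_cocycle \<mu> (inv f) (\<lambda>x. (*v) (matrix_inv (A (inv f x)))) g' H' L' \<nu>"
    and A: "\<And>x. invertible (A x)" and os: "oseledets_filtration \<mu> f A k lyap F"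
    and split: "oseledets_splitting \<mu> f A k lyap E" and i: "i \<in> {1..k}"
    and e1: "e \<le> \<nu> * gap_exponent (gap_lo lyap i) (gap_hi k lyap i) (max 0 (lyap k) + 6 + \<nu> * ln L)"
    and e2: "e \<le> \<nu> * gap_exponent (- gap_hi k lyap (i - 1)) (- gap_lo lyap (i - 1)) (max 0 (- lyap 1) + 6 + \<nu> * ln L')"
  shows "prob_space.nearly_pair \<mu> (\<lambda>K x y. dist x y < 1 \<longrightarrow> subspace_dist (E i x) (E i y) \<le> K * dist x y powr e)"
proof -
  interpret F: hoelder_linear_cocycle \<mu> f "\<lambda>x. (*v) (A x)" g H L \<nu> by (rule fwd)
  interpret B: hoelder_linear_cocycle \<mu> "inv f" "\<lambda>x. (*v) (matrix_inv (A (inv f x)))" g' H' L' \<nu> by (rule bwd)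
  have mono: "strict_mono_on {1..k} lyap" and ae: "AE x in \<mu>. oseledets_filtration_at f A k lyap F x"
    using os by (simp_all add: oseledets_filtration_def)
  have ae_split: "AE x in \<mu>. oseledets_splitting_at f A k lyap E x"
    using split by (simp add: oseledets_splitting_def)
  have ik: "i \<le> k" "k \<ge> 1" "i - 1 \<le> k" using i by auto
  note gap_iff = growth_space_splitting_gap[OF A _ mono]
  \<comment> \<open>Almost everywhere \<open>V j x\<close> is the sum of the first \<open>j\<close>
    Oseledets subspaces and \<open>W x\<close> the sum of those from \<open>i\<close> on. Hence
    \<open>V i x\<close> and \<open>W x\<close> intersect in \<open>E i x\<close>, while
    \<open>V (i - 1) x\<close> and \<open>W x\<close> are complementary.\<close>
  define V where "V j x = F.grow x (gap_mid k lyap j)" for j x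
  define W where "W x = B.grow x (- gap_mid k lyap (i - 1))" for x
  have subV: "subspace (V j x)" for j x unfolding V_def by (rule F.subspace_grow)
  have subW: "subspace (W x)" for x unfolding W_def by (rule B.subspace_grow)
  have V_iff: "(\<Sum>j=1..k. u j) \<in> V l x \<longleftrightarrow> (\<forall>j\<in>{1..k}. l < j \<longrightarrow> u j = 0)"
    if "oseledets_splitting_at f A k lyap E x" "l \<le> k" "\<forall>j\<in>{1..k}. u j \<in> E j x" for l x u
    unfolding V_def by (rule gap_iff(1)[OF that(1,2) gap_mid_bounds[OF mono that(2) ik(2)] that(3)])
  have W_iff': "(\<Sum>j=1..k. u j) \<in> B.grow x (- s) \<longleftrightarrow> (\<forall>j\<in>{1..k}. j \<le> i - 1 \<longrightarrow> u j = 0)"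
    if "oseledets_splitting_at f A k lyap E x" "s \<in> {gap_lo lyap (i - 1)<..<gap_hi k lyap (i - 1)}"
      "\<forall>j\<in>{1..k}. u j \<in> E j x" for s x u
    by (rule gap_iff(2)[OF that(1) ik(3) that(2,3)])
  have W_iff: "(\<Sum>j=1..k. u j) \<in> W x \<longleftrightarrow> (\<forall>j\<in>{1..k}. j \<le> i - 1 \<longrightarrow> u j = 0)"
    if "oseledets_splitting_at f A k lyap E x" "\<forall>j\<in>{1..k}. u j \<in> E j x" for x u
    unfolding W_def by (rule W_iff'[OF that(1) gap_mid_bounds[OF mono ik(3,2)] that(2)])
  have V_filt: "V j x = F j x" if "oseledets_filtration_at f A k lyap F x" "j \<le> k" for j x
    unfolding V_def
    by (rule growth_space_eq_filtration[OF A that])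
      (rule gap_separates[OF mono that(2) gap_mid_bounds[OF mono that(2) ik(2)]], assumption)+
  have nearly_V: "F.nearly_pair (\<lambda>K x y. K > 0 \<and> (dist x y < 1 \<longrightarrow> (\<forall>v\<in>V i x. infdist v (V i y)
    \<le> K * dist x y powr (\<nu> * gap_exponent (gap_lo lyap i) (gap_hi k lyap i) (max 0 (lyap k) + 6 + \<nu> * ln L)) * norm v)))"
    unfolding V_def
  proof (rule F.nearly_pair_grow[OF gap_less[OF mono ik(1,2)] gap_mid_bounds[OF mono ik(1,2)]])
    show "AE x in \<mu>. \<forall>s\<in>{gap_lo lyap i<..<gap_hi k lyap i}. F.grow x s = F.grow x (gap_mid k lyap i)"
      using ae_split
    proof eventually_elim
      case (elim x)
      have "v \<in> F.grow x s \<longleftrightarrow> v \<in> V i x" if "s \<in> {gap_lo lyap i<..<gap_hi k lyap i}" for s v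
      proof -
        obtain u where u: "\<forall>j\<in>{1..k}. u j \<in> E j x" "v = (\<Sum>j=1..k. u j)"
          using oseledets_splitting_decomp[OF elim, of v] by blast
        show ?thesis
          unfolding u(2) V_iff[OF elim ik(1) u(1)] by (rule gap_iff(1)[OF elim ik(1) that u(1)])
      qed
      then show ?case unfolding V_def by blast
    qed
    show "AE x in \<mu>. \<forall>s>lyap k. F.grow x s = UNIV"
      using ae_split
    proof eventually_elim
      case (elim x)
      have "v \<in> F.grow x s" if "s > lyap k" for s v
      proof -
        obtain u where u: "\<forall>j\<in>{1..k}. u j \<in> E j x" "v = (\<Sum>j=1..k. u j)"
          using oseledets_splitting_decomp[OF elim, of v] by blast
        have "lyap j < s" if "j \<in> {1..k}" for j
          using strict_mono_on_leD[OF mono, of j k] that ik(2) \<open>s > lyap k\<close> by auto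
        then show ?thesis
          using growth_space_splitting(1)[OF A elim mono bspec[OF u(1)], of s] unfolding u(2) by fastforce
      qed
      then show ?case by blast
    qed
  qed
  have nearly_W: "F.nearly_pair (\<lambda>K x y. K > 0 \<and> (dist x y < 1 \<longrightarrow> (\<forall>v\<in>W x. infdist v (W y)
    \<le> K * dist x y powr (\<nu> * gap_exponent (- gap_hi k lyap (i - 1)) (- gap_lo lyap (i - 1))
      (max 0 (- lyap 1) + 6 + \<nu> * ln L')) * norm v)))"
    unfolding W_def
  proof (rule B.nearly_pair_grow)
    show "- gap_hi k lyap (i - 1) < - gap_lo lyap (i - 1)"
      using gap_less[OF mono ik(3,2)] by simp
    show "- gap_mid k lyap (i - 1) \<in> {- gap_hi k lyap (i - 1)<..<- gap_lo lyap (i - 1)}"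
      using gap_mid_bounds[OF mono ik(3,2)] by simp
    show "AE x in \<mu>. \<forall>s\<in>{- gap_hi k lyap (i - 1)<..<- gap_lo lyap (i - 1)}.
        B.grow x s = B.grow x (- gap_mid k lyap (i - 1))"
      using ae_split
    proof eventually_elim
      case (elim x)
      have "v \<in> B.grow x s \<longleftrightarrow> v \<in> W x" if s: "s \<in> {- gap_hi k lyap (i - 1)<..<- gap_lo lyap (i - 1)}" for s v
      proof -
        obtain u where u: "\<forall>j\<in>{1..k}. u j \<in> E j x" "v = (\<Sum>j=1..k. u j)"
          using oseledets_splitting_decomp[OF elim, of v] by blast
        have "- s \<in> {gap_lo lyap (i - 1)<..<gap_hi k lyap (i - 1)}" using s by auto
        from W_iff'[OF elim this u(1)] show ?thesis
          unfolding u(2) W_iff[OF elim u(1)] by simp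
      qed
      then show ?case unfolding W_def by blast
    qed
    show "AE x in \<mu>. \<forall>s>- lyap 1. B.grow x s = UNIV"
      using ae_split
    proof eventually_elim
      case (elim x)
      have "v \<in> B.grow x s" if "s > - lyap 1" for s v
      proof -
        obtain u where u: "\<forall>j\<in>{1..k}. u j \<in> E j x" "v = (\<Sum>j=1..k. u j)"
          using oseledets_splitting_decomp[OF elim, of v] by blast
        have "- s < lyap j" if "j \<in> {1..k}" for j
          using strict_mono_on_leD[OF mono, of 1 j] that \<open>s > - lyap 1\<close> by auto
        then show ?thesis
          using growth_space_splitting(2)[OF A elim mono bspec[OF u(1)], of "- s"] unfolding u(2) by fastforce
      qed
      then show ?case by blast
    qed
  qed
  have "AE x in \<mu>. V (i - 1) x \<inter> W x = {0}"
    using ae_split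
  proof eventually_elim
    case (elim x)
    have "v = 0" if v: "v \<in> V (i - 1) x" "v \<in> W x" for v
    proof -
      obtain u where u: "\<forall>j\<in>{1..k}. u j \<in> E j x" "v = (\<Sum>j=1..k. u j)"
        using oseledets_splitting_decomp[OF elim, of v] by blast
      have "\<forall>j\<in>{1..k}. i - 1 < j \<longrightarrow> u j = 0" using v(1) unfolding u(2) V_iff[OF elim ik(3) u(1)] .
      moreover have "\<forall>j\<in>{1..k}. j \<le> i - 1 \<longrightarrow> u j = 0" using v(2) unfolding u(2) W_iff[OF elim u(1)] .
      ultimately have "u j = 0" if "j \<in> {1..k}" for j using that not_le by blast
      then show ?thesis unfolding u(2) by (intro sum.neutral) blast
    qed
    then show ?case using subspace_0[OF subV, of "i - 1" x] subspace_0[OF subW, of x] by blast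
  qed
  then have trans: "F.nearly (\<lambda>(C::real) x. \<forall>v\<in>V (i - 1) x. \<forall>w\<in>W x. norm v \<le> C * norm (v + w))"
  proof (rule F.nearly_transversal[OF subV subW, rotated 2])
    show "(\<lambda>x. infdist v (V (i - 1) x)) \<in> borel_measurable \<mu>" for v
      unfolding V_def by measurable
    show "(\<lambda>x. infdist v (W x)) \<in> borel_measurable \<mu>" for v
      unfolding W_def by measurable
  qed
  have R: "AE x in \<mu>. subspace (E i x) \<and> E i x \<noteq> {0} \<and> E i x \<subseteq> V i x \<and> E i x \<subseteq> W x \<and>
      (\<forall>u\<in>V i x. \<exists>e\<in>E i x. u - e \<in> V (i - 1) x)"
    using ae_split ae
  proof eventually_elim
    case (elim x)
    have subE: "subspace (E j x)" if "j \<in> {1..k}" for j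
      using elim(1) that by (simp add: oseledets_splitting_at_def)
    have single: "(\<Sum>j=1..k. if j = i then v else 0) = v" for v :: "real^'d"
      using i by (simp add: sum.delta)
    have "v \<in> V i x \<and> v \<in> W x" if v: "v \<in> E i x" for v
    proof -
      have u: "\<forall>j\<in>{1..k}. (if j = i then v else 0) \<in> E j x"
        using v subspace_0[OF subE] by auto
      show ?thesis
        using V_iff[OF elim(1) ik(1) u] W_iff[OF elim(1) u] i unfolding single by auto
    qed
    moreover have dec: "\<exists>e\<in>E i x. v - e \<in> V (i - 1) x" if v: "v \<in> V i x" for v
    proof -
      obtain u where u: "\<forall>j\<in>{1..k}. u j \<in> E j x" "v = (\<Sum>j=1..k. u j)"
        using oseledets_splitting_decomp[OF elim(1), of v] by blast
      have z: "\<forall>j\<in>{1..k}. i < j \<longrightarrow> u j = 0" using v unfolding u(2) V_iff[OF elim(1) ik(1) u(1)] .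
      let ?w = "\<lambda>j. u j - (if j = i then u i else 0)"
      have w: "\<forall>j\<in>{1..k}. ?w j \<in> E j x"
        using u(1) subspace_0[OF subE] by auto
      have "v - u i = (\<Sum>j=1..k. ?w j)" unfolding u(2) by (simp only: sum_subtractf single)
      moreover have "(\<Sum>j=1..k. ?w j) \<in> V (i - 1) x"
        unfolding V_iff[OF elim(1) ik(3) w] using z by auto
      ultimately show ?thesis using bspec[OF u(1) i] by (intro bexI[of _ "u i"]) simp_all
    qed
    \<comment> \<open>The definition of the splitting admits zero summands; that
      \<open>E i x\<close> is nonzero comes from the strictness of the filtration.\<close>
    moreover have "E i x \<noteq> {0}"
    proof
      assume "E i x = {0}"
      then have "V i x \<subseteq> V (i - 1) x" using dec by force
      then have "F i x \<subseteq> F (i - 1) x" by (simp only: V_filt[OF elim(2) ik(1)] V_filt[OF elim(2) ik(3)])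
      moreover have "F (i - 1) x \<subset> F (Suc (i - 1)) x"
      proof -
        have "\<forall>i<k. F i x \<subset> F (Suc i) x" using elim(2) by (simp add: oseledets_filtration_at_def)
        moreover have "i - 1 < k" using i by auto
        ultimately show ?thesis by blast
      qed
      ultimately show False using i by auto
    qed
    ultimately show ?case using subE[OF i] by blast
  qed
  have trans': "F.nearly_pair (\<lambda>(C::real) x y. \<forall>v\<in>V (i - 1) y. \<forall>w\<in>W y. norm v \<le> C * norm (v + w))"
    by (rule F.nearly_pairI[OF trans]) blast
  from F.nearly_pair_AE[OF F.nearly_pair_conj[OF F.nearly_pair_conj[OF nearly_V nearly_W] trans'] R]
  have "F.nearly_pair (\<lambda>K x y. subspace (E i x) \<and> E i x \<noteq> {0} \<and>
    (dist x y < 1 \<longrightarrow> (\<forall>v\<in>E i x. infdist v (E i y) \<le> K * dist x y powr e * norm v)))"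
  proof (rule F.nearly_pair_mono, goal_cases)
    case (1 p)
    obtain K1 K2 C where p: "p = ((K1, K2), C)" by (metis surj_pair)
    \<comment> \<open>The weights are those of \<open>infdist_intersection_bound\<close>; the
      absolute value is taken because the sign of \<open>C\<close> is unknown.\<close>
    define K where "K = (\<bar>C\<bar> + 1) * K1 + \<bar>C\<bar> * K2"
    let ?e1 = "\<nu> * gap_exponent (gap_lo lyap i) (gap_hi k lyap i) (max 0 (lyap k) + 6 + \<nu> * ln L)"
    let ?e2 = "\<nu> * gap_exponent (- gap_hi k lyap (i - 1)) (- gap_lo lyap (i - 1)) (max 0 (- lyap 1) + 6 + \<nu> * ln L')"
    have main: "infdist v (E i y) \<le> K * dist x y powr e * norm v"
      if K1: "K1 > 0" "\<forall>v\<in>V i x. infdist v (V i y) \<le> K1 * dist x y powr ?e1 * norm v"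
        and K2: "K2 > 0" "\<forall>v\<in>W x. infdist v (W y) \<le> K2 * dist x y powr ?e2 * norm v"
        and C: "\<forall>v\<in>V (i - 1) y. \<forall>w\<in>W y. norm v \<le> C * norm (v + w)"
        and x: "E i x \<subseteq> V i x" "E i x \<subseteq> W x"
        and y: "E i y \<subseteq> W y" "\<forall>u\<in>V i y. \<exists>e\<in>E i y. u - e \<in> V (i - 1) y"
        and d: "dist x y < 1" and v: "v \<in> E i x" for x y v
    proof -
      have pw: "dist x y powr ?e1 \<le> dist x y powr e" "dist x y powr ?e2 \<le> dist x y powr e"
        using d by (simp_all add: powr_mono'[OF e1] powr_mono'[OF e2] del: One_nat_def)
      have "infdist v (V i y) \<le> K1 * dist x y powr ?e1 * norm v" using K1 x v by blast
      also have "\<dots> \<le> K1 * dist x y powr e * norm v"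
        using K1(1) pw by (intro mult_right_mono mult_left_mono) auto
      finally have 1: "infdist v (V i y) \<le> K1 * dist x y powr e * norm v" .
      have "infdist v (W y) \<le> K2 * dist x y powr ?e2 * norm v" using K2 x v by blast
      also have "\<dots> \<le> K2 * dist x y powr e * norm v"
        using K2(1) pw by (intro mult_right_mono mult_left_mono) auto
      finally have 2: "infdist v (W y) \<le> K2 * dist x y powr e * norm v" .
      have "infdist v (E i y) \<le> (\<bar>C\<bar> + 1) * infdist v (V i y) + \<bar>C\<bar> * infdist v (W y)"
      proof (rule infdist_intersection_bound[OF subV subW _ y(1)])
        show "norm a \<le> \<bar>C\<bar> * norm (a + b)" if "a \<in> V (i - 1) y" "b \<in> W y" for a b
        proof -
          have "norm a \<le> C * norm (a + b)" using C that by blast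
          also have "\<dots> \<le> \<bar>C\<bar> * norm (a + b)" by (intro mult_right_mono) auto
          finally show ?thesis .
        qed
      qed (use y(2) in auto)
      also have "\<dots> \<le> (\<bar>C\<bar> + 1) * (K1 * dist x y powr e * norm v) + \<bar>C\<bar> * (K2 * dist x y powr e * norm v)"
        using 1 2 by (intro add_mono mult_left_mono) auto
      also have "\<dots> = K * dist x y powr e * norm v" by (simp add: K_def algebra_simps)
      finally show ?thesis .
    qed
    show ?case
      unfolding p prod.case
    proof (intro exI[of _ K] allI impI, elim conjE, intro conjI impI ballI, goal_cases)
      case (3 x y v)
      then show ?case by (intro main) simp_all
    qed
  qed
  from F.nearly_pair_sym[OF this] show ?thesis
  proof (rule F.nearly_pair_mono, goal_cases)
    case (1 K)
    have main: "subspace_dist (E i x) (E i y) \<le> K * dist x y powr e"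
      if "subspace (E i x)" "E i x \<noteq> {0}" "subspace (E i y)" "E i y \<noteq> {0}"
        "\<forall>v\<in>E i x. infdist v (E i y) \<le> K * dist x y powr e * norm v"
        "\<forall>v\<in>E i y. infdist v (E i x) \<le> K * dist x y powr e * norm v" for x y
      using that by (intro subspace_dist_le) simp_all
    show ?case
      by (intro exI[of _ K] allI impI, elim conjE, intro main) (simp_all add: dist_commute)
  qed
qed

section \<open>The exponents and the theorem\<close>

text \<open>The first entry belongs to the gap above the \<open>i\<close>-th exponent for the
  forward cocycle, the second to the gap below it for the inverse cocycle, whose rates have the
  opposite sign. As an intersection, \<open>E i x\<close> inherits the smaller one.\<close>

definition oseledets_exponent ::
    "real \<Rightarrow> real \<Rightarrow> real \<Rightarrow> nat \<Rightarrow> (nat \<Rightarrow> real) \<Rightarrow> nat \<Rightarrow> real" where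
  "oseledets_exponent \<nu> L L' k l i = min
     (gap_exponent (gap_lo l i) (gap_hi k l i) (max 0 (l k) + 6 + \<nu> * ln L))
     (gap_exponent (- gap_hi k l (i - 1)) (- gap_lo l (i - 1)) (max 0 (- l 1) + 6 + \<nu> * ln L'))"

lemma oseledets_exponent_bounds:
  assumes "strict_mono_on {1..k} l" "i \<in> {1..k}"
  shows "0 < oseledets_exponent \<nu> L L' k l i" "oseledets_exponent \<nu> L L' k l i < 1"
proof -
  have "gap_lo l i < gap_hi k l i" "- gap_hi k l (i - 1) < - gap_lo l (i - 1)"
    using gap_less[OF assms(1), of i] gap_less[OF assms(1), of "i - 1"] assms(2) by auto
  from gap_exponent_bounds[OF this(1)] gap_exponent_bounds[OF this(2)]
  show "0 < oseledets_exponent \<nu> L L' k l i" "oseledets_exponent \<nu> L L' k l i < 1"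
    unfolding oseledets_exponent_def by (auto simp only: min_less_iff_conj min_less_iff_disj)
qed

text \<open>In the theorem the exponents are passed as a list, and the function read off from the
  list agrees with \<open>lyap\<close> only on the indices from 1 to \<open>k\<close>.\<close>

lemma oseledets_exponent_cong:
  assumes "i \<in> {1..k}" "\<And>j. j \<in> {1..k} \<Longrightarrow> l j = l' j"
  shows "oseledets_exponent \<nu> L L' k l i = oseledets_exponent \<nu> L L' k l' i"
proof -
  have "l 1 = l' 1" "l k = l' k" using assms by auto
  moreover have gap: "gap_lo l j = gap_lo l' j" "gap_hi k l j = gap_hi k l' j" if "j \<le> k" for j
    using assms that by (auto simp: gap_lo_def gap_hi_def)
  moreover have "i \<le> k" "i - 1 \<le> k" using assms(1) by auto
  ultimately show ?thesis unfolding oseledets_exponent_def by metis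
qed

lemma lipschitz_constant_ge_1:
  fixes f :: "'m::metric_space \<Rightarrow> 'm"
  assumes "\<exists>L. L-lipschitz_on UNIV f"
  obtains L where "L \<ge> 1" "\<And>x y. dist (f x) (f y) \<le> L * dist x y"
proof -
  obtain L where L: "L-lipschitz_on UNIV f" using assms by blast
  have "dist (f x) (f y) \<le> max 1 L * dist x y" for x y
    using lipschitz_onD[OF L, of x y] mult_right_mono[of L "max 1 L" "dist x y"] by simp
  then show thesis using that[of "max 1 L"] by simp
qed

context
  fixes f :: "'m::metric_space \<Rightarrow> 'm" and \<nu> L L' :: real
    and \<mu> :: "'m measure" and A :: "'m \<Rightarrow> real^'d^'d" and k lyap F
  assumes nu: "\<nu> > 0" and L: "L \<ge> 1" "\<And>x y. dist (f x) (f y) \<le> L * dist x y"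
    and erg: "ergodic_borel_prob f \<mu>" and tight: "tight_measure \<mu>" and hoelder: "hoelder_cocycle \<nu> A"
    and int: "integrable \<mu> (\<lambda>x. ln (opnorm (A x)))" "integrable \<mu> (\<lambda>x. ln (opnorm (matrix_inv (A x))))"
    and os: "oseledets_filtration \<mu> f A k lyap F"
begin

lemma nearly_pair_filtration_exponent:
  assumes i: "i \<in> {1..k}"
  shows "prob_space.nearly_pair \<mu> (\<lambda>K x y. dist x y < 1 \<longrightarrow> subspace_dist (F i x) (F i y)
    \<le> K * dist x y powr (\<nu> * oseledets_exponent \<nu> L L' k lyap i))"
proof -
  interpret prob_space \<mu> using erg by (simp add: ergodic_borel_prob_def)
  obtain H where H: "hoelder_linear_cocycle \<mu> f (\<lambda>x. (*v) (A x)) (\<lambda>x. log_size (A x)) H L \<nu>"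
    by (rule hoelder_linear_cocycle_forward[OF erg nu hoelder int L])
  have inv: "invertible (A x)" for x using hoelder by (simp add: hoelder_cocycle_def)
  let ?e = "\<nu> * gap_exponent (gap_lo lyap i) (gap_hi k lyap i) (max 0 (lyap k) + 6 + \<nu> * ln L)"
  let ?w = "\<nu> * oseledets_exponent \<nu> L L' k lyap i"
  have e: "?w \<le> ?e" unfolding oseledets_exponent_def using nu by (intro mult_left_mono) auto
  from nearly_pair_filtration[OF H inv os i] show ?thesis
  proof (rule nearly_pair_mono)
    fix K
    have "K * dist x y powr ?e \<le> \<bar>K\<bar> * dist x y powr ?w" if "dist x y < 1" for x y :: 'm
      using that powr_mono'[OF e, of "dist x y"] by (intro mult_mono) auto
    then show "\<exists>C'. \<forall>x y. (dist x y < 1 \<longrightarrow> subspace_dist (F i x) (F i y) \<le> K * dist x y powr ?e) \<longrightarrow>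
        (dist x y < 1 \<longrightarrow> subspace_dist (F i x) (F i y) \<le> C' * dist x y powr ?w)"
      by (meson order_trans)
  qed
qed

lemma nearly_pair_splitting_exponent:
  assumes i: "i \<in> {1..k}" and bij: "bij f"
    and L': "L' \<ge> 1" "\<And>x y. dist (inv f x) (inv f y) \<le> L' * dist x y"
    and split: "oseledets_splitting \<mu> f A k lyap E"
  shows "prob_space.nearly_pair \<mu> (\<lambda>K x y. dist x y < 1 \<longrightarrow> subspace_dist (E i x) (E i y)
    \<le> K * dist x y powr (\<nu> * oseledets_exponent \<nu> L L' k lyap i))"
proof -
  obtain H where H: "hoelder_linear_cocycle \<mu> f (\<lambda>x. (*v) (A x)) (\<lambda>x. log_size (A x)) H L \<nu>"
    by (rule hoelder_linear_cocycle_forward[OF erg nu hoelder int L])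
  obtain H' where H': "hoelder_linear_cocycle \<mu> (inv f) (\<lambda>x. (*v) (matrix_inv (A (inv f x))))
      (\<lambda>x. log_size (A (inv f x))) H' L' \<nu>"
    by (rule hoelder_linear_cocycle_backward[OF erg nu hoelder int bij L'])
  have inv: "invertible (A x)" for x using hoelder by (simp add: hoelder_cocycle_def)
  show ?thesis
    by (rule nearly_pair_splitting[OF H H' inv os split i])
      (unfold oseledets_exponent_def, use nu in \<open>auto intro!: mult_left_mono simp del: One_nat_def\<close>)
qed

text \<open>Half of \<epsilon> is spent on the good event and half on its compact approximation. The
  distance \<open>D\<close> is arbitrary, so that it can stand for the filtration alone or for the
  filtration and the splitting together.\<close>

lemma compact_hoelder_set:
  assumes Q: "\<forall>i\<in>{1..k}. prob_space.nearly_pair \<mu> (\<lambda>K x y. dist x y < 1 \<longrightarrow> D i x y \<le> K * dist x y powr e i)"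
    and R: "AE x in \<mu>. R x" and \<epsilon>: "\<epsilon> > 0"
  obtains \<Lambda> C where "compact \<Lambda>" "measure \<mu> \<Lambda> \<ge> 1 - \<epsilon>" "C > 0" "\<And>x. x \<in> \<Lambda> \<Longrightarrow> R x"
    "\<And>x y i. x \<in> \<Lambda> \<Longrightarrow> y \<in> \<Lambda> \<Longrightarrow> i \<in> {1..k} \<Longrightarrow> dist x y < 1 \<Longrightarrow> D i x y \<le> C * dist x y powr e i"
proof -
  interpret prob_space \<mu> using erg by (simp add: ergodic_borel_prob_def)
  have mono: "C * dist x y powr e i \<le> C' * dist x y powr e i" if "C \<le> C'" for C C' x y i
    using that by (intro mult_right_mono) auto
  have "nearly_pair (\<lambda>K x y. \<forall>i\<in>{1..k}. dist x y < 1 \<longrightarrow> D i x y \<le> K * dist x y powr e i)"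
    by (rule nearly_pair_finite[OF finite_atLeastAtMost bspec[OF Q]]) (use mono order_trans in blast)+
  from nearly_pair_AE[OF this R] have "nearly_pair (\<lambda>K x y.
    (\<forall>i\<in>{1..k}. dist x y < 1 \<longrightarrow> D i x y \<le> K * dist x y powr e i) \<and> R x \<and> R y)" .
  moreover have h: "\<epsilon> / 2 > 0" using \<epsilon> by simp
  ultimately obtain S K where S: "S \<in> events" "prob S \<ge> 1 - \<epsilon> / 2"
    "\<forall>x\<in>S. \<forall>y\<in>S. (\<forall>i\<in>{1..k}. dist x y < 1 \<longrightarrow> D i x y \<le> K * dist x y powr e i) \<and> R x \<and> R y"
    unfolding nearly_pair_def by blast
  obtain \<Lambda> where \<Lambda>: "compact \<Lambda>" "\<Lambda> \<subseteq> S" "prob \<Lambda> \<ge> prob S - \<epsilon> / 2"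
    by (rule compact_inner_approx[OF prob_space_axioms sets_borel[OF erg nu hoelder int] tight S(1) h])
  show thesis
  proof (rule that)
    show "compact \<Lambda>" by fact
    show "prob \<Lambda> \<ge> 1 - \<epsilon>" using S(2) \<Lambda>(3) by simp
    show "max K 1 > 0" by simp
    show "R x" if "x \<in> \<Lambda>" for x using S(3) \<Lambda>(2) that by blast
    show "D i x y \<le> max K 1 * dist x y powr e i"
      if "x \<in> \<Lambda>" "y \<in> \<Lambda>" "i \<in> {1..k}" "dist x y < 1" for x y i
    proof -
      have "D i x y \<le> K * dist x y powr e i" using S(3) \<Lambda>(2) that by blast
      also have "\<dots> \<le> max K 1 * dist x y powr e i" by (rule mono) simp
      finally show ?thesis .
    qed
  qed
qed

end

theorem theorem1:
  fixes f :: "'m::metric_space \<Rightarrow> 'm" and \<nu> :: real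
  assumes lipschitz: "\<exists>L. L-lipschitz_on UNIV f"
    and nu_pos: "\<nu> > 0"
  shows "\<exists>\<omega> :: real list \<Rightarrow> nat \<Rightarrow> real.
    (\<forall>c i. 0 < \<omega> c i \<and> \<omega> c i < 1) \<and>
    (\<forall>(\<mu> :: 'm measure) (A :: 'm \<Rightarrow> real^'d^'d) k lyap F E.
       ergodic_borel_prob f \<mu> \<and> tight_measure \<mu> \<and>
       hoelder_cocycle \<nu> A \<and>
       integrable \<mu> (\<lambda>x. ln (opnorm (A x))) \<and>
       integrable \<mu> (\<lambda>x. ln (opnorm (matrix_inv (A x)))) \<and>
       oseledets_filtration \<mu> f A k lyap F
       \<longrightarrow>
       (\<forall>\<epsilon>>0. \<exists>\<Lambda>. \<exists>C>0. \<exists>\<delta>>0.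
          compact \<Lambda> \<and>
          measure \<mu> \<Lambda> \<ge> 1 - \<epsilon> \<and>
          (\<forall>x\<in>\<Lambda>. oseledets_filtration_at f A k lyap F x) \<and>
          (\<forall>x\<in>\<Lambda>. \<forall>y\<in>\<Lambda>. \<forall>i\<in>{1..k}. dist x y < \<delta> \<longrightarrow>
             subspace_dist (F i x) (F i y)
               \<le> C * dist x y powr (\<nu> * \<omega> (map lyap [1..<Suc k]) i)) \<and>
          (bij f \<and> (\<exists>L. L-lipschitz_on UNIV (inv f)) \<and> oseledets_splitting \<mu> f A k lyap E
           \<longrightarrow>
           (\<forall>x\<in>\<Lambda>. oseledets_splitting_at f A k lyap E x) \<and>
           (\<forall>x\<in>\<Lambda>. \<forall>y\<in>\<Lambda>. \<forall>i\<in>{1..k}. dist x y < \<delta> \<longrightarrow>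
              subspace_dist (E i x) (E i y)
                \<le> C * dist x y powr (\<nu> * \<omega> (map lyap [1..<Suc k]) i)))))"
proof -
  obtain L where L: "L \<ge> 1" "\<And>x y. dist (f x) (f y) \<le> L * dist x y"
    using lipschitz_constant_ge_1[OF lipschitz] by metis
  \<comment> \<open>The exponents must be fixed before it is known whether \<open>inv f\<close> is
    Lipschitz; if it is not, \<open>L'\<close> is arbitrary.\<close>
  obtain L' where L': "(\<exists>L. L-lipschitz_on UNIV (inv f)) \<Longrightarrow>
      L' \<ge> 1 \<and> (\<forall>x y. dist (inv f x) (inv f y) \<le> L' * dist x y)"
    using lipschitz_constant_ge_1[of "inv f"] by metis
  \<comment> \<open>Lists count from 0 and exponents from 1, hence the shift. The default 1/2
    secures the bounds on \<omega> for meaningless arguments.\<close>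
  define \<omega> where "\<omega> c i = (let k = length c; l = (\<lambda>j. c ! (j - 1)) in
    if strict_mono_on {1..k} l \<and> i \<in> {1..k} then oseledets_exponent \<nu> L L' k l i else 1 / 2)"
    for c :: "real list" and i
  have \<omega>: "\<omega> (map lyap [1..<Suc k]) i = oseledets_exponent \<nu> L L' k lyap i"
    if mono: "strict_mono_on {1..k} lyap" and i: "i \<in> {1..k}" for lyap k i
  proof -
    let ?l = "\<lambda>j. map lyap [1..<Suc k] ! (j - 1)"
    have l: "?l j = lyap j" if "j \<in> {1..k}" for j using that by (auto simp del: upt_Suc)
    have "strict_mono_on {1..k} ?l"
      using mono unfolding strict_mono_on_def by (simp add: l del: upt_Suc atLeastAtMost_iff One_nat_def)
    moreover have "length (map lyap [1..<Suc k]) = k" by (simp del: upt_Suc)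
    ultimately have "\<omega> (map lyap [1..<Suc k]) i = oseledets_exponent \<nu> L L' k ?l i"
      unfolding \<omega>_def Let_def using i by (simp only: simp_thms if_True)
    also have "\<dots> = oseledets_exponent \<nu> L L' k lyap i" by (rule oseledets_exponent_cong[OF i l])
    finally show ?thesis .
  qed
  show ?thesis
  proof (intro exI[of _ \<omega>] conjI allI impI, goal_cases)
    case (1 c i)
    show ?case unfolding \<omega>_def Let_def using oseledets_exponent_bounds(1) by auto
  next
    case (2 c i)
    show ?case unfolding \<omega>_def Let_def using oseledets_exponent_bounds(2) by auto
  next
    case (3 \<mu> A k lyap F E \<epsilon>)
    then have erg: "ergodic_borel_prob f \<mu>" and tight: "tight_measure \<mu>" and h: "hoelder_cocycle \<nu> A"
      and int: "integrable \<mu> (\<lambda>x. ln (opnorm (A x)))" "integrable \<mu> (\<lambda>x. ln (opnorm (matrix_inv (A x))))"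
      and os: "oseledets_filtration \<mu> f A k lyap F" and \<epsilon>: "\<epsilon> > 0"
      by blast+
    have mono: "strict_mono_on {1..k} lyap" and ae: "AE x in \<mu>. oseledets_filtration_at f A k lyap F x"
      using os by (simp_all add: oseledets_filtration_def)
    interpret prob_space \<mu> using erg by (simp add: ergodic_borel_prob_def)
    let ?e = "\<lambda>i. \<nu> * oseledets_exponent \<nu> L L' k lyap i"
    have F: "nearly_pair (\<lambda>K x y. dist x y < 1 \<longrightarrow> subspace_dist (F i x) (F i y) \<le> K * dist x y powr ?e i)"
      if "i \<in> {1..k}" for i
      by (rule nearly_pair_filtration_exponent[OF nu_pos L erg tight h int os that])
    then have F': "\<forall>i\<in>{1..k}. nearly_pair (\<lambda>K x y. dist x y < 1 \<longrightarrow>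
        subspace_dist (F i x) (F i y) \<le> K * dist x y powr ?e i)" by blast
    let ?inv = "bij f \<and> (\<exists>L. L-lipschitz_on UNIV (inv f)) \<and> oseledets_splitting \<mu> f A k lyap E"
    show ?case
    \<comment> \<open>One set \<Lambda> has to serve both conclusions, so it is decided before
      choosing \<Lambda> whether the splitting is present; if so, the maximum of the two distances
      is estimated.\<close>
    proof (cases ?inv)
      case False
      obtain \<Lambda> C where \<Lambda>: "compact \<Lambda>" "prob \<Lambda> \<ge> 1 - \<epsilon>" "C > 0"
        "\<And>x. x \<in> \<Lambda> \<Longrightarrow> oseledets_filtration_at f A k lyap F x"
        "\<And>x y i. x \<in> \<Lambda> \<Longrightarrow> y \<in> \<Lambda> \<Longrightarrow> i \<in> {1..k} \<Longrightarrow> dist x y < 1 \<Longrightarrow>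
          subspace_dist (F i x) (F i y) \<le> C * dist x y powr ?e i"
        using compact_hoelder_set[OF nu_pos L erg tight h int os F' ae \<epsilon>] by metis
      show ?thesis
      \<comment> \<open>\<delta> can be 1, because the estimates hold for all pairs of points of
        \<Lambda> at distance below 1.\<close>
      proof (rule exI[of _ \<Lambda>], rule exI[of _ C], rule conjI[OF \<Lambda>(3)], rule exI[of _ 1],
          rule conjI[OF zero_less_one], intro conjI ballI impI)
        show "subspace_dist (F i x) (F i y) \<le> C * dist x y powr (\<nu> * \<omega> (map lyap [1..<Suc k]) i)"
          if "x \<in> \<Lambda>" "y \<in> \<Lambda>" "i \<in> {1..k}" "dist x y < 1" for x y i
          using \<Lambda>(5)[OF that] by (simp only: \<omega>[OF mono that(3)])
      qed (use \<Lambda> False in blast)+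
    next
      case True
      then have bij: "bij f" and split: "oseledets_splitting \<mu> f A k lyap E"
        and Linv: "L' \<ge> 1" "\<And>x y. dist (inv f x) (inv f y) \<le> L' * dist x y"
        using L' by blast+
      have E: "nearly_pair (\<lambda>K x y. dist x y < 1 \<longrightarrow> subspace_dist (E i x) (E i y) \<le> K * dist x y powr ?e i)"
        if "i \<in> {1..k}" for i
        by (rule nearly_pair_splitting_exponent[OF nu_pos L erg tight h int os that bij Linv split])
      have FE: "nearly_pair (\<lambda>K x y. dist x y < 1 \<longrightarrow>
          max (subspace_dist (F i x) (F i y)) (subspace_dist (E i x) (E i y)) \<le> K * dist x y powr ?e i)"
        if i: "i \<in> {1..k}" for i
        using nearly_pair_conj[OF F[OF i] E[OF i]]
      proof (rule nearly_pair_mono, goal_cases)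
        case (1 p)
        obtain K1 K2 where p: "p = (K1, K2)" by (cases p)
        have "K1 * dist x y powr ?e i \<le> max K1 K2 * dist x y powr ?e i"
          "K2 * dist x y powr ?e i \<le> max K1 K2 * dist x y powr ?e i" for x y :: 'm
          by (intro mult_right_mono; simp)+
        then have "max (subspace_dist (F i x) (F i y)) (subspace_dist (E i x) (E i y)) \<le> max K1 K2 * dist x y powr ?e i"
          if "subspace_dist (F i x) (F i y) \<le> K1 * dist x y powr ?e i"
            "subspace_dist (E i x) (E i y) \<le> K2 * dist x y powr ?e i" for x y :: 'm
          using that by (intro max.boundedI) (blast intro: order_trans)+
        then show ?case
          unfolding p prod.case by blast
      qed
      then have FE': "\<forall>i\<in>{1..k}. nearly_pair (\<lambda>K x y. dist x y < 1 \<longrightarrow>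
          max (subspace_dist (F i x) (F i y)) (subspace_dist (E i x) (E i y)) \<le> K * dist x y powr ?e i)"
        by blast
      have ae': "AE x in \<mu>. oseledets_filtration_at f A k lyap F x \<and> oseledets_splitting_at f A k lyap E x"
        using ae split by (simp add: oseledets_splitting_def)
      obtain \<Lambda> C where \<Lambda>: "compact \<Lambda>" "prob \<Lambda> \<ge> 1 - \<epsilon>" "C > 0"
        "\<And>x. x \<in> \<Lambda> \<Longrightarrow> oseledets_filtration_at f A k lyap F x \<and> oseledets_splitting_at f A k lyap E x"
        "\<And>x y i. x \<in> \<Lambda> \<Longrightarrow> y \<in> \<Lambda> \<Longrightarrow> i \<in> {1..k} \<Longrightarrow> dist x y < 1 \<Longrightarrow>
          max (subspace_dist (F i x) (F i y)) (subspace_dist (E i x) (E i y)) \<le> C * dist x y powr ?e i"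
        using compact_hoelder_set[OF nu_pos L erg tight h int os FE' ae' \<epsilon>] by metis
      show ?thesis
      proof (rule exI[of _ \<Lambda>], rule exI[of _ C], rule conjI[OF \<Lambda>(3)], rule exI[of _ 1],
          rule conjI[OF zero_less_one], intro conjI ballI impI)
        fix x y i assume xy: "x \<in> \<Lambda>" "y \<in> \<Lambda>" "i \<in> {1..k}" "dist x y < 1"
        show "subspace_dist (F i x) (F i y) \<le> C * dist x y powr (\<nu> * \<omega> (map lyap [1..<Suc k]) i)"
          "subspace_dist (E i x) (E i y) \<le> C * dist x y powr (\<nu> * \<omega> (map lyap [1..<Suc k]) i)"
          using \<Lambda>(5)[OF xy] by (simp_all only: \<omega>[OF mono xy(3)] max.bounded_iff)
      qed (use \<Lambda> in blast)+
    qed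
  qed
qed

end
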